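(* Let $k\ge 3$ and let $\mathcal{S}_1,\ldots,\mathcal{S}_k$ be finite sets of points in $\mathbb{C}^n$. Assume that for every $i\neq j\in[k]$ and every $p_i\in\mathcal{S}_i$, $p_j\in\mathcal{S}_j$ with $p_i\neq p_j$, there exist $t\in[k]\setminus\{i,j\}$ and $p_t\in\mathcal{S}_t\setminus\{p_i,p_j\}$ such that $p_t,p_i,p_j$ are collinear. Then the affine span of $\bigcup_{i\in[k]}\mathcal{S}_i$ has dimension at most $3$.
   Formalization: The formal theorem additionally assumes that at least two of the sets S_1,…,S_k are nonempty; if only one is nonempty the collinearity assumption is vacuous and the claim fails, e.g. S_1 = five affinely independent points in C^4 and all other sets empty. *)

theory Defs
  imports "HOL-Analysis.Analysis"
begin

text \<open>
  The library's \<^const>\<open>affine\<close>, \<^const>\<open>collinear\<close> and \<^const>\<open>aff_dim\<close> refer to real scalars.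
  The following are their counterparts over the complex scalars of \<open>complex ^ 'n\<close>.
\<close>

definition complex_affine :: "(complex ^ 'n) set \<Rightarrow> bool" where
  "complex_affine A \<longleftrightarrow> (\<forall>x\<in>A. \<forall>y\<in>A. \<forall>u v. u + v = 1 \<longrightarrow> u *s x + v *s y \<in> A)"

definition complex_collinear :: "(complex ^ 'n) set \<Rightarrow> bool" where
  "complex_collinear A \<longleftrightarrow> (\<exists>u. \<forall>x\<in>A. \<forall>y\<in>A. \<exists>c. x - y = c *s u)"

text \<open>
  The dimension of a complex affine subspace is the complex dimension of its space of
  directions; as for \<^const>\<open>aff_dim\<close>, the empty set has dimension \<open>-1\<close>. The definition is
  meant for sets \<open>A\<close> with \<open>complex_affine A\<close>, for which the differences form a subspace.
\<close>

definition complex_affine_dim :: "(complex ^ 'n) set \<Rightarrow> int" where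
  "complex_affine_dim A =
     (if A = {} then - 1 else int (vec.dim {x - y | x y. x \<in> A \<and> y \<in> A}))"

end

theory Submission
  imports Defs
begin

text \<open>
  Supposing that the affine span has dimension at least 4, lift the points of a 4-dimensional flat
  to vectors spanning \<open>\<complex>\<^sup>5\<close>. Vectors spanning \<open>\<complex>\<^sup>D\<close> are brought into radial isotropic position:
  there are unit vectors \<open>u\<^sub>i\<close> along them with \<open>\<Sum> u\<^sub>i u\<^sub>i\<^sup>* = (n / D) I\<close>, so that
  \<open>\<Sum> \<bar>\<langle>u\<^sub>i, u\<^sub>j\<rangle>\<bar>\<^sup>2 = n\<^sup>2 / D\<close>. Here \<open>r\<close> points in a subspace of dimension \<open>d\<close> contribute at least
  \<open>r\<^sup>2 / d\<close>.

  If every line spanned by the points carries at least 4 of them, summing over all lines forces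
  \<open>D < 3\<close>. This is applied to the quotient by a line \<open>L\<close> meeting several colours: if \<open>L\<close> carries
  at least 4 points, then every 3-flat through \<open>L\<close> contains 4 occupied planes through \<open>L\<close>, because
  3 planes would give sumset relations between finite subsets of a torsion-free group. In
  \<open>D = 5\<close> the quotient has dimension 3, a contradiction, so every line meeting several colours
  carries exactly 3 points, of distinct colours. Then each such line contributes on average \<open>1/4\<close>
  for every ordered pair, whereas the pairs of equal colour contribute at least \<open>1/D\<close> on average;
  comparison with the total \<open>n\<^sup>2 / D\<close> gives \<open>D \<le> 4\<close>.
\<close>

section \<open>Radial isotropic position\<close>

text \<open>In units of a diagonal term, the correlations of all ordered pairs average exactly
  \<open>1 / D\<close>. On a line with \<open>r\<close> points the estimate
  \<open>r\<^sup>2 / 2\<close>, less \<open>r\<close> diagonal terms, is spread over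
  \<open>r * (r - 1)\<close> pairs, so off-diagonal pairs average at least
  \<open>(r - 2) / (2 * (r - 1))\<close>: this is 1/4 for three points and 1/3 for four. The value
  1/3 ties with \<open>1 / D\<close> at \<open>D = 3\<close>, where the diagonal terms break the
  tie; 1/4 ties at \<open>D = 4\<close>, so the contradiction is available at \<open>D = 5\<close>.
  The obstacle is that a line estimate involves all pairs on the line. It can be added to the
  estimate for colour classes only if a line meeting several colours carries no two points of equal
  colour, hence the separate treatment of lines with four or more points. Isotropic weights
  \<open>x\<close> arise by minimising the logarithm of det (\<Sum>
  \<open>x\<^sub>e e e\<^sup>*\<close>) minus \<open>D / n\<close> times \<Sum>
  \<open>ln x\<^sub>e\<close>. For the minimum to be attained, a proper nonzero subspace of
  dimension \<open>d\<close> must contain fewer than \<open>d * n / D\<close> points; this is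
  checked by counting third points on lines joining the subspace to points outside it.\<close>

definition cip :: "complex ^ 'm \<Rightarrow> complex ^ 'm \<Rightarrow> complex" where
  "cip u w = (\<Sum>a\<in>UNIV. cnj (u $ a) * w $ a)"

definition frame_matrix :: "(complex ^ 'm) set \<Rightarrow> (complex ^ 'm \<Rightarrow> real) \<Rightarrow> complex ^ 'm ^ 'm" where
  "frame_matrix E x = (\<chi> a b. \<Sum>e\<in>E. of_real (x e) * (e $ a * cnj (e $ b)))"

lemma cip_add_right: "cip u (v + w) = cip u v + cip u w"
  by (simp add: cip_def distrib_left sum.distrib)

lemma cip_diff_right: "cip u (v - w) = cip u v - cip u w"
  by (simp add: cip_def right_diff_distrib sum_subtractf)

lemma cip_scale_right: "cip u (c *s w) = c * cip u w"
  by (simp add: cip_def sum_distrib_left mult_ac)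

lemma cip_commute: "cnj (cip u w) = cip w u"
  by (simp add: cip_def mult.commute)

lemma cip_sum_right: "cip u (\<Sum>e\<in>E. f e) = (\<Sum>e\<in>E. cip u (f e))"
  by (simp add: cip_def sum_component sum_distrib_left) (rule sum.swap)

lemma cip_zero_right [simp]: "cip u 0 = 0"
  by (simp add: cip_def)

lemma cip_self: "cip u u = of_real (\<Sum>a\<in>UNIV. (cmod (u $ a))\<^sup>2)"
  by (simp add: cip_def complex_norm_square[symmetric] mult.commute)

lemma cip_self_eq_0: "cip u u = 0 \<longleftrightarrow> u = 0"
proof
  assume "cip u u = 0"
  then have "(\<Sum>a\<in>UNIV. (cmod (u $ a))\<^sup>2) = 0"
    unfolding cip_self by (simp only: of_real_eq_0_iff)
  then have "\<forall>a\<in>UNIV. (cmod (u $ a))\<^sup>2 = 0"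
    by (subst (asm) sum_nonneg_eq_0_iff) auto
  then show "u = 0"
    by (simp add: vec_eq_iff)
qed simp

lemma frame_matrix_mult:
  "frame_matrix E x *v u = (\<Sum>e\<in>E. (of_real (x e) * cip e u) *s e)"
proof -
  have "(frame_matrix E x *v u) $ a = (\<Sum>e\<in>E. (of_real (x e) * cip e u) *s e) $ a" for a
  proof -
    have "(frame_matrix E x *v u) $ a
        = (\<Sum>b\<in>UNIV. \<Sum>e\<in>E. of_real (x e) * (e $ a * cnj (e $ b)) * u $ b)"
      by (simp add: frame_matrix_def matrix_vector_mult_def sum_distrib_right)
    also have "\<dots> = (\<Sum>e\<in>E. \<Sum>b\<in>UNIV. of_real (x e) * (e $ a * cnj (e $ b)) * u $ b)"
      by (rule sum.swap)
    also have "\<dots> = (\<Sum>e\<in>E. of_real (x e) * cip e u * e $ a)"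
      by (simp add: cip_def sum_distrib_left sum_distrib_right mult_ac)
    finally show ?thesis by (simp add: sum_component)
  qed
  then show ?thesis by (simp add: vec_eq_iff)
qed

lemma cip_frame_matrix:
  "cip u (frame_matrix E x *v w) = (\<Sum>e\<in>E. of_real (x e) * (cip u e * cip e w))"
  by (simp add: frame_matrix_mult cip_sum_right cip_scale_right mult_ac)

section \<open>Determinants under rank-one updates\<close>

text \<open>The matrix determinant lemma. The identity matrix with column \<open>k\<close> replaced
  by \<open>u\<close> is \<open>T\<close>; it conjugates the update into one that alters only row
  \<open>k\<close>, whose determinant is a case of Cramer's rule. Choosing \<open>u $ k\<close>
  nonzero makes \<open>det T\<close> cancellable.\<close>

lemma det_rank_one_update:
  fixes u w :: "'a::field ^ 'm"
  shows "det (mat 1 + (\<chi> a b. u $ a * w $ b)) = 1 + (\<Sum>a\<in>UNIV. w $ a * u $ a)"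
proof (cases "u = 0")
  case True
  then have "(\<chi> a b. u $ a * w $ b) = (0 :: 'a ^ 'm ^ 'm)"
    by (simp add: vec_eq_iff)
  with True show ?thesis by simp
next
  case False
  then obtain k where k: "u $ k \<noteq> 0" by (auto simp: vec_eq_iff)
  define T :: "'a ^ 'm ^ 'm" where "T = (\<chi> i j. if j
    = k then u $ i else (mat 1 :: 'a ^ 'm ^ 'm) $ i $ j)"
  have detT: "det T = u $ k"
    using cramer_lemma[where A="mat 1 :: 'a ^ 'm ^ 'm" and x=u and k=k]
      by (simp add: T_def cong: if_cong)
  define w' where "w' = (\<chi> b. \<Sum>c\<in>UNIV. w $ c * T $ c $ b)"
  define N :: "'a ^ 'm ^ 'm" where "N = mat 1 + (\<chi> a b. axis k 1 $ a * w' $ b)"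
  have Tk: "T $ i $ k = u $ i" for i by (simp add: T_def)
  have 1: "(mat 1 + (\<chi> a b. u $ a * w $ b)) ** T = T ** N"
  proof -
    have "(\<chi> a b. u $ a * w $ b) ** T = T ** (\<chi> a b. axis k 1 $ a * w' $ b)"
    proof -
      have "(\<Sum>c\<in>UNIV. u $ i * w $ c * T $ c $ j)
        = (\<Sum>c\<in>UNIV. T $ i $ c * (axis k 1 $ c * w' $ j))" for i j
      proof -
        have "(\<Sum>c\<in>UNIV. T $ i $ c * (axis k 1 $ c * w' $ j))
            = (\<Sum>c\<in>UNIV. if c = k then T $ i $ c * w' $ j else 0)"
          by (rule sum.cong) (auto simp: axis_def)
        also have "\<dots> = u $ i * w' $ j" by (simp add: Tk)
        finally show ?thesis by (simp add: w'_def sum_distrib_left mult_ac)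
      qed
      then show ?thesis by (simp add: matrix_matrix_mult_def vec_eq_iff)
    qed
    moreover have "(A + B) ** T = A ** T + B ** T" for A B :: "'a ^ 'm ^ 'm"
      by (simp add: matrix_matrix_mult_def vec_eq_iff distrib_right sum.distrib)
    ultimately show ?thesis
      by (simp add: N_def matrix_add_ldistrib)
  qed
  have "det N = 1 + w' $ k"
  proof -
    have "N = (\<chi> i. if i = k then (\<Sum>j\<in>UNIV. (axis k 1 + w') $ j *s row j (mat 1 :: 'a ^ 'm ^ 'm))
        else row i (mat 1 :: 'a ^ 'm ^ 'm))"
      by (auto simp: N_def vec_eq_iff axis_def row_def mat_def sum_component if_distrib cong:
        if_cong)
    then have "det N = (axis k 1 + w') $ k * det (mat 1 :: 'a ^ 'm ^ 'm)"
      by (simp only: cramer_lemma_transpose)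
    then show ?thesis by (simp add: axis_def)
  qed
  moreover have "det (mat 1 + (\<chi> a b. u $ a * w $ b)) * u $ k = u $ k * det N"
    using arg_cong[OF 1, of det] by (simp only: det_mul detT)
  ultimately have "det (mat 1 + (\<chi> a b. u $ a * w $ b)) = 1 + w' $ k"
    using k by simp
  then show ?thesis by (simp add: w'_def Tk)
qed


text \<open>Factoring out \<open>M\<close> leaves a rank-one update of the identity. For a frame
  matrix this shows that the determinant is affine in each single weight, with slope governed by the
  inverse matrix.\<close>

lemma det_add_outer:
  fixes M :: "complex ^ 'm ^ 'm"
  assumes "M ** N = mat 1"
  shows "det (M + (\<chi> a b. s * (e $ a * cnj (e $ b)))) = det M * (1 + s * cip e (N *v e))"
proof -
  define u where "u = N *v (s *s e)"
  define w :: "complex ^ 'm" where "w = (\<chi> b. cnj (e $ b))"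
  have Mu: "M *v u = s *s e"
    by (simp add: u_def matrix_vector_mul_assoc assms)
  have "(\<chi> a b. s * (e $ a * cnj (e $ b))) = M ** (\<chi> a b. u $ a * w $ b)"
  proof -
    have "(\<Sum>c\<in>UNIV. M $ a $ c * (u $ c * w $ b)) = s * (e $ a * cnj (e $ b))" for a b
    proof -
      have "(\<Sum>c\<in>UNIV. M $ a $ c * (u $ c * w $ b)) = (M *v u) $ a * w $ b"
        by (simp add: matrix_vector_mult_def sum_distrib_left sum_distrib_right mult_ac)
      then show ?thesis by (simp add: Mu w_def mult_ac)
    qed
    then show ?thesis by (simp add: matrix_matrix_mult_def vec_eq_iff)
  qed
  then have "M + (\<chi> a b. s * (e $ a * cnj (e $ b))) = M ** (mat 1 + (\<chi> a b. u $ a * w $ b))"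
    by (simp add: matrix_add_ldistrib)
  then have "det (M + (\<chi> a b. s * (e $ a * cnj (e $ b)))) = det M * (1 + (\<Sum>a\<in>UNIV. w $ a * u $ a))"
    by (simp add: det_mul det_rank_one_update)
  also have "(\<Sum>a\<in>UNIV. w $ a * u $ a) = s * cip e (N *v e)"
    by (simp add: u_def w_def cip_def matrix_vector_mult_scaleR vec.scale sum_distrib_left mult_ac)
  finally show ?thesis .
qed

section \<open>The inner product attached to a weighted frame\<close>

locale frame =
  fixes E :: "(complex ^ 'm) set" and x :: "complex ^ 'm \<Rightarrow> real"
  assumes finite_E: "finite E"
    and span_E: "vec.span E = UNIV"
    and x_pos: "\<And>e. e \<in> E \<Longrightarrow> 0 < x e"
begin

abbreviation "M \<equiv> frame_matrix E x"

lemma cip_M_self: "cip u (M *v u) = of_real (\<Sum>e\<in>E. x e * (cmod (cip e u))\<^sup>2)"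
proof -
  have "cip u e * cip e u = of_real ((cmod (cip e u))\<^sup>2)" for e
    by (metis cip_commute complex_norm_square mult.commute)
  then show ?thesis by (simp add: cip_frame_matrix)
qed

text \<open>If the sum vanished, \<open>u\<close> would be orthogonal to every vector of
  \<open>E\<close>, hence to their span, which contains \<open>u\<close> itself.\<close>

lemma M_self_pos:
  assumes "u \<noteq> 0"
  shows "0 < (\<Sum>e\<in>E. x e * (cmod (cip e u))\<^sup>2)"
proof (rule ccontr)
  assume "\<not> ?thesis"
  moreover have "0 \<le> (\<Sum>e\<in>E. x e * (cmod (cip e u))\<^sup>2)"
    by (intro sum_nonneg mult_nonneg_nonneg) (auto simp: x_pos less_imp_le)
  ultimately have "(\<Sum>e\<in>E. x e * (cmod (cip e u))\<^sup>2) = 0" by simp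
  then have "\<forall>e\<in>E. x e * (cmod (cip e u))\<^sup>2 = 0"
    by (subst (asm) sum_nonneg_eq_0_iff) (auto simp: finite_E x_pos less_imp_le)
  then have "\<forall>e\<in>E. cip e u = 0"
    using x_pos by fastforce
  then have "\<forall>e\<in>E. cip u e = 0"
    by (metis cip_commute complex_cnj_zero)
  moreover have "vec.subspace {w. cip u w = 0}"
    by (auto simp: vec.subspace_def cip_add_right cip_scale_right)
  ultimately have "vec.span E \<subseteq> {w. cip u w = 0}"
    by (intro vec.span_minimal) auto
  then show False
    using span_E cip_self_eq_0 assms by auto
qed

definition "N = matrix_inv M"

lemma invertible_M: "invertible M"
proof -
  have "\<forall>u. M *v u = 0 \<longrightarrow> u = 0"
  proof (intro allI impI, rule ccontr)
    fix u assume "M *v u = 0" "u \<noteq> 0"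
    then show False
      using M_self_pos[of u] cip_M_self[of u] by (metis cip_zero_right of_real_eq_0_iff less_irrefl)
  qed
  then show ?thesis
    by (simp add: invertible_left_inverse matrix_left_invertible_ker)
qed

lemma M_N: "M ** N = mat 1" and N_M: "N ** M = mat 1"
  using someI_ex[OF invertible_M[unfolded invertible_def]]
  by (auto simp: N_def matrix_inv_def)

lemma M_N_mult: "M *v (N *v u) = u" and N_M_mult: "N *v (M *v u) = u"
  by (simp_all add: matrix_vector_mul_assoc M_N N_M)

lemma det_M_nz: "det M \<noteq> 0"
  using invertible_M invertible_det_nz by blast

text \<open>The inner product for which the weighted frame is a Parseval frame.\<close>

definition B :: "complex ^ 'm \<Rightarrow> complex ^ 'm \<Rightarrow> complex" where
  "B u w = cip u (N *v w)"

lemma B_commute: "cnj (B u w) = B w u"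
proof -
  have sym: "cnj (cip a (M *v b)) = cip b (M *v a)" for a b
    by (simp add: cip_frame_matrix cip_commute mult_ac)
  have "B u w = cip (N *v u) (M *v (N *v w))" for u w
  proof -
    have "B u w = cip (M *v (N *v u)) (N *v w)" by (simp add: B_def M_N_mult)
    also have "\<dots> = cnj (cip (N *v w) (M *v (N *v u)))" by (simp add: cip_commute)
    also have "\<dots> = cip (N *v u) (M *v (N *v w))" by (rule sym)
    finally show ?thesis .
  qed
  then show ?thesis using sym by simp
qed

lemma B_add_right: "B u (v + w) = B u v + B u w"
  and B_diff_right: "B u (v - w) = B u v - B u w"
  and B_scale_right: "B u (c *s w) = c * B u w"
  by (simp_all add: B_def vec.add vec.diff vec.scale cip_add_right cip_diff_right cip_scale_right)

lemma B_diff_left: "B (u - v) w = B u w - B v w"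
  and B_scale_left: "B (c *s u) w = cnj c * B u w"
  by (metis B_commute B_diff_right complex_cnj_diff)
     (metis B_commute B_scale_right complex_cnj_mult)

lemma B_zero_right [simp]: "B u 0 = 0"
  by (simp add: B_def)

lemma B_self:
  obtains r where "B u u = of_real r" "0 \<le> r" "u \<noteq> 0 \<longrightarrow> 0 < r"
proof -
  let ?r = "\<Sum>e\<in>E. x e * (cmod (cip e (N *v u)))\<^sup>2"
  have "B u u = cnj (B u u)" by (rule B_commute[symmetric])
  also have "\<dots> = cip (N *v u) (M *v (N *v u))"
    by (simp add: B_def cip_commute M_N_mult)
  finally have 1: "B u u = of_real ?r"
    by (simp only: cip_M_self)
  have "0 < ?r" if "u \<noteq> 0"
    using that M_N_mult[of u] by (intro M_self_pos) auto
  moreover have "0 \<le> ?r"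
    by (intro sum_nonneg mult_nonneg_nonneg) (auto simp: x_pos less_imp_le)
  ultimately show ?thesis using that 1 by blast
qed

text \<open>This is \<open>N = N M N\<close> with the middle factor expanded over the frame.\<close>

lemma B_reproducing: "(\<Sum>e\<in>E. of_real (x e) * (B u e * B e w)) = B u w"
proof -
  have "B u w = cip u (N *v (M *v (N *v w)))"
    by (simp add: B_def M_N_mult)
  also have "M *v (N *v w) = (\<Sum>e\<in>E. (of_real (x e) * cip e (N *v w)) *s e)"
    by (simp add: frame_matrix_mult)
  also have "cip u (N *v \<dots>) = (\<Sum>e\<in>E. of_real (x e) * (B u e * B e w))"
    by (simp add: vec.sum vec.scale cip_sum_right cip_scale_right B_def mult_ac)
  finally show ?thesis by simp
qed

text \<open>Gram-Schmidt by induction on the dimension: normalise one vector \<open>f\<close> of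
  \<open>W\<close> and recurse into its \<open>B\<close>-orthogonal complement in \<open>W\<close>.
  The outcome is stated as an expansion formula with a bound on \<open>card F\<close>, the form in
  which the trace estimate consumes it.\<close>

lemma Parseval:
  assumes "vec.subspace W"
  shows "\<exists>F. finite F \<and> F \<subseteq> W \<and> card F \<le> vec.dim W \<and> (\<forall>u\<in>W. \<forall>w\<in>W. B u w = (\<Sum>f\<in>F. B u f * B f w))"
  using assms
proof (induction "vec.dim W" arbitrary: W rule: less_induct)
  case (less W)
  show ?case
  proof (cases "W \<subseteq> {0}")
    case True
    then show ?thesis by (intro exI[of _ "{}"]) auto
  next
    case False
    then obtain g where g: "g \<in> W" "g \<noteq> 0" by auto
    obtain r where r: "B g g = of_real r" "0 < r" using B_self[of g] g(2) by metis
    define f where "f = of_real (1 / sqrt r) *s g"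
    have f: "f \<in> W" using g(1) less.prems by (simp add: f_def vec.subspace_scale)
    have ff: "B f f = 1"
    proof -
      have "B f f = cnj (of_real (1 / sqrt r)) * (of_real (1 / sqrt r) * of_real r)"
        by (simp only: f_def B_scale_left B_scale_right r(1) mult_ac)
      also have "\<dots> = of_real (1 / sqrt r * (1 / sqrt r) * r)"
        by (simp only: complex_cnj_complex_of_real of_real_mult mult.assoc)
      also have "1 / sqrt r * (1 / sqrt r) * r = 1"
        using r(2) by simp
      finally show ?thesis by simp
    qed
    define W' where "W' = {w \<in> W. B f w = 0}"
    have W': "vec.subspace W'"
      using less.prems by (auto simp: W'_def vec.subspace_def B_add_right B_scale_right)
    have "f \<notin> W'" using ff by (simp add: W'_def)
    then have "W' \<subset> W" using f by (auto simp: W'_def)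
    then have dim: "vec.dim W' < vec.dim W"
      by (intro vec.dim_psubset) (metis W' less.prems vec.span_eq_iff)
    then obtain F where F: "finite F" "F \<subseteq> W'" "card F \<le> vec.dim W'"
      "\<And>u w. u \<in> W' \<Longrightarrow> w \<in> W' \<Longrightarrow> B u w = (\<Sum>e\<in>F. B u e * B e w)"
      using less.hyps[OF dim W'] by blast
    \<comment> \<open>Orthogonal projection along \<open>f\<close>: applying the induction
      hypothesis to \<open>P u\<close> and \<open>P w\<close> accounts for everything except the
      term of \<open>f\<close>.\<close>
    define P where "P w = w - B f w *s f" for w
    have P: "P w \<in> W'" if "w \<in> W" for w
      using that f less.prems ff
      by (auto simp: P_def W'_def B_diff_right B_scale_right intro: vec.subspace_diff
        vec.subspace_scale)
    have *: "B u w = (\<Sum>e\<in>insert f F. B u e * B e w)" if "u \<in> W" "w \<in> W" for u w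
    proof -
      have fe: "B f e = 0" "B e f = 0" if "e \<in> F" for e
        using F(2) that B_commute[of f e] by (auto simp: W'_def)
      have "B (P u) e = B u e" "B e (P w) = B e w" if "e \<in> F" for e
        using fe[OF that] by (auto simp: P_def B_diff_left B_diff_right B_scale_left B_scale_right)
      then have "B (P u) (P w) = (\<Sum>e\<in>F. B u e * B e w)"
        using F(4)[OF P[OF that(1)] P[OF that(2)]] by simp
      moreover have "B (P u) (P w) = B u w - B u f * B f w"
        using ff by (simp add: P_def B_diff_left B_diff_right B_scale_left B_scale_right B_commute)
      moreover have "f \<notin> F"
        using fe ff by force
      ultimately show ?thesis
        using F(1) by (simp add: diff_eq_eq add.commute)
    qed
    show ?thesis
    proof (intro exI[of _ "insert f F"] conjI ballI)
      show "insert f F \<subseteq> W"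
        using f F(2) by (auto simp: W'_def)
      show "card (insert f F) \<le> vec.dim W"
        using F(1,3) dim by (auto simp: card_insert_if)
    qed (use F(1) * in auto)
  qed
qed

end


section \<open>Subframes and greedy bases\<close>

lemma frame_matrix_insert:
  assumes "finite E" "e \<notin> E"
  shows "frame_matrix (insert e E) x
    = frame_matrix E x + (\<chi> a b. of_real (x e) * (e $ a * cnj (e $ b)))"
  using assms by (simp add: frame_matrix_def vec_eq_iff)

text \<open>Vectors are added one at a time, each multiplying the determinant by
  \<open>1 + x e * B e e\<close>, which is at least 1. Since \<open>J\<close> spans, the matrix is
  invertible at every stage.\<close>

lemma cmod_det_frame_matrix_mono:
  assumes "finite E" "J \<subseteq> E" "vec.span J = UNIV" "\<And>e. e \<in> E \<Longrightarrow> 0 < x e"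
  shows "cmod (det (frame_matrix J x)) \<le> cmod (det (frame_matrix E x))"
proof -
  have "finite K \<Longrightarrow> K \<subseteq> E - J \<Longrightarrow> cmod (det (frame_matrix J x))
    \<le> cmod (det (frame_matrix (J \<union> K) x))" for K
  proof (induction K rule: finite_induct)
    case (insert e K)
    interpret frame "J \<union> K" x
    proof
      show "finite (J \<union> K)" using assms insert.hyps finite_subset by blast
      show "vec.span (J \<union> K) = UNIV" using assms(3) vec.span_mono[of J "J \<union> K"] by auto
    qed (use assms insert.prems in auto)
    obtain r where r: "B e e = of_real r" "0 \<le> r" using B_self by metis
    have "frame_matrix (J \<union> insert e K) x = M + (\<chi> a b. of_real (x e) * (e $ a * cnj (e $ b)))"
      using frame_matrix_insert[of "J \<union> K" e x] finite_E insert by simp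
    then have "det (frame_matrix (J \<union> insert e K) x) = det M * (1 + of_real (x e) * B e e)"
      by (simp add: det_add_outer[OF M_N] B_def)
    also have "\<dots> = det M * of_real (1 + x e * r)"
      by (simp add: r)
    finally have "cmod (det (frame_matrix (J \<union> insert e K) x)) = cmod (det M) * \<bar>1 + x e * r\<bar>"
      by (simp only: norm_mult norm_of_real)
    moreover have "0 \<le> x e * r"
      using assms(4)[of e] insert.prems r(2) by (intro mult_nonneg_nonneg) auto
    ultimately have "cmod (det M) \<le> cmod (det (frame_matrix (J \<union> insert e K) x))"
      by (simp add: mult_le_cancel_left1)
    then show ?case using insert by auto
  qed simp
  from this[of "E - J"] assms(1,2) show ?thesis
    by (simp add: Un_absorb1)
qed

text \<open>For a basis the frame matrix is a product of two square matrices, with the weights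
  scaling the rows of the second, so they leave the determinant as a product.\<close>

lemma det_frame_matrix_basis:
  fixes J :: "(complex ^ 'm) set"
  assumes "vec.independent J" "vec.span J = UNIV"
  shows "det (frame_matrix J x) = of_real (\<Prod>e\<in>J. x e) * det (frame_matrix J (\<lambda>_. 1))"
proof -
  have "finite J" using assms(1) vec.finiteI_independent by blast
  moreover have "card J = CARD('m)"
    by (metis assms vec.dim_eq_card_independent vec.dim_span vec_dim_card)
  ultimately obtain \<beta> where \<beta>: "bij_betw \<beta> (UNIV :: 'm set) J"
    by (metis finite_UNIV finite_same_card_bij finite)
  define V :: "complex ^ 'm ^ 'm" where "V = (\<chi> a k. \<beta> k $ a)"
  have "frame_matrix J x = V ** (\<chi> k. of_real (x (\<beta> k)) *s (\<chi> b. cnj (\<beta> k $ b)))" for x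
  proof -
    have "(\<Sum>e\<in>J. of_real (x e) * (e $ a * cnj (e $ b)))
        = (\<Sum>k\<in>UNIV. \<beta> k $ a * (of_real (x (\<beta> k)) * cnj (\<beta> k $ b)))" for a b
      by (subst sum.reindex_bij_betw[OF \<beta>, symmetric]) (simp add: mult_ac)
    then show ?thesis
      by (simp add: frame_matrix_def V_def matrix_matrix_mult_def vec_eq_iff)
  qed
  then have "det (frame_matrix J x)
      = (\<Prod>k\<in>UNIV. of_real (x (\<beta> k))) * (det V * det (\<chi> k. (\<chi> b. cnj (\<beta> k $ b))))" for x
    by (simp add: det_mul det_rows_mul mult_ac)
  then show ?thesis
    by (simp add: prod.reindex_bij_betw[OF \<beta>] flip: of_real_prod)
qed

text \<open>
  Abel summation. To avoid sorting, the coefficient of the smallest \<open>t i\<close> is moved to the next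
  smallest.
\<close>

lemma sum_mult_nonneg_of_upper_sums:
  fixes a t :: "'i \<Rightarrow> real"
  assumes "finite I" "sum a I = 0" "\<And>s. 0 \<le> (\<Sum>i | i \<in> I \<and> s \<le> t i. a i)"
  shows "0 \<le> (\<Sum>i\<in>I. a i * t i)"
  using assms
proof (induction "card I" arbitrary: I a)
  case 0
  then show ?case by simp
next
  case (Suc n)
  then have "I \<noteq> {}" by auto
  then obtain p where p: "p \<in> I" "\<And>i. i \<in> I \<Longrightarrow> t p \<le> t i"
    using arg_min_if_finite[of I t] Suc.prems(1) by (metis not_le)
  define I' where "I' = I - {p}"
  have I: "I = insert p I'" "p \<notin> I'" "finite I'" "card I' = n"
    using p(1) Suc.prems(1) Suc.hyps(2) by (auto simp: I'_def)
  show ?case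
  proof (cases "I' = {}")
    case True
    then show ?thesis using Suc.prems(2) I by simp
  next
    case False
    then obtain q where q: "q \<in> I'" "\<And>i. i \<in> I' \<Longrightarrow> t q \<le> t i"
      using arg_min_if_finite[of I' t] I(3) by (metis not_le)
    define a' where "a' = a(q := a q + a p)"
    have sum': "(\<Sum>i\<in>K. a' i * c i) = (\<Sum>i\<in>K. a i * c i) + (if q \<in> K then a p * c q else 0)"
      if "finite K" for K and c :: "'i \<Rightarrow> real"
    proof -
      have "(\<Sum>i\<in>K. a' i * c i) = (\<Sum>i\<in>K. a i * c i + (if i = q then a p * c q else 0))"
        by (rule sum.cong) (auto simp: a'_def algebra_simps)
      then show ?thesis using that by (simp add: sum.distrib)
    qed
    note sum'1 = sum'[of _ "\<lambda>_. 1", simplified]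
    have 1: "sum a' I' = 0"
      using Suc.prems(2) I q(1) by (simp add: sum'1)
    have 2: "0 \<le> (\<Sum>i | i \<in> I' \<and> s \<le> t i. a' i)" for s
    proof (cases "s \<le> t q")
      case True
      then have "{i. i \<in> I' \<and> s \<le> t i} = I'" using q(2) by force
      then show ?thesis using 1 by simp
    next
      case False
      moreover have "t p \<le> t q" using p(2) q(1) by (auto simp: I'_def)
      ultimately have "{i. i \<in> I' \<and> s \<le> t i} = {i. i \<in> I \<and> s \<le> t i}" by (auto simp: I(1))
      moreover have "(\<Sum>i | i \<in> I' \<and> s \<le> t i. a' i) = (\<Sum>i | i \<in> I' \<and> s \<le> t i. a i)"
        using False I(3) by (subst sum'1) auto
      ultimately show ?thesis using Suc.prems(3)[of s] by simp
    qed
    have "0 \<le> (\<Sum>i\<in>I'. a' i * t i)"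
      using Suc.hyps(1)[of I' a'] I 1 2 by simp
    also have "\<dots> = (\<Sum>i\<in>I'. a i * t i) + a p * t q"
      using I(3) q(1) by (simp add: sum')
    also have "\<dots> = (\<Sum>i\<in>I. a i * t i) + a p * (t q - t p)"
      using I by (simp add: algebra_simps)
    \<comment> \<open>If \<open>t p < t q\<close>, the upper set at height \<open>t q\<close> is all
      of \<open>I'\<close>, so \<open>a\<close> has nonnegative sum there; as the total over
      \<open>I\<close> is zero, \<open>a p\<close> is at most zero.\<close>
    also have "a p * (t q - t p) \<le> 0"
    proof (cases "t q = t p")
      case False
      then have less: "t p < t q" using p(2) q(1) by (fastforce simp: I'_def)
      then have "{i. i \<in> I \<and> t q \<le> t i} = I'" using q(2) by (auto simp: I(1))
      then have "0 \<le> sum a I'" using Suc.prems(3)[of "t q"] by simp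
      then have "a p \<le> 0" using Suc.prems(2) I by simp
      then show ?thesis using less by (simp add: mult_nonpos_nonneg)
    qed simp
    finally show ?thesis by simp
  qed
qed

text \<open>A basis maximising the sum of \<open>t\<close> has this property by exchange.\<close>

lemma greedy_basis:
  fixes E :: "(complex ^ 'm) set" and t :: "complex ^ 'm \<Rightarrow> real"
  assumes "finite E" "vec.span E = UNIV"
  obtains J where "J \<subseteq> E" "vec.independent J" "vec.span J = UNIV"
    "\<And>e. e \<in> E \<Longrightarrow> e \<in> vec.span {j \<in> J. t e \<le> t j}"
proof -
  define \<J> where "\<J> = {J. J \<subseteq> E \<and> vec.independent J \<and> vec.span J = UNIV}"
  have "finite \<J>" using assms(1) by (auto simp: \<J>_def)
  moreover have "\<J> \<noteq> {}"
  proof -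
    obtain J where "J \<subseteq> E" "vec.independent J" "E \<subseteq> vec.span J"
      using vec.maximal_independent_subset by blast
    moreover have "vec.span E \<subseteq> vec.span J"
      using calculation by (intro vec.span_minimal) auto
    ultimately show ?thesis using assms(2) by (auto simp: \<J>_def)
  qed
  ultimately obtain J where J: "J \<in> \<J>" "\<And>K. K \<in> \<J> \<Longrightarrow> sum t K \<le> sum t J"
    using arg_min_if_finite[of \<J> "\<lambda>K. - sum t K"] by (metis neg_less_iff_less not_le)
  have fin: "finite J" using J(1) assms(1) finite_subset by (auto simp: \<J>_def)
  have "e \<in> vec.span {j \<in> J. t e \<le> t j}" if e: "e \<in> E" for e
  proof (rule ccontr)
    let ?S = "{j \<in> J. t e \<le> t j}"
    assume neg: "e \<notin> vec.span ?S"
    have "vec.independent ?S"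
      using J(1) vec.independent_mono by (force simp: \<J>_def)
    then have "vec.independent (insert e ?S)"
      using neg by (rule vec.independent_insertI[rotated])
    \<comment> \<open>This basis exchanges exactly one \<open>j\<close> of \<open>J\<close> for
      \<open>e\<close>. As \<open>j\<close> lies outside \<open>?S\<close>, it has
      \<open>t j < t e\<close>, so \<open>K\<close> beats the maximal sum.\<close>
    then obtain K where K: "insert e ?S \<subseteq> K" "K \<subseteq> insert e J" "vec.independent K" "insert e J
      \<subseteq> vec.span K"
      using vec.maximal_independent_subset_extend[of "insert e ?S" "insert e J"] by auto
    have spanK: "vec.span K = UNIV"
      using vec.span_mono[of J "vec.span K"] K(4) J(1) by (auto simp: \<J>_def vec.span_span)
    then have "K \<in> \<J>" using K J(1) e by (auto simp: \<J>_def)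
    have "e \<notin> J"
    proof
      assume "e \<in> J"
      then show False using neg vec.span_base[of e ?S] by simp
    qed
    have card: "card K = card J"
      using J(1) K(3) spanK unfolding \<J>_def
      by (metis (mono_tags, lifting) mem_Collect_eq vec.dim_eq_card_independent vec.dim_span)
    have finK: "finite K" using K(2) fin finite_subset by blast
    have eK: "e \<in> K" using K(1) by simp
    have "card (K - {e}) < card J"
      using card eK finK by (metis card_Diff1_less)
    moreover have "K - {e} \<subseteq> J" using K(2) by auto
    ultimately obtain j where j: "j \<in> J" "j \<notin> K - {e}"
      by (metis order_less_irrefl subsetI subset_antisym)
    then have jK: "j \<notin> K" using \<open>e \<notin> J\<close> by auto
    have "K - {e} \<subseteq> J - {j}" using \<open>K - {e} \<subseteq> J\<close> j by auto
    moreover have "card (K - {e}) = card (J - {j})"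
      using card eK j(1) finK fin by simp
    ultimately have eq: "K - {e} = J - {j}"
      using fin by (simp add: card_subset_eq)
    have "t j < t e" using j(1) jK K(1) by force
    moreover have "sum t K = t e + sum t (K - {e})" "sum t J = t j + sum t (J - {j})"
      using finK fin eK j(1) by (simp_all add: sum.remove)
    ultimately show False using J(2)[OF \<open>K \<in> \<J>\<close>] eq by simp
  qed
  then show ?thesis using that J(1) by (auto simp: \<J>_def)
qed

text \<open>
  With \<open>\<le>\<close> instead of \<open><\<close> this is necessary for an isotropic position to exist; the strict
  inequality makes the potential below coercive modulo constants.
\<close>

locale uncrowded =
  fixes E :: "(complex ^ 'm) set"
  assumes finite_E: "finite E" and nonempty_E: "E \<noteq> {}" and zero_notin_E: "0 \<notin> E"
    and card_Int_subspace: "\<And>W. vec.subspace W \<Longrightarrow> W \<noteq> {0} \<Longrightarrow> W \<noteq> UNIV \<Longrightarrow>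
      CARD('m) * card (E \<inter> W) < card E * vec.dim W"
begin

lemma card_E_pos: "0 < card E"
  using finite_E nonempty_E by (simp add: card_gt_0_iff)

text \<open>Strictness among integers is turned into a margin of 1. After division by
  \<open>card E\<close> this margin produces the coercivity term. When \<open>K\<close> spans, it
  comes from \<open>K\<close> being a proper subset.\<close>

lemma dim_span_bound:
  assumes "K \<subset> E" "K \<noteq> {}"
  shows "CARD('m) * card K + 1 \<le> card E * vec.dim K"
proof (cases "vec.span K = UNIV")
  case True
  then have "vec.dim K = CARD('m)" by (metis vec.dim_span vec_dim_card)
  moreover have "card K < card E" using assms(1) finite_E by (simp add: psubset_card_mono)
  then have "card K * CARD('m) < card E * CARD('m)" by (intro mult_strict_right_mono) auto
  ultimately show ?thesis by (simp add: mult.commute Suc_le_eq)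
next
  case False
  obtain e where "e \<in> K" "e \<noteq> 0"
    using assms zero_notin_E by (metis all_not_in_conv psubsetD)
  then have "vec.span K \<noteq> {0}"
    using vec.span_base by (metis singletonD)
  then have "CARD('m) * card (E \<inter> vec.span K) < card E * vec.dim K"
    using card_Int_subspace[of "vec.span K"] False by simp
  moreover have "card K \<le> card (E \<inter> vec.span K)"
    using assms(1) finite_E vec.span_superset[of K] by (intro card_mono) auto
  then have "CARD('m) * card K \<le> CARD('m) * card (E \<inter> vec.span K)" by simp
  ultimately show ?thesis by linarith
qed

lemma span_E: "vec.span E = UNIV"
proof (rule ccontr)
  assume *: "vec.span E \<noteq> UNIV"
  obtain e where "e \<in> E" "e \<noteq> 0"
    using nonempty_E zero_notin_E by (metis all_not_in_conv)
  then have "vec.span E \<noteq> {0}"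
    using vec.span_base by (metis singletonD)
  then have "CARD('m) * card (E \<inter> vec.span E) < card E * vec.dim E"
    using card_Int_subspace[of "vec.span E"] * by simp
  moreover have "E \<inter> vec.span E = E" using vec.span_superset by blast
  ultimately have "CARD('m) < vec.dim E" by (simp add: mult.commute)
  then show False
    using dim_subset_UNIV_cart_gen[of E] by simp
qed

text \<open>The greedy basis for \<open>t\<close> has at least \<open>vec.dim K\<close> members in
  every upper level set \<open>K\<close>, which by the margin exceeds the proportional share
  \<open>D / n * card K\<close> by at least \<open>1 / n\<close>. Summation by parts turns this into
  a bound by the spread of \<open>t\<close>.\<close>

lemma coercive:
  fixes t :: "complex ^ 'm \<Rightarrow> real"
  obtains J where "J \<subseteq> E" "vec.independent J" "vec.span J = UNIV"
    "\<And>p q. p \<in> E \<Longrightarrow> q \<in> E \<Longrightarrow>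
      (t p - t q) / card E \<le> sum t J - CARD('m) / card E * sum t E"
proof -
  define n where "n = real (card E)"
  define D where "D = real CARD('m)"
  have n: "0 < n" using card_E_pos by (simp add: n_def)
  obtain J where J: "J \<subseteq> E" "vec.independent J" "vec.span J = UNIV"
    "\<And>e. e \<in> E \<Longrightarrow> e \<in> vec.span {j \<in> J. t e \<le> t j}"
    using greedy_basis[OF finite_E span_E] by blast
  have cardJ: "card J = CARD('m)"
    by (metis J(2,3) vec.dim_eq_card_independent vec.dim_span vec_dim_card)
  obtain p where p: "p \<in> E" "\<And>i. i \<in> E \<Longrightarrow> t i \<le> t p"
    using arg_min_if_finite[of E "\<lambda>e. - t e"] finite_E nonempty_E
      by (metis neg_less_iff_less not_le)
  obtain q where q: "q \<in> E" "\<And>i. i \<in> E \<Longrightarrow> t q \<le> t i"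
    using arg_min_if_finite[of E t] finite_E nonempty_E by (metis not_le)
  \<comment> \<open>Here \<open>p\<close> and \<open>q\<close> are the places of the maximum and the
    minimum of \<open>t\<close>. The last two terms spend the margin \<open>1 / n\<close>: a proper
    nonempty level set contains \<open>p\<close> but not \<open>q\<close>.\<close>
  define a where "a e = (if e \<in> J then 1 else 0) - D / n + (if e = q then 1 / n else 0) - (if e
    = p then 1 / n else 0)" for e
  have sum_a: "(\<Sum>e\<in>K. a e * c e) = sum c (J \<inter> K) - D / n * sum c K
      + (if q \<in> K then c q / n else 0) - (if p \<in> K then c p / n else 0)" if "finite K" for K c
  proof -
    have "(\<Sum>e\<in>K. a e * c e) = (\<Sum>e\<in>K. (if e \<in> J then c e else 0) - D / n * c e
      + (if e = q then c q / n else 0) - (if e = p then c p / n else 0))"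
      by (rule sum.cong) (auto simp: a_def algebra_simps)
    then show ?thesis
      using that by (simp add: sum.distrib sum_subtractf sum_distrib_left sum.If_cases Int_commute)
  qed
  note sum_a1 = sum_a[of _ "\<lambda>_. 1", simplified]
  have "sum a E = 0"
    using finite_E J(1) p(1) q(1) n by (simp add: sum_a1 Int_absorb2 cardJ D_def n_def nonempty_E)
  moreover have "0 \<le> (\<Sum>e | e \<in> E \<and> s \<le> t e. a e)" for s
  proof -
    let ?K = "{e. e \<in> E \<and> s \<le> t e}"
    have finK: "finite ?K" using finite_E by auto
    consider "?K = {}" | "?K = E" | "?K \<noteq> {}" "?K \<noteq> E" by blast
    then show ?thesis
    proof cases
      case 1
      then show ?thesis by (simp only: sum.empty)
    next
      case 2
      with \<open>sum a E = 0\<close> show ?thesis by simp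
    next
      case 3
      have "?K \<subset> E" using 3 by auto
      \<comment> \<open>Greediness enters here: the basis vectors needed for \<open>e\<close> have
        values at least \<open>t e\<close>, so they stay in the level set.\<close>
      have "?K \<subseteq> vec.span (J \<inter> ?K)"
      proof
        fix e assume e: "e \<in> ?K"
        then have "{j \<in> J. t e \<le> t j} \<subseteq> J \<inter> ?K" using J(1) by auto
        then show "e \<in> vec.span (J \<inter> ?K)" using J(4)[of e] e vec.span_mono by blast
      qed
      then have "vec.dim ?K \<le> card (J \<inter> ?K)"
        using finK by (intro vec.dim_le_card) auto
      then have "card E * vec.dim ?K \<le> card E * card (J \<inter> ?K)" by simp
      then have "CARD('m) * card ?K + 1 \<le> card E * card (J \<inter> ?K)"
        using dim_span_bound[OF \<open>?K \<subset> E\<close> 3(1)] by linarith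
      then have "real (CARD('m) * card ?K + 1) \<le> real (card E * card (J \<inter> ?K))"
        by (simp only: of_nat_le_iff)
      then have "D * card ?K + 1 \<le> n * card (J \<inter> ?K)"
        by (simp only: D_def n_def of_nat_mult of_nat_add of_nat_1)
      then have *: "(D * card ?K + 1) / n \<le> card (J \<inter> ?K)"
        using n by (simp add: pos_divide_le_eq mult.commute)
      have "p \<in> ?K"
        using 3(1) p by force
      moreover have "q \<notin> ?K"
        using 3(2) q by force
      ultimately have "(\<Sum>e\<in>?K. a e) = card (J \<inter> ?K) - D * card ?K / n - 1 / n"
        unfolding sum_a1[OF finK] by (simp only: if_P if_not_P if_False add_0_right)
      with * show ?thesis by (simp add: add_divide_distrib)
    qed
  qed
  ultimately have "0 \<le> (\<Sum>e\<in>E. a e * t e)"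
    by (intro sum_mult_nonneg_of_upper_sums finite_E)
  then have *: "(t p - t q) / n \<le> sum t J - D / n * sum t E"
    using p(1) q(1) J(1) by (simp add: sum_a finite_E Int_absorb2 diff_divide_distrib)
  show ?thesis
  proof (rule that[OF J(1-3)])
    fix p' q' assume "p' \<in> E" "q' \<in> E"
    then have "(t p' - t q') / n \<le> (t p - t q) / n"
      using n p(2)[of p'] q(2)[of q'] by (intro divide_right_mono) auto
    then show "(t p' - t q') / card E \<le> sum t J - CARD('m) / card E * sum t E"
      using * by (simp add: n_def D_def)
  qed
qed

section \<open>The potential and its minimum\<close>

text \<open>Logarithmic coordinates \<open>t = ln x\<close> make the weights unconstrained. The
  factor \<open>CARD('m) / card E\<close> balances the homogeneity of the determinant, so that
  adding a constant to \<open>t\<close> changes nothing.\<close>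

definition potential :: "(complex ^ 'm \<Rightarrow> real) \<Rightarrow> real" where
  "potential t = ln (cmod (det (frame_matrix E (\<lambda>e. exp (t e))))) - CARD('m) / card E * sum t E"

lemma frame_exp: "frame E (\<lambda>e. exp (t e))"
  by unfold_locales (auto simp: finite_E span_E)

lemma det_exp_nz: "det (frame_matrix E (\<lambda>e. exp (t e))) \<noteq> 0"
  using frame.det_M_nz[OF frame_exp] .

lemma continuous_potential: "continuous_on S potential"
proof -
  have coord: "continuous_on S (\<lambda>t. t e)" for e
    by (rule continuous_on_subset[OF continuous_on_product_coordinates]) simp
  have "continuous_on S (\<lambda>t. frame_matrix E (\<lambda>e. exp (t e)) $ a $ b)" for a b
    by (simp add: frame_matrix_def)
       (intro continuous_on_sum continuous_on_mult continuous_on_of_real continuous_on_exp coord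
         continuous_on_const)
  then have "continuous_on S (\<lambda>t. det (frame_matrix E (\<lambda>e. exp (t e))))"
    unfolding det_def by (intro continuous_on_sum continuous_on_mult continuous_on_prod
      continuous_on_const)
  then have "continuous_on S (\<lambda>t. ln (cmod (det (frame_matrix E (\<lambda>e. exp (t e))))))"
    by (intro continuous_on_ln continuous_on_norm) (auto simp: det_exp_nz)
  moreover have "continuous_on S (\<lambda>t. CARD('m) / card E * sum t E)"
    by (intro continuous_on_mult continuous_on_const continuous_on_sum coord)
  ultimately show ?thesis
    unfolding potential_def by (rule continuous_on_diff)
qed

text \<open>The determinant for \<open>E\<close> dominates that for the greedy basis
  \<open>J\<close> of \<open>t\<close>, which is \<open>exp (sum t J)\<close> times a number
  depending only on \<open>J\<close>. There are finitely many candidates \<open>J\<close>, so one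
  constant serves all \<open>t\<close>.\<close>

lemma potential_lower_bound:
  obtains C where "\<And>t p q. p \<in> E \<Longrightarrow> q \<in> E \<Longrightarrow> C + (t p - t q) / card E \<le> potential t"
proof -
  define \<J> where "\<J> = {J. J \<subseteq> E \<and> vec.independent J \<and> vec.span J = UNIV}"
  have fin: "finite \<J>" using finite_E by (auto simp: \<J>_def)
  define d where "d J = ln (cmod (det (frame_matrix J (\<lambda>_. 1))))" for J :: "(complex ^ 'm) set"
  define C where "C = Min (d ` \<J>)"
  have "C + (t p - t q) / card E \<le> potential t" if pq: "p \<in> E" "q \<in> E" for t p q
  proof -
    obtain J where J: "J \<subseteq> E" "vec.independent J" "vec.span J = UNIV"
      and "\<And>p q. p \<in> E \<Longrightarrow> q \<in> E \<Longrightarrow>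
        (t p - t q) / card E \<le> sum t J - CARD('m) / card E * sum t E"
      using coercive[of t] by blast
    then have J4: "(t p - t q) / card E \<le> sum t J - CARD('m) / card E * sum t E"
      using pq by blast
    have finJ: "finite J" using J(1) finite_E finite_subset by blast
    interpret J: frame J "\<lambda>_. 1"
      by unfold_locales (auto simp: finJ J(3))
    have "cmod (det (frame_matrix J (\<lambda>e. exp (t e))))
      = exp (sum t J) * cmod (det (frame_matrix J (\<lambda>_. 1)))"
      by (subst det_frame_matrix_basis[OF J(2,3)]) (simp add: norm_mult exp_sum finJ abs_prod del:
        of_real_prod flip: prod_norm)
    then have "exp (sum t J) * cmod (det (frame_matrix J (\<lambda>_. 1)))
      \<le> cmod (det (frame_matrix E (\<lambda>e. exp (t e))))"
      using cmod_det_frame_matrix_mono[OF finite_E J(1,3), of "\<lambda>e. exp (t e)"] by simp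
    then have "ln (exp (sum t J) * cmod (det (frame_matrix J (\<lambda>_. 1))))
      \<le> ln (cmod (det (frame_matrix E (\<lambda>e. exp (t e)))))"
      using J.det_M_nz by (intro ln_mono) auto
    then have "sum t J + d J \<le> ln (cmod (det (frame_matrix E (\<lambda>e. exp (t e)))))"
      using J.det_M_nz by (simp add: ln_mult d_def)
    moreover have "C \<le> d J"
      using fin J by (auto simp: C_def \<J>_def)
    ultimately show ?thesis
      using J4 by (simp add: potential_def)
  qed
  then show ?thesis using that by blast
qed

lemma potential_shift: "potential (\<lambda>e. t e + c) = potential t"
proof -
  have fm: "frame_matrix E (\<lambda>e. exp (t e + c))
    = (\<chi> a. of_real (exp c) *s (frame_matrix E (\<lambda>e. exp (t e)) $ a))"
    by (simp add: frame_matrix_def vec_eq_iff exp_add sum_distrib_left mult_ac)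
  have "det (frame_matrix E (\<lambda>e. exp (t e + c)))
    = of_real (exp c) ^ CARD('m) * det (frame_matrix E (\<lambda>e. exp (t e)))"
    unfolding fm by (subst det_rows_mul) simp
  then have "cmod (det (frame_matrix E (\<lambda>e. exp (t e + c))))
    = exp c ^ CARD('m) * cmod (det (frame_matrix E (\<lambda>e. exp (t e))))"
    by (simp add: norm_mult norm_power)
  then have "ln (cmod (det (frame_matrix E (\<lambda>e. exp (t e + c)))))
    = CARD('m) * c + ln (cmod (det (frame_matrix E (\<lambda>e. exp (t e)))))"
    using det_exp_nz[of t] by (simp add: ln_mult ln_realpow)
  then show ?thesis
    using card_E_pos by (simp add: potential_def sum.distrib algebra_simps)
qed

lemma potential_cong: "(\<And>e. e \<in> E \<Longrightarrow> t e = t' e) \<Longrightarrow> potential t = potential t'"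
  by (simp add: potential_def frame_matrix_def)

lemma potential_attains_min: "\<exists>t. \<forall>t'. potential t \<le> potential t'"
proof -
  obtain C where C: "\<And>t p q. p \<in> E \<Longrightarrow> q \<in> E \<Longrightarrow> C + (t p - t q) / card E \<le> potential t"
    using potential_lower_bound by blast
  \<comment> \<open>Beyond spread \<open>R\<close> the lower bound already reaches the potential at
    0; the maximum with 0 keeps the zero function in the box.\<close>
  define R where "R = max 0 (card E * (potential (\<lambda>_. 0) - C))"
  \<comment> \<open>Coordinates outside \<open>E\<close> do not affect the potential and are pinned
    to 0, so the box is compact by Tychonoff. A function of small spread enters it after a shift
    that makes its minimum over \<open>E\<close> zero.\<close>
  define \<C> where "\<C> = (PiE UNIV (\<lambda>e. if e \<in> E then {0..R} else {0}) :: (complex ^ 'm \<Rightarrow> real) set)"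
  have "compactin (product_topology (\<lambda>_. euclidean) UNIV) \<C>"
    unfolding \<C>_def compactin_PiE by simp
  then have "compact \<C>"
    by (simp add: euclidean_product_topology)
  have zero: "(\<lambda>_. 0) \<in> \<C>" by (auto simp: \<C>_def R_def)
  then have "\<exists>t\<in>\<C>. \<forall>t'\<in>\<C>. potential t \<le> potential t'"
    by (intro continuous_attains_inf \<open>compact \<C>\<close> continuous_potential) auto
  then obtain t where t: "t \<in> \<C>" "\<And>t'. t' \<in> \<C> \<Longrightarrow> potential t \<le> potential t'"
    by blast
  have "potential t \<le> potential t'" for t'
  proof -
    obtain q where q: "q \<in> E" "\<And>i. i \<in> E \<Longrightarrow> t' q \<le> t' i"
      using arg_min_if_finite[of E t'] finite_E nonempty_E by (metis not_le)
    show ?thesis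
    proof (cases "\<forall>p\<in>E. t' p - t' q \<le> R")
      case True
      define t'' where "t'' e = (if e \<in> E then t' e + - t' q else 0)" for e
      have "t'' \<in> \<C>" using True q(2) by (auto simp: \<C>_def t''_def)
      then have "potential t \<le> potential t''" by (rule t(2))
      also have "\<dots> = potential (\<lambda>e. t' e + - t' q)" by (rule potential_cong) (simp add: t''_def)
      also have "\<dots> = potential t'" by (rule potential_shift)
      finally show ?thesis .
    next
      case False
      then obtain p where p: "p \<in> E" "R < t' p - t' q" by force
      have "potential t \<le> potential (\<lambda>_. 0)" by (rule t(2)[OF zero])
      also have "\<dots> \<le> C + R / card E"
        using card_E_pos by (simp add: R_def field_simps)
      also have "\<dots> \<le> C + (t' p - t' q) / card E"
        using p(2) card_E_pos by (simp add: divide_right_mono)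
      also have "\<dots> \<le> potential t'" by (rule C[OF p(1) q(1)])
      finally show ?thesis .
    qed
  qed
  then show ?thesis by blast
qed

text \<open>
  The determinant is affine in each weight, so vanishing of the partial derivative in direction
  \<open>e\<close> at a minimum says exactly that \<open>x e * B e e = D / n\<close>.
\<close>

lemma isotropic_weights:
  "\<exists>x. frame E x \<and> (\<forall>e\<in>E. of_real (x e) * frame.B E x e e = of_real (CARD('m) / card E))"
proof -
  obtain t where t: "\<And>t'. potential t \<le> potential t'" using potential_attains_min by blast
  define x where "x = (\<lambda>e. exp (t e))"
  interpret frame E x
    unfolding x_def by (rule frame_exp)
  have "of_real (x e) * B e e = of_real (CARD('m) / card E)" if e: "e \<in> E" for e
  proof -
    obtain r where r: "B e e = of_real r" "0 \<le> r" "e \<noteq> 0 \<longrightarrow> 0 < r" using B_self by blast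
    have "0 < r" using r(3) e zero_notin_E by auto
    define b where "b = x e * r"
    have "b > 0" using x_pos[OF e] \<open>0 < r\<close> by (simp add: b_def)
    \<comment> \<open>The term of \<open>e\<close> alone in the reproducing formula for
      \<open>B e e\<close> cannot exceed the whole. This keeps \<open>1 + (exp s - 1) * b\<close>
      positive for every \<open>s\<close>, so its logarithm is well behaved.\<close>
    have "b \<le> 1"
    proof -
      have "of_real (\<Sum>f\<in>E. x f * (cmod (B e f))\<^sup>2) = (\<Sum>f\<in>E. of_real (x f) * (B e f * B f e))"
        by (simp only: of_real_sum of_real_mult complex_norm_square B_commute)
      then have "complex_of_real (\<Sum>f\<in>E. x f * (cmod (B e f))\<^sup>2) = of_real r"
        by (simp only: B_reproducing r)
      then have *: "(\<Sum>f\<in>E. x f * (cmod (B e f))\<^sup>2) = r" by (simp only: of_real_eq_iff)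
      have "x e * (cmod (B e e))\<^sup>2 \<le> (\<Sum>f\<in>E. x f * (cmod (B e f))\<^sup>2)"
        using e by (intro member_le_sum) (auto simp: finite_E less_imp_le x_pos)
      then have "x e * r\<^sup>2 \<le> r" using * r by simp
      then show ?thesis using \<open>0 < r\<close> by (simp add: b_def power2_eq_square)
    qed
    define c where "c = real CARD('m) / card E"
    have pos: "0 < 1 + (exp s - 1) * b" for s
    proof -
      have "0 < exp s * b" using \<open>b > 0\<close> by simp
      then show ?thesis using \<open>b \<le> 1\<close> unfolding left_diff_distrib by linarith
    qed
    have Ft: "potential (t(e := t e + s)) = ln (cmod (det M)) + ln (1 + (exp s - 1) * b) - c *
      (sum t E + s)" for s
    proof -
      have "frame_matrix E (\<lambda>f. exp ((t(e := t e + s)) f))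
          = M + (\<chi> a a'. of_real (x e * (exp s - 1)) * (e $ a * cnj (e $ a')))"
      proof -
        have "(\<Sum>f\<in>E. of_real (exp ((t(e := t e + s)) f)) * (f $ a * cnj (f $ a')))
          = (\<Sum>f\<in>E. of_real (x f) * (f $ a * cnj (f $ a'))
             + (if f = e then of_real (x e * (exp s - 1)) * (e $ a * cnj (e $ a')) else 0))"
               for a a'
          by (rule sum.cong) (auto simp: x_def exp_add algebra_simps)
        then have "frame_matrix E (\<lambda>f. exp ((t(e := t e + s)) f)) $ a $ a'
            = (M + (\<chi> a a'. of_real (x e * (exp s - 1)) * (e $ a * cnj (e $ a')))) $ a $ a'"
              for a a'
          using e finite_E by (simp add: frame_matrix_def sum.distrib)
        then show ?thesis unfolding vec_eq_iff by blast
      qed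
      then have "det (frame_matrix E (\<lambda>f. exp ((t(e := t e + s)) f)))
          = det M * (1 + of_real (x e * (exp s - 1)) * B e e)"
        by (simp only: det_add_outer[OF M_N] B_def)
      also have "\<dots> = det M * of_real (1 + (exp s - 1) * b)"
        by (simp add: r b_def mult_ac)
      finally have "cmod (det (frame_matrix E (\<lambda>f. exp ((t(e := t e + s)) f))))
          = cmod (det M) * (1 + (exp s - 1) * b)"
        using pos[of s] by (simp only: norm_mult norm_of_real abs_of_pos)
      then have "ln (cmod (det (frame_matrix E (\<lambda>f. exp ((t(e := t e + s)) f)))))
          = ln (cmod (det M)) + ln (1 + (exp s - 1) * b)"
        using pos[of s] det_M_nz by (simp add: ln_mult)
      moreover have "sum (t(e := t e + s)) E = sum t E + s"
        using e finite_E by (simp add: sum.remove[of E e])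
      ultimately show ?thesis
        by (simp add: potential_def c_def)
    qed
    have "((\<lambda>s. potential (t(e := t e + s))) has_real_derivative b - c) (at 0)"
      unfolding Ft by (auto intro!: derivative_eq_intros)
    moreover have "\<forall>s. \<bar>0 - s\<bar> < 1 \<longrightarrow> potential (t(e := t e + 0)) \<le> potential (t(e := t e + s))"
      using t by simp
    ultimately have "b - c = 0"
      by (intro DERIV_local_min[where d=1]) auto
    then show ?thesis
      by (simp add: r b_def c_def flip: of_real_mult)
  qed
  then show ?thesis using frame_axioms by blast
qed

end

section \<open>Correlations\<close>

context frame
begin

lemma B_norm_sum:
  assumes "B u u = of_real r"
  shows "(\<Sum>f\<in>E. x f * (cmod (B u f))\<^sup>2) = r"
proof -
  have "complex_of_real (\<Sum>f\<in>E. x f * (cmod (B u f))\<^sup>2) = of_real r"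
    unfolding assms[symmetric] B_reproducing[of u u, symmetric]
    by (simp only: of_real_sum of_real_mult complex_norm_square B_commute)
  then show ?thesis by (simp only: of_real_eq_iff)
qed

text \<open>The squared modulus of the \<open>B\<close>-inner product of the vectors rescaled by the
  square roots of their weights. At isotropic weights these all have squared norm
  \<open>c = D / n\<close>, so \<open>h i j\<close> is \<open>c\<^sup>2\<close> times the squared
  correlation of unit vectors.\<close>

definition h :: "complex ^ 'm \<Rightarrow> complex ^ 'm \<Rightarrow> real" where
  "h i j = x i * x j * (cmod (B i j))\<^sup>2"

lemma of_real_h: "of_real (h i j) = of_real (x i) * of_real (x j) * (B i j * B j i)"
  by (simp only: h_def of_real_mult complex_norm_square B_commute)

text \<open>
  With \<open>N = \<Sum> a\<^sub>i a\<^sub>i\<^sup>*\<close>, where \<open>a\<^sub>i\<close> are coordinates in \<open>W\<close>, this is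
  \<open>(tr N)\<^sup>2 \<le> dim W * \<parallel>N\<parallel>\<^sup>2\<close> for the Frobenius norm.
\<close>

lemma square_trace_le:
  fixes c :: real
  assumes "vec.subspace W" "K \<subseteq> E \<inter> W"
    and "\<And>i. i \<in> K \<Longrightarrow> of_real (x i) * B i i = of_real c"
  shows "(card K * c)\<^sup>2 \<le> vec.dim W * (\<Sum>i\<in>K. \<Sum>j\<in>K. h i j)"
proof -
  obtain F where F: "finite F" "card F \<le> vec.dim W"
    "\<And>u w. u \<in> W \<Longrightarrow> w \<in> W \<Longrightarrow> B u w = (\<Sum>f\<in>F. B u f * B f w)"
    using Parseval[OF assms(1)] by blast
  \<comment> \<open>This local \<open>N\<close> is indexed by the Parseval system \<open>F\<close>;
    it is not the inverse matrix of the locale.\<close>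
  define N where "N f g = (\<Sum>i\<in>K. of_real (x i) * (B f i * B i g))" for f g
  have cnj_N: "cnj (N f g) = N g f" for f g
    by (simp add: N_def B_commute mult_ac)
  define \<nu> where "\<nu> f = (\<Sum>i\<in>K. x i * (cmod (B f i))\<^sup>2)" for f
  have N_diag: "N f f = of_real (\<nu> f)" for f
    by (simp only: N_def \<nu>_def of_real_sum of_real_mult complex_norm_square B_commute)
  have "complex_of_real (\<Sum>i\<in>K. \<Sum>j\<in>K. h i j) = (\<Sum>f\<in>F. \<Sum>g\<in>F. N g f * N f g)"
  proof -
    have "complex_of_real (\<Sum>i\<in>K. \<Sum>j\<in>K. h i j)
      = (\<Sum>i\<in>K. \<Sum>j\<in>K. \<Sum>f\<in>F. \<Sum>g\<in>F. (of_real (x i) * (B g i * B i f)) * (of_real (x j) * (B f j * B j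
        g)))"
    proof -
      have "complex_of_real (h i j) = (\<Sum>f\<in>F. \<Sum>g\<in>F. (of_real (x i) * (B g i * B i f)) * (of_real (x
        j) * (B f j * B j g)))"
        if "i \<in> K" "j \<in> K" for i j
      proof -
        have "i \<in> W" "j \<in> W" using that assms(2) by auto
        then have "complex_of_real (h i j) = of_real (x i) * of_real (x j) * ((\<Sum>f\<in>F. B i f * B f
          j) * (\<Sum>g\<in>F. B j g * B g i))"
          using F(3) by (simp add: of_real_h)
        also have "\<dots> = (\<Sum>f\<in>F. \<Sum>g\<in>F. of_real (x i) * of_real (x j) * ((B i f * B f j) * (B j g * B
          g i)))"
          by (subst sum_product) (simp only: sum_distrib_left)
        finally show ?thesis by (simp only: mult_ac)
      qed
      then show ?thesis by (simp only: of_real_sum cong: sum.cong)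
    qed
    also have "\<dots> = (\<Sum>i\<in>K. \<Sum>f\<in>F. \<Sum>j\<in>K. \<Sum>g\<in>F. (of_real (x i) * (B g i * B i f)) * (of_real (x j) *
      (B f j * B j g)))"
      by (rule sum.cong[OF refl], rule sum.swap)
    also have "\<dots> = (\<Sum>f\<in>F. \<Sum>i\<in>K. \<Sum>j\<in>K. \<Sum>g\<in>F. (of_real (x i) * (B g i * B i f)) * (of_real (x j) *
      (B f j * B j g)))"
      by (rule sum.swap)
    also have "\<dots> = (\<Sum>f\<in>F. \<Sum>i\<in>K. \<Sum>g\<in>F. \<Sum>j\<in>K. (of_real (x i) * (B g i * B i f)) * (of_real (x j) *
      (B f j * B j g)))"
      by (rule sum.cong[OF refl], rule sum.cong[OF refl], rule sum.swap)
    also have "\<dots> = (\<Sum>f\<in>F. \<Sum>g\<in>F. \<Sum>i\<in>K. \<Sum>j\<in>K. (of_real (x i) * (B g i * B i f)) * (of_real (x j) *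
      (B f j * B j g)))"
      by (rule sum.cong[OF refl], rule sum.swap)
    finally show ?thesis by (simp only: N_def sum_product)
  qed
  also have "\<dots> = of_real (\<Sum>f\<in>F. \<Sum>g\<in>F. (cmod (N f g))\<^sup>2)"
  proof -
    have "N g f * N f g = of_real ((cmod (N f g))\<^sup>2)" for f g
      by (simp only: complex_norm_square cnj_N mult.commute)
    then show ?thesis by (simp only: of_real_sum)
  qed
  finally have eq: "(\<Sum>i\<in>K. \<Sum>j\<in>K. h i j) = (\<Sum>f\<in>F. \<Sum>g\<in>F. (cmod (N f g))\<^sup>2)"
    by (simp only: of_real_eq_iff)
  have "complex_of_real (\<Sum>f\<in>F. \<nu> f) = (\<Sum>f\<in>F. \<Sum>i\<in>K. of_real (x i) * (B i f * B f i))"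
    by (simp only: of_real_sum N_diag[symmetric] N_def mult.commute)
  also have "\<dots> = (\<Sum>i\<in>K. of_real (x i) * (\<Sum>f\<in>F. B i f * B f i))"
    by (subst sum.swap) (simp only: sum_distrib_left)
  also have "\<dots> = (\<Sum>i\<in>K. of_real (x i) * B i i)"
    using assms(2) by (intro sum.cong refl) (simp add: F(3) subset_iff)
  also have "\<dots> = of_real (card K * c)"
    using assms(3) by simp
  finally have tr: "(\<Sum>f\<in>F. \<nu> f) = card K * c" by (simp only: of_real_eq_iff)
  \<comment> \<open>Cauchy-Schwarz for the diagonal entries; the off-diagonal ones are then added as
    nonnegative terms.\<close>
  have "(\<Sum>f\<in>F. \<nu> f)\<^sup>2 \<le> card F * (\<Sum>f\<in>F. (\<nu> f)\<^sup>2)"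
    using sum_squared_le_sum_of_squares[of \<nu> F] F(1) by (simp add: mult.commute)
  also have "\<dots> \<le> vec.dim W * (\<Sum>i\<in>K. \<Sum>j\<in>K. h i j)"
  proof (intro mult_mono)
    have "(\<nu> f)\<^sup>2 \<le> (\<Sum>g\<in>F. (cmod (N f g))\<^sup>2)" if "f \<in> F" for f
    proof -
      have "(\<nu> f)\<^sup>2 = (cmod (N f f))\<^sup>2" by (simp add: N_diag)
      also have "\<dots> \<le> (\<Sum>g\<in>F. (cmod (N f g))\<^sup>2)"
        using F(1) that by (intro member_le_sum) auto
      finally show ?thesis .
    qed
    then show "(\<Sum>f\<in>F. (\<nu> f)\<^sup>2) \<le> (\<Sum>i\<in>K. \<Sum>j\<in>K. h i j)"
      unfolding eq by (rule sum_mono)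
  qed (use F(2) in \<open>auto intro: sum_nonneg\<close>)
  finally show ?thesis by (simp only: tr)
qed

end

text \<open>The interface between analysis and combinatorics: all later counting sees only
  \<open>h\<close>. The total arises from row sums, each equal to \<open>x i * B i i = D / n\<close>
  by the reproducing formula.\<close>

lemma isotropic_correlations:
  fixes E :: "(complex ^ 'm) set"
  assumes "uncrowded E"
  obtains h :: "complex ^ 'm \<Rightarrow> complex ^ 'm \<Rightarrow> real" where
    "\<And>i. i \<in> E \<Longrightarrow> h i i = (CARD('m) / card E)\<^sup>2"
    "(\<Sum>i\<in>E. \<Sum>j\<in>E. h i j) = CARD('m)"
    "\<And>K W. vec.subspace W \<Longrightarrow> K \<subseteq> E \<inter> W \<Longrightarrow>
      (card K * (CARD('m) / card E))\<^sup>2 \<le> vec.dim W * (\<Sum>i\<in>K. \<Sum>j\<in>K. h i j)"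
proof -
  define c where "c = real CARD('m) / card E"
  obtain x where "frame E x" and iso: "\<And>e. e \<in> E \<Longrightarrow> of_real (x e) * frame.B E x e e = of_real c"
    using uncrowded.isotropic_weights[OF assms] unfolding c_def by blast
  interpret frame E x by fact
  have self: "B i i = of_real (c / x i)" if "i \<in> E" for i
    using iso[OF that] x_pos[OF that] by (simp add: field_simps)
  have diag: "h i i = c\<^sup>2" if "i \<in> E" for i
  proof -
    have "complex_of_real (h i i) = of_real (c\<^sup>2)"
      using iso[OF that] by (simp add: of_real_h power2_eq_square mult_ac)
    then show ?thesis by (simp only: of_real_eq_iff)
  qed
  have "(\<Sum>j\<in>E. h i j) = c" if "i \<in> E" for i
  proof -
    have "(\<Sum>j\<in>E. h i j) = x i * (\<Sum>j\<in>E. x j * (cmod (B i j))\<^sup>2)"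
      by (simp add: h_def sum_distrib_left mult_ac)
    also have "\<dots> = c"
      using x_pos[OF that] by (simp add: B_norm_sum[OF self[OF that]])
    finally show ?thesis .
  qed
  then have total: "(\<Sum>i\<in>E. \<Sum>j\<in>E. h i j) = CARD('m)"
    using uncrowded.card_E_pos[OF assms] by (simp add: c_def)
  show ?thesis
  proof (rule that[of h])
    show "h i i = (CARD('m) / card E)\<^sup>2" if "i \<in> E" for i
      using diag[OF that] by (simp add: c_def)
    show "(card K * (CARD('m) / card E))\<^sup>2 \<le> vec.dim W * (\<Sum>i\<in>K. \<Sum>j\<in>K. h i j)"
      if "vec.subspace W" "K \<subseteq> E \<inter> W" for K W
      using square_trace_le[OF that, of c] iso that(2) by (auto simp: c_def)
  qed (rule total)
qed

section \<open>Lines as spans of two vectors\<close>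

lemma mem_span_pair: "x \<in> vec.span {a, b} \<longleftrightarrow> (\<exists>\<alpha> \<beta>. x = \<alpha> *s a + \<beta> *s b)"
  for x a b :: "'a::field ^ 'm"
proof
  assume "x \<in> vec.span {a, b}"
  then obtain \<alpha> where "x - \<alpha> *s a \<in> vec.span {b}" by (auto simp: vec.span_insert)
  then obtain \<beta> where "x - \<alpha> *s a = \<beta> *s b" by (auto simp: vec.span_singleton)
  then have "x = \<alpha> *s a + \<beta> *s b" by (simp add: algebra_simps)
  then show "\<exists>\<alpha> \<beta>. x = \<alpha> *s a + \<beta> *s b" by blast
next
  assume "\<exists>\<alpha> \<beta>. x = \<alpha> *s a + \<beta> *s b"
  then show "x \<in> vec.span {a, b}"
    by (auto simp del: vec.span_insert intro: vec.span_add vec.span_scale vec.span_base)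
qed

lemma mem_span_singleton: "x \<in> vec.span {a} \<longleftrightarrow> (\<exists>\<alpha>. x = \<alpha> *s a)"
  for x a :: "'a::field ^ 'm"
  by (auto simp: vec.span_singleton)

text \<open>Members of such a set represent distinct points of a projective space; spans of two
  members are its lines.\<close>

definition pairwise_nonparallel :: "('a::field ^ 'm) set \<Rightarrow> bool" where
  "pairwise_nonparallel E \<longleftrightarrow> 0 \<notin> E \<and> (\<forall>u\<in>E. \<forall>v\<in>E. u \<in> vec.span {v} \<longrightarrow> u = v)"

lemma span_pair_exchange:
  fixes a b c :: "'a::field ^ 'm"
  assumes "c \<in> vec.span {a, b}" "c \<notin> vec.span {a}"
  shows "vec.span {a, c} = vec.span {a, b}"
proof -
  obtain \<alpha> \<beta> where c: "c = \<alpha> *s a + \<beta> *s b" using assms(1) mem_span_pair by blast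
  have "\<beta> \<noteq> 0" using assms(2) c by (auto simp: mem_span_singleton)
  then have "b = (- \<alpha> / \<beta>) *s a + (1 / \<beta>) *s c"
    by (simp add: c vec_eq_iff field_simps)
  then have "b \<in> vec.span {a, c}" using mem_span_pair by blast
  then have "vec.span {a, b} \<subseteq> vec.span {a, c}"
    by (intro vec.span_minimal) (auto intro: vec.span_base)
  moreover have "vec.span {a, c} \<subseteq> vec.span {a, b}"
    using assms(1) by (intro vec.span_minimal) (auto intro: vec.span_base)
  ultimately show ?thesis by simp
qed

lemma span_pair_eq:
  fixes a b i j :: "'a::field ^ 'm"
  assumes "a \<in> vec.span {i, j}" "b \<in> vec.span {i, j}" "a \<notin> vec.span {b}" "b \<noteq> 0"
  shows "vec.span {a, b} = vec.span {i, j}"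
proof (cases "b \<in> vec.span {i}")
  case True
  then obtain \<beta> where b: "b = \<beta> *s i" by (auto simp: mem_span_singleton)
  then have "\<beta> \<noteq> 0" using assms(4) by auto
  then have eq: "vec.span {b} = vec.span {i}"
    using vec.span_image_scale[of "{i}" "\<lambda>_. \<beta>"] b by simp
  then have "vec.span {i, a} = vec.span {i, j}"
    using span_pair_exchange[OF assms(1)] assms(3) by simp
  moreover have "vec.span {i, a} = vec.span {b, a}"
    using eq by (simp add: vec.span_insert[of _ "{_}"] insert_commute[of _ a])
  ultimately show ?thesis by (simp add: insert_commute)
next
  case False
  then have 1: "vec.span {i, b} = vec.span {i, j}" using span_pair_exchange assms(2) by blast
  then have "a \<in> vec.span {b, i}" using assms(1) by (simp add: insert_commute)
  then have "vec.span {b, a} = vec.span {b, i}" using assms(3) by (rule span_pair_exchange)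
  then show ?thesis using 1 by (simp add: insert_commute)
qed

text \<open>Group \<open>P\<close> by lines. By \<open>closed\<close>, a line occurring in
  \<open>P\<close> contributes all its off-diagonal pairs. With \<open>r\<close> points it has total
  at least \<open>(r * c)\<^sup>2 / 2\<close>, of which the diagonal takes
  \<open>r * c\<^sup>2\<close>; the resulting average over \<open>r * (r - 1)\<close> pairs
  increases with \<open>r\<close>, so \<open>r\<^sub>0\<close> gives the worst case.\<close>

lemma pair_sum_bound:
  fixes E :: "(complex ^ 'm) set" and h :: "complex ^ 'm \<Rightarrow> complex ^ 'm \<Rightarrow> real" and r\<^sub>0 :: nat and
    c :: real
  assumes E: "finite E" "pairwise_nonparallel E"
    and P: "P \<subseteq> {(i, j). i \<in> E \<and> j \<in> E \<and> i \<noteq> j}"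
    and closed: "\<And>i j a b. (i, j) \<in> P \<Longrightarrow> a \<in> E \<inter> vec.span {i, j} \<Longrightarrow> b \<in> E \<inter> vec.span {i, j} \<Longrightarrow>
      a \<noteq> b \<Longrightarrow> (a, b) \<in> P"
    and card: "\<And>i j. (i, j) \<in> P \<Longrightarrow> r\<^sub>0 \<le> card (E \<inter> vec.span {i, j})"
    and r\<^sub>0: "2 \<le> r\<^sub>0"
    and h_diag: "\<And>i. i \<in> E \<Longrightarrow> h i i = c\<^sup>2"
    and h_lower: "\<And>K W. vec.subspace W \<Longrightarrow> K \<subseteq> E \<inter> W \<Longrightarrow>
      (card K * c)\<^sup>2 \<le> vec.dim W * (\<Sum>i\<in>K. \<Sum>j\<in>K. h i j)"
  shows "(real r\<^sub>0 - 2) / (2 * (real r\<^sub>0 - 1)) * c\<^sup>2 * card P \<le> (\<Sum>(i, j)\<in>P. h i j)"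
proof -
  define \<theta> where "\<theta> = (real r\<^sub>0 - 2) / (2 * (real r\<^sub>0 - 1))"
  define L where "L = (\<lambda>(i, j). E \<inter> vec.span {i, j})"
  have finP: "finite P" using P E(1) by (rule_tac finite_subset[of _ "E \<times> E"]) auto
  have fibre: "{q \<in> P. L q = K} = {(a, b). a \<in> K \<and> b \<in> K \<and> a \<noteq> b}"
    if p: "(i, j) \<in> P" and K: "K = L (i, j)" for i j K
  proof (intro set_eqI iffI)
    fix q assume q: "q \<in> {q \<in> P. L q = K}"
    obtain a b where ab: "q = (a, b)" by (cases q)
    have "a \<in> E" "b \<in> E" "a \<noteq> b" using q ab P by auto
    then have "a \<in> L q" "b \<in> L q" by (auto simp: ab L_def vec.span_base)
    then show "q \<in> {(a, b). a \<in> K \<and> b \<in> K \<and> a \<noteq> b}"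
      using q ab \<open>a \<noteq> b\<close> by auto
  next
    fix q assume "q \<in> {(a, b). a \<in> K \<and> b \<in> K \<and> a \<noteq> b}"
    then obtain a b where ab: "q = (a, b)" "a \<in> K" "b \<in> K" "a \<noteq> b" by auto
    then have "vec.span {a, b} = vec.span {i, j}"
      using E(2) by (intro span_pair_eq) (auto simp: K L_def pairwise_nonparallel_def)
    moreover have "(a, b) \<in> P"
      using closed[OF p, of a b] ab by (auto simp: K L_def)
    ultimately show "q \<in> {q \<in> P. L q = K}"
      by (simp add: ab K L_def)
  qed
  have line: "\<theta> * c\<^sup>2 * card {q \<in> P. L q = K} \<le> (\<Sum>q\<in>{q \<in> P. L q = K}. case q of (i, j) \<Rightarrow> h i j)"
    if "K \<in> L ` P" for K
  proof -
    obtain i j where ij: "(i, j) \<in> P" "K = L (i, j)" using \<open>K \<in> L ` P\<close> by auto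
    have KE: "K \<subseteq> E" using ij by (auto simp: L_def)
    then have finK: "finite K" using E(1) finite_subset by blast
    define r where "r = real (card K)"
    have r: "real r\<^sub>0 \<le> r" using card[OF ij(1)] by (simp add: ij(2) L_def r_def)
    have split: "K \<times> K = {(a, b). a \<in> K \<and> b \<in> K \<and> a \<noteq> b} \<union> (\<lambda>a. (a, a)) ` K" by auto
    have finOff: "finite {(a, b). a \<in> K \<and> b \<in> K \<and> a \<noteq> b}"
      using finK by (rule_tac finite_subset[of _ "K \<times> K"]) auto
    have inj: "inj_on (\<lambda>a. (a, a)) K" by (auto simp: inj_on_def)
    have "card (K \<times> K) = card {(a, b). a \<in> K \<and> b \<in> K \<and> a \<noteq> b} + card K"
      unfolding split using finK finOff by (subst card_Un_disjoint) (auto simp: card_image inj)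
    then have cardOff: "real (card {(a, b). a \<in> K \<and> b \<in> K \<and> a \<noteq> b}) = r * r - r"
      by (simp add: r_def card_cartesian_product flip: of_nat_mult)
    have "(\<Sum>a\<in>K. \<Sum>b\<in>K. h a b) = (\<Sum>(a, b)\<in>K \<times> K. h a b)"
      by (rule sum.cartesian_product)
    also have "\<dots> = (\<Sum>(a, b)\<in>{(a, b). a \<in> K \<and> b \<in> K \<and> a \<noteq> b}. h a b) + (\<Sum>a\<in>K. h a a)"
      unfolding split using finK finOff by (subst sum.union_disjoint) (auto simp: sum.reindex inj)
    also have "(\<Sum>a\<in>K. h a a) = r * c\<^sup>2"
      using KE h_diag by (simp add: r_def subset_iff)
    finally have tot: "(\<Sum>a\<in>K. \<Sum>b\<in>K. h a b) = (\<Sum>(a, b)\<in>{(a, b). a \<in> K \<and> b \<in> K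
      \<and> a \<noteq> b}. h a b) + r * c\<^sup>2" .
    have "vec.dim (vec.span {i, j}) \<le> 2"
      using vec.dim_le_card[of "vec.span {i, j}" "{i, j}"]
        by (simp add: card_insert_if split: if_splits)
    \<comment> \<open>Nonnegativity, read off from the estimate in the whole space, allows the
      dimension of the line to be replaced by its upper bound 2.\<close>
    moreover have nonneg: "0 \<le> (\<Sum>a\<in>K. \<Sum>b\<in>K. h a b)"
    proof -
      have "0 \<le> real CARD('m) * (\<Sum>a\<in>K. \<Sum>b\<in>K. h a b)"
        using order_trans[OF zero_le_power2 h_lower[OF vec.subspace_UNIV, of K]] KE
        by (simp add: vec_dim_card card_cart_basis)
      then show ?thesis
        by (simp add: zero_le_mult_iff)
    qed
    ultimately have "vec.dim (vec.span {i, j}) * (\<Sum>a\<in>K. \<Sum>b\<in>K. h a b) \<le> 2 * (\<Sum>a\<in>K. \<Sum>b\<in>K. h a b)"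
      by (intro mult_right_mono) auto
    moreover have "(r * c)\<^sup>2 \<le> vec.dim (vec.span {i, j}) * (\<Sum>a\<in>K. \<Sum>b\<in>K. h a b)"
      using h_lower[OF vec.subspace_span[of "{i, j}"], of K] ij(2) unfolding r_def L_def by simp
    ultimately have "(r * c)\<^sup>2 / 2 - r * c\<^sup>2 \<le> (\<Sum>(a, b)\<in>{(a, b). a \<in> K \<and> b \<in> K \<and> a \<noteq> b}. h a b)"
      using tot by simp
    moreover have "\<theta> * c\<^sup>2 * (r * r - r) \<le> (r * c)\<^sup>2 / 2 - r * c\<^sup>2"
    proof -
      have "\<theta> * (r - 1) \<le> (r - 2) / 2"
        using r r\<^sub>0 by (simp add: \<theta>_def field_simps)
      then have "\<theta> * (r - 1) * (r * c\<^sup>2) \<le> (r - 2) / 2 * (r * c\<^sup>2)"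
        by (rule mult_right_mono) (simp add: r_def)
      then show ?thesis by (simp add: power2_eq_square algebra_simps)
    qed
    ultimately show ?thesis
      unfolding fibre[OF ij] cardOff by (simp add: split_def)
  qed
  have "\<theta> * c\<^sup>2 * card P = (\<Sum>K\<in>L ` P. \<theta> * c\<^sup>2 * card {q \<in> P. L q = K})"
  proof -
    have "card P = (\<Sum>K\<in>L ` P. card {q \<in> P. L q = K})"
      using sum.group[OF finP finite_imageI[OF finP] subset_refl, of "\<lambda>_. 1::nat" L] by simp
    then show ?thesis by (simp add: sum_distrib_left)
  qed
  also have "\<dots> \<le> (\<Sum>K\<in>L ` P. \<Sum>q\<in>{q \<in> P. L q = K}. case q of (i, j) \<Rightarrow> h i j)"
    by (rule sum_mono) (rule line)
  also have "\<dots> = (\<Sum>(i, j)\<in>P. h i j)"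
    by (rule sum.group[OF finP finite_imageI[OF finP] subset_refl])
  finally show ?thesis by (simp add: \<theta>_def)
qed


section \<open>Cones over a subspace and the three-dimensional case\<close>

text \<open>Comparing the two expressions of \<open>z\<close> modulo \<open>W\<close> equates the
  coefficients of \<open>x\<close>, leaving proportional \<open>w\<close> and \<open>w'\<close>.
  Thus lines from an apex outside \<open>W\<close> to different points of \<open>W\<close> share
  only the apex, so points chosen on them can be counted without repetition.\<close>

lemma cone_disjoint:
  fixes x w w' z :: "'a::field ^ 'm"
  assumes "vec.subspace W" "x \<notin> W" "w \<in> W" "w' \<in> W"
    and "z \<in> vec.span {x, w}" "z \<in> vec.span {x, w'}" "z \<notin> vec.span {x}"
  shows "w \<in> vec.span {w'}"
proof -
  obtain \<alpha> \<beta> where 1: "z = \<alpha> *s x + \<beta> *s w" using assms(5) mem_span_pair by blast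
  obtain \<alpha>' \<beta>' where 2: "z = \<alpha>' *s x + \<beta>' *s w'" using assms(6) mem_span_pair by blast
  have eq: "(\<alpha> - \<alpha>') *s x = \<beta>' *s w' - \<beta> *s w"
    using 1 2 by (simp add: vec.scale_left_diff_distrib algebra_simps)
  then have "(\<alpha> - \<alpha>') *s x \<in> W"
    using assms(1,3,4) by (simp add: vec.subspace_diff vec.subspace_scale)
  then have "(1 / (\<alpha> - \<alpha>')) *s ((\<alpha> - \<alpha>') *s x) \<in> W"
    using assms(1) vec.subspace_scale by blast
  then have "(1 / (\<alpha> - \<alpha>') * (\<alpha> - \<alpha>')) *s x \<in> W"
    by (simp only: vec.scale_scale)
  then have "\<alpha> = \<alpha>'" using assms(2) by (cases "\<alpha> = \<alpha>'") simp_all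
  then have *: "\<beta> *s w = \<beta>' *s w'" using eq by simp
  have "\<beta> \<noteq> 0" using assms(7) 1 by (auto simp: mem_span_singleton)
  then have "w = (1 / \<beta>) *s (\<beta> *s w)" by simp
  also have "\<dots> = (1 / \<beta> * \<beta>') *s w'" by (simp only: * vec.scale_scale)
  finally show ?thesis using mem_span_singleton by blast
qed

lemma cone_notin:
  fixes x w z :: "'a::field ^ 'm"
  assumes "vec.subspace W" "x \<notin> W" "w \<in> W" "z \<in> vec.span {x, w}" "z \<notin> vec.span {w}"
  shows "z \<notin> W"
proof
  assume "z \<in> W"
  obtain \<alpha> \<beta> where z: "z = \<alpha> *s x + \<beta> *s w" using assms(4) mem_span_pair by blast
  then have "\<alpha> \<noteq> 0" using assms(5) by (auto simp: mem_span_singleton)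
  then have "x = (1 / \<alpha>) *s (z - \<beta> *s w)" by (simp add: z)
  then show False using assms(1-3) \<open>z \<in> W\<close> by (metis vec.subspace_diff vec.subspace_scale)
qed

text \<open>Uncrowdedness: from an \<open>x\<close> outside \<open>W\<close>, each point of
  \<open>E \<inter> W\<close> yields two further points outside \<open>W\<close>, disjointly for
  different points, and \<open>x\<close> is one more; hence \<open>W\<close> has less than a third
  of \<open>E\<close>. Averages of 1/3 off the diagonal and 1 on it then give a total of at least
  \<open>3 + 6 / n\<close>, where isotropy demands 3.\<close>

lemma no_spanning_set_with_four_rich_lines:
  fixes E :: "(complex ^ 3) set"
  assumes fin: "finite E" and np: "pairwise_nonparallel E" and span: "vec.span E = UNIV"
    and rich: "\<And>x y. x \<in> E \<Longrightarrow> y \<in> E \<Longrightarrow> x \<noteq> y \<Longrightarrow> 4 \<le> card (E \<inter> vec.span {x, y})"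
  shows False
proof -
  have ne: "E \<noteq> {}"
  proof
    assume "E = {}"
    then have "vec.dim (UNIV :: (complex ^ 3) set) = 0" using span
      by (metis vec.dim_empty vec.dim_span)
    then show False by (simp add: vec_dim_card card_cart_basis)
  qed
  have cond: "3 * card (E \<inter> W) < card E" if W: "vec.subspace W" "W \<noteq> UNIV" for W
  proof -
    have "\<not> E \<subseteq> W" using span W vec.span_minimal by blast
    then obtain x where x: "x \<in> E" "x \<notin> W" by blast
    define Z where "Z w = E \<inter> vec.span {x, w} - {x, w}" for w
    have finZ: "finite (Z w)" for w using fin by (simp add: Z_def)
    have cardZ: "2 \<le> card (Z w)" if "w \<in> E \<inter> W" for w
    proof -
      have "card (E \<inter> vec.span {x, w}) - card {x, w} \<le> card (Z w)"
        unfolding Z_def by (rule diff_card_le_card_Diff) simp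
      moreover have "card {x, w} \<le> 2" by (simp add: card_insert_if)
      moreover have "x \<noteq> w" using that x by auto
      ultimately show ?thesis using rich[of x w] that x by force
    qed
    have disj: "Z w \<inter> Z w' = {}" if "w \<in> E \<inter> W" "w' \<in> E \<inter> W" "w \<noteq> w'" for w w'
    proof (rule ccontr)
      assume "Z w \<inter> Z w' \<noteq> {}"
      then obtain z where "z \<in> Z w" "z \<in> Z w'" by blast
      then have "w \<in> vec.span {w'}"
        using that np x by (intro cone_disjoint[OF W(1) x(2)]) (auto simp: Z_def
          pairwise_nonparallel_def)
      then show False using that np by (auto simp: pairwise_nonparallel_def)
    qed
    have sub: "(\<Union>w\<in>E \<inter> W. Z w) \<subseteq> E - W - {x}"
    proof
      fix z assume "z \<in> (\<Union>w\<in>E \<inter> W. Z w)"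
      then obtain w where w: "w \<in> E" "w \<in> W" "z \<in> Z w" by blast
      then have "z \<notin> W"
        using np by (intro cone_notin[OF W(1) x(2), of w]) (auto simp: Z_def
          pairwise_nonparallel_def)
      then show "z \<in> E - W - {x}" using w by (auto simp: Z_def)
    qed
    have "2 * card (E \<inter> W) \<le> (\<Sum>w\<in>E \<inter> W. card (Z w))"
      using sum_mono[of "E \<inter> W" "\<lambda>_. 2" "\<lambda>w. card (Z w)"] cardZ by simp
    also have "\<dots> = card (\<Union>w\<in>E \<inter> W. Z w)"
      using fin finZ disj by (subst card_UN_disjoint) auto
    also have "\<dots> \<le> card (E - W - {x})"
      using sub fin by (intro card_mono) auto
    also have "\<dots> < card (E - W)"
      using x fin by (intro psubset_card_mono) auto
    finally have "2 * card (E \<inter> W) < card (E - W)" .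
    moreover have "card E = card (E \<inter> W) + card (E - W)"
      using fin by (metis card_Int_Diff)
    ultimately show ?thesis by simp
  qed
  have "uncrowded E"
  proof
    fix W :: "(complex ^ 3) set"
    assume W: "vec.subspace W" "W \<noteq> {0}" "W \<noteq> UNIV"
    then have "1 \<le> vec.dim W"
      using vec.subspace_0 by (fastforce simp: Suc_le_eq)
    then have le: "card E \<le> card E * vec.dim W"
      by (metis mult.right_neutral mult_le_mono2)
    have "CARD(3) = 3" by simp
    then show "CARD(3) * card (E \<inter> W) < card E * vec.dim W"
      using less_le_trans[OF cond[OF W(1,3)] le] by (simp only:)
  qed (use fin ne np in \<open>auto simp: pairwise_nonparallel_def\<close>)
  then obtain h :: "complex ^ 3 \<Rightarrow> complex ^ 3 \<Rightarrow> real" where h: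
    "\<And>i. i \<in> E \<Longrightarrow> h i i = (CARD(3) / card E)\<^sup>2"
    "(\<Sum>i\<in>E. \<Sum>j\<in>E. h i j) = CARD(3)"
    "\<And>K W. vec.subspace W \<Longrightarrow> K \<subseteq> E \<inter> W \<Longrightarrow>
      (card K * (CARD(3) / card E))\<^sup>2 \<le> vec.dim W * (\<Sum>i\<in>K. \<Sum>j\<in>K. h i j)"
    using isotropic_correlations by blast
  define n where "n = real (card E)"
  have n: "0 < n" using fin ne by (simp add: n_def card_gt_0_iff)
  define P where "P = {(i, j). i \<in> E \<and> j \<in> E \<and> i \<noteq> j}"
  have finP: "finite P" using fin by (rule_tac finite_subset[of _ "E \<times> E"]) (auto simp: P_def)
  have bound: "(real 4 - 2) / (2 * (real 4 - 1)) * (CARD(3) / card E)\<^sup>2 * card P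
    \<le> (\<Sum>(i, j)\<in>P. h i j)"
    by (rule pair_sum_bound[where r\<^sub>0=4, OF fin np _ _ _ _ h(1,3)])
       (use rich in \<open>auto simp: P_def\<close>)
  have split: "E \<times> E = P \<union> (\<lambda>a. (a, a)) ` E" by (auto simp: P_def)
  have inj: "inj_on (\<lambda>a. (a, a)) E" by (auto simp: inj_on_def)
  have disj: "P \<inter> (\<lambda>a. (a, a)) ` E = {}" by (auto simp: P_def)
  have "card (E \<times> E) = card P + card E"
    unfolding split using fin finP disj by (subst card_Un_disjoint) (auto simp: card_image inj)
  then have cardP: "real (card P) = n * n - n"
    by (simp add: n_def card_cartesian_product flip: of_nat_mult)
  have "3 = (\<Sum>(i, j)\<in>E \<times> E. h i j)"
    using h(2) by (simp add: sum.cartesian_product)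
  also have "\<dots> = (\<Sum>(i, j)\<in>P. h i j) + (\<Sum>i\<in>E. h i i)"
    unfolding split using fin finP disj by (subst sum.union_disjoint) (auto simp: sum.reindex inj)
  also have "(\<Sum>i\<in>E. h i i) = n * (3 / n)\<^sup>2"
    using h(1) by (simp add: n_def)
  finally have "n * (3 / n)\<^sup>2 + 1 / 3 * (3 / n)\<^sup>2 * (n * n - n) \<le> 3"
    using bound by (simp add: cardP flip: n_def)
  moreover have "n * (3 / n)\<^sup>2 + 1 / 3 * (3 / n)\<^sup>2 * (n * n - n) = 3 + 6 / n"
    using n by (simp add: power2_eq_square field_simps)
  ultimately show False using n by simp
qed

section \<open>Pencils of planes through a rich line\<close>

abbreviation perm3 :: "nat \<Rightarrow> nat \<Rightarrow> nat \<Rightarrow> bool" where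
  "perm3 i j k \<equiv> i < 3 \<and> j < 3 \<and> k < 3 \<and> distinct [i, j, k]"

text \<open>An extremal argument on the widths \<open>u i - l i\<close>. If both extreme sums of
  \<open>A i\<close> and \<open>A j\<close> are negatives of elements of \<open>A k\<close>, the
  widths of \<open>A i\<close> and \<open>A j\<close> add up to at most that of \<open>A k\<close>.
  If one of them falls into \<open>B k\<close>, the relation \<open>AB\<close> leads back beyond the
  extremes unless both widths are 0. Taken for all three indices, every \<open>A i\<close> is a
  singleton, and then \<open>AB\<close> determines the elements of \<open>B 0\<close>.\<close>

lemma sumset_triple:
  fixes A B :: "nat \<Rightarrow> real set"
  assumes fin: "\<And>i. i < 3 \<Longrightarrow> finite (A i)"
    and ne: "\<And>i. i < 3 \<Longrightarrow> A i \<noteq> {}"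
    and AA: "\<And>i j k a b. perm3 i j k \<Longrightarrow> a \<in> A i \<Longrightarrow> b \<in> A j \<Longrightarrow> - (a + b) \<in> A k \<union> B k"
    and AB: "\<And>i j k a b. perm3 i j k \<Longrightarrow> a \<in> A i \<Longrightarrow> b \<in> B j \<Longrightarrow> - (a + b) \<in> A k"
  obtains a b where "A 0 \<union> B 0 \<subseteq> {a, b}"
proof -
  define u where "u i = Max (A i)" for i
  define l where "l i = Min (A i)" for i
  have u: "u i \<in> A i" "\<And>a. a \<in> A i \<Longrightarrow> a \<le> u i" if "i < 3" for i
    using fin[OF that] ne[OF that] by (auto simp: u_def)
  have l: "l i \<in> A i" "\<And>a. a \<in> A i \<Longrightarrow> l i \<le> a" if "i < 3" for i
    using fin[OF that] ne[OF that] by (auto simp: l_def)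
  have key: "u i - l i + (u j - l j) \<le> u k - l k \<or> u i = l i \<and> u j = l j"
    if ijk: "perm3 i j k" for i j k
  proof -
    have lt: "i < 3" "j < 3" "k < 3" and perm: "perm3 i k j" "perm3 j k i" using ijk by auto
    consider "- (u i + u j) \<in> A k" "- (l i + l j) \<in> A k"
      | "- (u i + u j) \<in> B k" | "- (l i + l j) \<in> B k"
      using AA[OF ijk u(1)[OF lt(1)] u(1)[OF lt(2)]] AA[OF ijk l(1)[OF lt(1)] l(1)[OF lt(2)]]
        by blast
    then show ?thesis
    proof cases
      case 1
      then have "l k \<le> - (u i + u j)" "- (l i + l j) \<le> u k" using u l lt by auto
      then show ?thesis by linarith
    next
      case 2
      have "- (l i + - (u i + u j)) \<le> u j" "- (l j + - (u i + u j)) \<le> u i"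
        using AB[OF perm(1) l(1)[OF lt(1)] 2] AB[OF perm(2) l(1)[OF lt(2)] 2] u lt by auto
      moreover have "l i \<le> u i" "l j \<le> u j" using u l lt by auto
      ultimately show ?thesis by linarith
    next
      case 3
      have "l j \<le> - (u i + - (l i + l j))" "l i \<le> - (u j + - (l i + l j))"
        using AB[OF perm(1) u(1)[OF lt(1)] 3] AB[OF perm(2) u(1)[OF lt(2)] 3] l lt by auto
      moreover have "l i \<le> u i" "l j \<le> u j" using u l lt by auto
      ultimately show ?thesis by linarith
    qed
  qed
  note keys = key[of 0 1 2, simplified] key[of 0 2 1, simplified] key[of 1 2 0, simplified]
  have "l 0 \<le> u 0" "l 1 \<le> u 1" "l 2 \<le> u 2" using u l by auto
  note facts = keys this[unfolded One_nat_def]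
  have "u 0 = l 0" using facts by linarith
  moreover have "u (Suc 0) = l (Suc 0)" using facts by linarith
  moreover have "u 2 = l 2" using facts by linarith
  ultimately have eq: "u 0 = l 0" "u 1 = l 1" "u 2 = l 2" by simp_all
  have sing: "a = u i" if "i < 3" "a \<in> A i" for i a
  proof -
    have "i = 0 \<or> i = 1 \<or> i = 2" using that(1) by auto
    then have "u i = l i" using eq by auto
    then show ?thesis using u(2) l(2) that by force
  qed
  have "A 0 \<union> B 0 \<subseteq> {u 0, - (u 1 + u 2)}"
  proof
    fix b assume "b \<in> A 0 \<union> B 0"
    then consider "b \<in> A 0" | "b \<in> B 0" by blast
    then show "b \<in> {u 0, - (u 1 + u 2)}"
    proof cases
      case 1
      then show ?thesis using sing by simp
    next
      case 2
      have "- (u 1 + b) \<in> A 2" using AB[of 1 0 2 "u 1" b] u(1)[of 1] 2 by simp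
      then have "- (u 1 + b) = u 2" by (intro sing) auto
      then show ?thesis by simp
    qed
  qed
  then show ?thesis by (rule that)
qed

text \<open>For \<open>c = Complex 1 s\<close> the real part of \<open>c * z\<close> is
  \<open>Re z - s * Im z\<close>, so \<open>s\<close> only has to avoid finitely many quotients.
  This transfers finite sets of complex numbers to the ordered reals without collapsing distinct
  values.\<close>

lemma ex_Re_mult_nonzero:
  fixes Z :: "complex set"
  assumes "finite Z" "0 \<notin> Z"
  obtains c where "\<And>z. z \<in> Z \<Longrightarrow> Re (c * z) \<noteq> 0"
proof -
  obtain s :: real where s: "s \<notin> (\<lambda>z. Re z / Im z) ` Z"
    using ex_new_if_finite[OF infinite_UNIV_char_0] assms(1) by blast
  have "Re (Complex 1 s * z) \<noteq> 0" if z: "z \<in> Z" for z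
  proof (cases "Im z = 0")
    case True
    moreover have "z \<noteq> 0" using assms(2) z by blast
    ultimately show ?thesis by (simp add: complex_eq_iff)
  next
    case False
    have "s \<noteq> Re z / Im z" using s z by blast
    then show ?thesis using False by (simp add: field_simps)
  qed
  then show ?thesis by (rule that)
qed

lemma pairwise_nonparallel_span_Int:
  fixes v :: "'a::field ^ 'm"
  assumes "pairwise_nonparallel E" "p \<in> E" "q \<in> E" "p \<noteq> q" "v \<in> vec.span {p}" "v \<in> vec.span {q}"
  shows "v = 0"
proof (rule ccontr)
  assume "v \<noteq> 0"
  obtain a b where ab: "v = a *s p" "v = b *s q"
    using assms(5,6) unfolding mem_span_singleton by blast
  then have "a \<noteq> 0" using \<open>v \<noteq> 0\<close> by auto
  then have "p = (1 / a) *s (a *s p)" by simp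
  also have "\<dots> = (1 / a * b) *s q" using ab by (metis vec.scale_scale)
  finally have "p \<in> vec.span {q}" using mem_span_singleton by blast
  then show False using assms by (auto simp: pairwise_nonparallel_def)
qed

text \<open>Fix one direction, two congruent points \<open>x\<close>, \<open>x'\<close> for it, and
  a \<open>y\<close> in the other class. For any other direction \<open>x\<close> and
  \<open>x'\<close> are not congruent, so \<open>y\<close> is congruent to one of them. Each of the
  nonzero vectors \<open>x - y\<close> and \<open>x' - y\<close> has only one direction, so at most
  two further directions exist.\<close>

lemma few_two_class_directions:
  fixes X E :: "('a::field ^ 'm) set"
  assumes np: "pairwise_nonparallel E"
    and pair: "\<And>p. p \<in> E \<Longrightarrow> \<exists>x\<in>X. \<exists>y\<in>X. x \<noteq> y \<and> x - y \<in> vec.span {p}"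
    and classes: "\<And>p x y z. p \<in> E \<Longrightarrow> x \<in> X \<Longrightarrow> y \<in> X \<Longrightarrow> z \<in> X \<Longrightarrow>
      x - y \<in> vec.span {p} \<or> x - z \<in> vec.span {p} \<or> y - z \<in> vec.span {p}"
  shows "card E < 4"
proof (rule ccontr)
  assume "\<not> card E < 4"
  then obtain T where T: "T \<subseteq> E" "card T = 4"
    using obtain_subset_with_card_n[of 4 E] by auto
  have "finite T" using T(2) card.infinite by fastforce
  then obtain ps where ps: "set ps = T" "distinct ps" using finite_distinct_list by blast
  then have "length ps = 4" using T(2) distinct_card by metis
  then obtain p\<^sub>1 p\<^sub>2 p\<^sub>3 p\<^sub>4 where "ps = [p\<^sub>1, p\<^sub>2, p\<^sub>3, p\<^sub>4]"
    by (auto simp: length_Suc_conv eval_nat_numeral)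
  then have T4: "T = {p\<^sub>1, p\<^sub>2, p\<^sub>3, p\<^sub>4}" "distinct [p\<^sub>1, p\<^sub>2, p\<^sub>3, p\<^sub>4]" using ps by auto
  then have p: "p\<^sub>1 \<in> E" "p\<^sub>2 \<in> E" "p\<^sub>3 \<in> E" "p\<^sub>4 \<in> E" using T(1) by auto
  note zero = pairwise_nonparallel_span_Int[OF np]
  obtain x x' where x: "x \<in> X" "x' \<in> X" "x \<noteq> x'" "x - x' \<in> vec.span {p\<^sub>1}"
    using pair[OF p(1)] by blast
  obtain y where y: "y \<in> X" "x - y \<notin> vec.span {p\<^sub>1}"
  proof -
    obtain v v' where v: "v \<in> X" "v' \<in> X" "v \<noteq> v'" "v - v' \<in> vec.span {p\<^sub>2}"
      using pair[OF p(2)] by blast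
    \<comment> \<open>If both \<open>v\<close> and \<open>v'\<close> were congruent to
      \<open>x\<close>, their difference would lie in two different directions and vanish. So one of
      them serves as \<open>y\<close>.\<close>
    have "\<not> (x - v \<in> vec.span {p\<^sub>1} \<and> x - v' \<in> vec.span {p\<^sub>1})"
    proof
      assume "x - v \<in> vec.span {p\<^sub>1} \<and> x - v' \<in> vec.span {p\<^sub>1}"
      then have "(x - v') - (x - v) \<in> vec.span {p\<^sub>1}" using vec.span_diff by blast
      then have "v - v' = 0" using zero[OF p(1,2) _ _ v(4)] T4(2) by simp
      then show False using v(3) by simp
    qed
    then show ?thesis using that v by blast
  qed
  have x'y: "x' - y \<notin> vec.span {p\<^sub>1}"
  proof
    assume "x' - y \<in> vec.span {p\<^sub>1}"
    then have "(x - x') + (x' - y) \<in> vec.span {p\<^sub>1}" using x(4) vec.span_add by blast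
    then show False using y(2) by simp
  qed
  have two: "x - y \<in> vec.span {p} \<or> x' - y \<in> vec.span {p}" if "p \<in> E" "p \<noteq> p\<^sub>1" for p
    using classes[OF that(1) x(1,2) y(1)] zero[OF p(1) that(1) _ x(4)] that(2) x(3) by auto
  have "False" if "v \<notin> vec.span {p\<^sub>1}" "v \<in> vec.span {p}" "v \<in> vec.span {q}" "p \<in> E" "q \<in> E" "p \<noteq>
    q" for v p q
    using zero[OF that(4-6,2,3)] that(1) vec.span_zero by blast
  then show False
    using two[OF p(2)] two[OF p(3)] two[OF p(4)] y(2) x'y p T4(2) by simp metis
qed

section \<open>Coloured configurations\<close>

text \<open>The given sets have become colours, and points have become homogeneous vectors, so that
  collinearity is membership in a span.\<close>

locale coloured_configuration =
  fixes S :: "(complex ^ 'm) set" and \<kappa> :: "complex ^ 'm \<Rightarrow> 'c"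
  assumes finite_S: "finite S"
    and nonparallel: "pairwise_nonparallel S"
    and third: "\<And>p q. p \<in> S \<Longrightarrow> q \<in> S \<Longrightarrow> \<kappa> p \<noteq> \<kappa> q \<Longrightarrow>
      \<exists>r\<in>S. r \<in> vec.span {p, q} \<and> \<kappa> r \<noteq> \<kappa> p \<and> \<kappa> r \<noteq> \<kappa> q"
begin

lemma parallel_eq: "u \<in> S \<Longrightarrow> c *s u \<in> S \<Longrightarrow> c *s u = u"
  using nonparallel mem_span_singleton[of "c *s u" u] by (auto simp: pairwise_nonparallel_def)

text \<open>A vanishing coefficient would make the third point parallel, hence equal, to
  \<open>p\<close> or \<open>q\<close>, contrary to its colour.\<close>

lemma third_coeffs:
  assumes "p \<in> S" "q \<in> S" "\<kappa> p \<noteq> \<kappa> q"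
  obtains a b where "a \<noteq> 0" "b \<noteq> 0" "a *s p + b *s q \<in> S"
    "\<kappa> (a *s p + b *s q) \<noteq> \<kappa> p" "\<kappa> (a *s p + b *s q) \<noteq> \<kappa> q"
proof -
  obtain r where r: "r \<in> S" "r \<in> vec.span {p, q}" "\<kappa> r \<noteq> \<kappa> p" "\<kappa> r \<noteq> \<kappa> q"
    using third[OF assms] by blast
  obtain a b where ab: "r = a *s p + b *s q" using r(2) mem_span_pair by blast
  have "a \<noteq> 0"
  proof
    assume "a = 0"
    then show False using ab r parallel_eq[OF assms(2), of b] by simp
  qed
  moreover have "b \<noteq> 0"
  proof
    assume "b = 0"
    then show False using ab r parallel_eq[OF assms(1), of a] by simp
  qed
  ultimately show ?thesis using that r ab by blast
qed


text \<open>
  Otherwise the points spanned by \<open>p, q, x, y\<close> off \<open>L = span {p, q}\<close> lie on three planes through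
  \<open>L\<close>, and are multiples of \<open>h i + l\<close> with \<open>l \<in> X i \<subseteq> L\<close>, where \<open>h 0 + h 1 + h 2 = 0\<close>; collinear
  points in the three planes then correspond to \<open>l\<close>'s with sum 0. Applying a generic real-linear
  functional that vanishes on a point \<open>o'\<close> of \<open>L\<close> shows that \<open>X 0\<close> has at most two classes
  modulo \<open>o'\<close>, which is possible for at most three points \<open>o'\<close>.
\<close>

lemma rich_pencil_plane:
  fixes \<pi> :: "complex ^ 'm \<Rightarrow> complex ^ 'k"
  assumes lin: "Vector_Spaces.linear (*s) (*s) \<pi>"
    and ker: "\<And>v. \<pi> v = 0 \<longleftrightarrow> v \<in> vec.span {p, q}"
    and pq: "p \<in> S" "q \<in> S" "\<kappa> p \<noteq> \<kappa> q"
    and card: "4 \<le> card (S \<inter> vec.span {p, q})"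
    and x: "x \<in> S" and y: "y \<in> S"
    and xy: "\<And>a b. a *s \<pi> x + b *s \<pi> y = 0 \<Longrightarrow> a = 0 \<and> b = 0"
  obtains z w where "z \<in> S" "w \<in> S" "\<pi> z \<in> vec.span {\<pi> x, \<pi> y}" "\<pi> w \<in> vec.span {\<pi> x, \<pi> y}"
    "\<pi> z \<notin> vec.span {\<pi> x}" "\<pi> z \<notin> vec.span {\<pi> y}"
    "\<pi> w \<noteq> 0" "\<pi> w \<notin> vec.span {\<pi> x}" "\<pi> w \<notin> vec.span {\<pi> y}" "\<pi> w \<notin> vec.span {\<pi> z}"
proof -
  interpret \<pi>: Vector_Spaces.linear "(*s)" "(*s)" \<pi> by (rule lin)
  let ?L = "vec.span {p, q}"
  have other: "\<exists>r\<in>S \<inter> ?L. \<kappa> r \<noteq> \<gamma>" for \<gamma>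
  proof -
    have "p \<in> S \<inter> ?L" "q \<in> S \<inter> ?L" using pq by (auto intro: vec.span_base)
    then show ?thesis using pq(3) by metis
  qed
  \<comment> \<open>If \<open>x\<close> and \<open>y\<close> share a colour, \<open>x\<close> is
    exchanged for the third point on its line to a point of \<open>L\<close> of another colour; this
    stays in the plane of \<open>x\<close> through \<open>L\<close>.\<close>
  obtain c x' where x': "x' \<in> S" "\<kappa> x' \<noteq> \<kappa> y" "c \<noteq> 0" "\<pi> x' = c *s \<pi> x"
  proof (cases "\<kappa> x = \<kappa> y")
    case False
    then show ?thesis using that[of x 1] x by simp
  next
    case True
    obtain r where r: "r \<in> S" "r \<in> ?L" "\<kappa> r \<noteq> \<kappa> x" using other by blast
    obtain a b where ab: "a \<noteq> 0" "b \<noteq> 0" "a *s x + b *s r \<in> S" "\<kappa> (a *s x + b *s r) \<noteq> \<kappa> x"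
      using third_coeffs[OF x r(1)] r(3) by metis
    have "\<pi> (a *s x + b *s r) = a *s \<pi> x"
      using r(2) ker by (simp add: \<pi>.add \<pi>.scale)
    then show ?thesis using that[of "a *s x + b *s r" a] ab True by simp
  qed
  obtain \<alpha> \<beta> where z: "\<alpha> \<noteq> 0" "\<beta> \<noteq> 0" "\<alpha> *s x' + \<beta> *s y \<in> S"
    using third_coeffs[OF x'(1) y x'(2)] by metis
  define z' where "z' = \<alpha> *s x' + \<beta> *s y"
  have \<pi>z: "\<pi> z' = (\<alpha> * c) *s \<pi> x + \<beta> *s \<pi> y"
    by (simp add: z'_def \<pi>.add \<pi>.scale x'(4))
  have z_span: "\<pi> z' \<in> vec.span {\<pi> x, \<pi> y}"
    using \<pi>z mem_span_pair by blast
  have z_x: "\<pi> z' \<notin> vec.span {\<pi> x}"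
  proof
    assume "\<pi> z' \<in> vec.span {\<pi> x}"
    then obtain d where "(\<alpha> * c) *s \<pi> x + \<beta> *s \<pi> y = d *s \<pi> x"
      unfolding \<pi>z mem_span_singleton by blast
    then have "(\<alpha> * c - d) *s \<pi> x + \<beta> *s \<pi> y = 0"
      by (simp add: vec.scale_left_diff_distrib diff_add_eq)
    then show False using xy z(2) by blast
  qed
  have z_y: "\<pi> z' \<notin> vec.span {\<pi> y}"
  proof
    assume "\<pi> z' \<in> vec.span {\<pi> y}"
    then obtain d where "(\<alpha> * c) *s \<pi> x + \<beta> *s \<pi> y = d *s \<pi> y"
      unfolding \<pi>z mem_span_singleton by blast
    then have "(\<alpha> * c) *s \<pi> x + (\<beta> - d) *s \<pi> y = 0"
      by (simp add: vec.scale_left_diff_distrib add_diff_eq)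
    then have "\<alpha> * c = 0" using xy by blast
    then show False using z(1) x'(3) by simp
  qed
  note result = that
  show ?thesis
  proof (rule ccontr)
    assume neg: "\<not> thesis"
    have cover: "\<pi> w \<in> vec.span {\<pi> x} \<or> \<pi> w \<in> vec.span {\<pi> y} \<or> \<pi> w \<in> vec.span {\<pi> z'}"
      if w: "w \<in> S" "\<pi> w \<in> vec.span {\<pi> x, \<pi> y}" "\<pi> w \<noteq> 0" for w
      using result[of z' w] neg z(3)[folded z'_def] z_span z_x z_y w by blast
    \<comment> \<open>The three planes are represented by the terms of the relation
      \<open>\<alpha> *s x' + \<beta> *s y - z' = 0\<close>. The coordinates of their images with
      respect to \<open>\<pi> x\<close> and \<open>\<pi> y\<close> are \<open>s\<close> and
      \<open>t\<close>.\<close>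
    define h where "h i = (if i = 0 then \<alpha> *s x' else if i = 1 then \<beta> *s y else - z')" for i :: nat
    define s where "s i = (if i = 0 then \<alpha> * c else if i = 1 then 0 else - (\<alpha> * c))" for i :: nat
    define t where "t i = (if i = 0 then 0 else if i = 1 then \<beta> else - \<beta>)" for i :: nat
    have lt3: "i = 0 \<or> i = 1 \<or> i = 2" if "i < 3" for i :: nat using that by auto
    have h_sum: "h i + h j = - h k" if "perm3 i j k" for i j k
      using that lt3[of i] lt3[of j] lt3[of k] by (auto simp: h_def z'_def)
    have \<pi>h: "\<pi> (h i) = s i *s \<pi> x + t i *s \<pi> y" for i
      by (simp add: h_def s_def t_def \<pi>.scale \<pi>.neg \<pi>z x'(4))
    have ind: "a = 0 \<and> b = 0" if "a *s \<pi> (h i) + b *s \<pi> (h j)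
      = 0" "i < 3" "j < 3" "i \<noteq> j" for a b i j
    proof -
      have "(a * s i + b * s j) *s \<pi> x + (a * t i + b * t j) *s \<pi> y = 0"
        using that(1) by (simp add: \<pi>h vec.scale_left_distrib vec.scale_right_distrib algebra_simps)
      then have "a * s i + b * s j = 0" "a * t i + b * t j = 0" using xy by blast+
      then show ?thesis
        using lt3[OF that(2)] lt3[OF that(3)] that(4) z(1,2) x'(3) by (auto simp: s_def t_def)
    qed
    have h_nz: "\<pi> (h i) \<noteq> 0" if "i < 3" for i
    proof
      assume "\<pi> (h i) = 0"
      moreover have "(if i = 0 then 1 else 0) < (3 :: nat)" "i \<noteq> (if i = 0 then 1 else 0)" by auto
      then obtain j where "j < 3" "i \<noteq> j" by blast
      ultimately show False using ind[of 1 i 0 j] that by simp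
    qed
    have cover': "\<exists>m<3. \<exists>\<gamma>. \<pi> w = \<gamma> *s \<pi> (h m)"
      if w: "w \<in> S" "\<pi> w \<in> vec.span {\<pi> x, \<pi> y}" "\<pi> w \<noteq> 0" for w
    proof -
      from cover[OF w] consider d where "\<pi> w = d *s \<pi> x" | d where "\<pi> w = d *s \<pi> y" | d where "\<pi> w
        = d *s \<pi> z'"
        unfolding mem_span_singleton by blast
      then show ?thesis
      proof cases
        case 1
        then have "\<pi> w = (d / (\<alpha> * c)) *s \<pi> (h 0)"
          using z(1) x'(3) by (simp add: \<pi>h s_def t_def)
        moreover have "0 < (3 :: nat)" by simp
          ultimately show ?thesis by blast
      next
        case 2
        then have "\<pi> w = (d / \<beta>) *s \<pi> (h 1)"
          using z(2) by (simp add: \<pi>h s_def t_def)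
        moreover have "1 < (3 :: nat)" by simp
          ultimately show ?thesis by blast
      next
        case 3
        then have "\<pi> w = (- d) *s \<pi> (h 2)"
          by (simp add: h_def \<pi>.neg)
        moreover have "2 < (3 :: nat)" by simp
          ultimately show ?thesis by blast
      qed
    qed
    \<comment> \<open>Each point of plane \<open>i\<close> off \<open>L\<close> is a multiple of
      \<open>h i + l\<close> for one \<open>l\<close> in \<open>L\<close>, and no two points of
      \<open>S\<close> are parallel. So the elements of \<open>X i\<close> stand for points, and the
      choice in \<open>K\<close> picks the colour of the unique point represented.\<close>
    define X where "X i = {l \<in> ?L. \<exists>c. c \<noteq> 0 \<and> c *s (h i + l) \<in> S}" for i
    define K where "K i l = \<kappa> (SOME r. r \<in> S \<and> (\<exists>c. c \<noteq> 0 \<and> r = c *s (h i + l)))" for i l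
    have X_K: "l \<in> X i \<and> K i l = \<kappa> r" if r: "r \<in> S" "r
      = d *s (h i + l)" "d \<noteq> 0" "l \<in> ?L" for r d i l
    proof
      show "l \<in> X i" using r by (auto simp: X_def)
      have "(SOME r. r \<in> S \<and> (\<exists>c. c \<noteq> 0 \<and> r = c *s (h i + l))) = r"
      proof (rule some_equality)
        fix r' assume r': "r' \<in> S \<and> (\<exists>c. c \<noteq> 0 \<and> r' = c *s (h i + l))"
        then obtain c' where "r' = c' *s (h i + l)" by blast
        then have "r' = (c' / d) *s r" using r(2,3) by simp
        then show "r' = r" using parallel_eq[OF r(1)] r' by metis
      qed (use r in blast)
      then show "K i l = \<kappa> r" by (simp add: K_def)
    qed
    have X_E: "\<exists>r d. r \<in> S \<and> d \<noteq> 0 \<and> r = d *s (h i + l) \<and> \<kappa> r = K i l \<and> l \<in> ?L" if "l \<in> X i" for i l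
      using that X_K by (fastforce simp: X_def)
    have L: "vec.subspace ?L" by simp
    have zero_X: "0 \<in> X i" if "i < 3" for i
      using lt3[OF that]
    proof (elim disjE)
      assume i: "i = 0"
      have "x' = (1 / \<alpha>) *s (h i + 0)" using z(1) by (simp add: h_def i)
      from X_K[OF x'(1) this _ vec.span_zero] z(1) show ?thesis by simp
    next
      assume i: "i = 1"
      have "y = (1 / \<beta>) *s (h i + 0)" using z(2) by (simp add: h_def i)
      from X_K[OF y this _ vec.span_zero] z(2) show ?thesis by simp
    next
      assume i: "i = 2"
      have "z' = (- 1) *s (h i + 0)" by (simp add: h_def i)
      from X_K[OF z(3)[folded z'_def] this _ vec.span_zero] show ?thesis by simp
    qed
    have fin_X: "finite (X i)" if "i < 3" for i
    proof -
      define g where "g l = (SOME r. r \<in> S \<and> (\<exists>c. c \<noteq> 0 \<and> r = c *s (h i + l)))" for l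
      have g: "g l \<in> S \<and> (\<exists>c. c \<noteq> 0 \<and> g l = c *s (h i + l))" if "l \<in> X i" for l
        unfolding g_def by (rule someI_ex) (use that in \<open>auto simp: X_def\<close>)
      have "inj_on g (X i)"
      proof (rule inj_onI)
        fix l l' assume l: "l \<in> X i" "l' \<in> X i" "g l = g l'"
        obtain c c' where c: "c \<noteq> 0" "g l = c *s (h i + l)" "g l' = c' *s (h i + l')"
          using g l by meson
        have "\<pi> l = 0" "\<pi> l' = 0" using l ker by (auto simp: X_def)
        then have "c *s \<pi> (h i) = c' *s \<pi> (h i)"
          using arg_cong[OF l(3), of \<pi>] c by (simp add: \<pi>.add \<pi>.scale)
        then have "c = c'" using h_nz[OF \<open>i < 3\<close>] by simp
        then show "l = l'" using l(3) c by simp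
      qed
      moreover have "g ` X i \<subseteq> S" using g by blast
      ultimately show ?thesis using finite_S inj_on_finite by blast
    qed
    \<comment> \<open>A third point on a line joining planes \<open>i\<close> and \<open>j\<close>
      is in neither of them and not in \<open>L\<close>, so by \<open>cover'\<close> it lies in
      plane \<open>k\<close>. Independence of \<open>\<pi> (h i)\<close> and
      \<open>\<pi> (h j)\<close> then makes both coefficients equal to
      \<open>- \<gamma>\<close>.\<close>
    have across: "- (l + l') \<in> X k \<and> K k (- (l + l')) \<noteq> K i l \<and> K k (- (l + l')) \<noteq> K j l'"
      if ijk: "perm3 i j k" and l: "l \<in> X i" "l' \<in> X j" "K i l \<noteq> K j l'" for i j k l l'
    proof -
      obtain u d where u: "u \<in> S" "d \<noteq> 0" "u = d *s (h i + l)" "\<kappa> u = K i l" "l \<in> ?L"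
        using X_E[OF l(1)] by blast
      obtain u' d' where u': "u' \<in> S" "d' \<noteq> 0" "u' = d' *s (h j + l')" "\<kappa> u' = K j l'" "l' \<in> ?L"
        using X_E[OF l(2)] by blast
      obtain a b where ab: "a \<noteq> 0" "b \<noteq> 0" "a *s u + b *s u' \<in> S"
        "\<kappa> (a *s u + b *s u') \<noteq> \<kappa> u" "\<kappa> (a *s u + b *s u') \<noteq> \<kappa> u'"
        using third_coeffs[OF u(1) u'(1)] l(3) u(4) u'(4) by metis
      define r where "r = a *s u + b *s u'"
      have \<pi>l: "\<pi> l = 0" "\<pi> l' = 0" using u(5) u'(5) ker by auto
      have \<pi>r: "\<pi> r = (a * d) *s \<pi> (h i) + (b * d') *s \<pi> (h j)"
        by (simp add: r_def u(3) u'(3) \<pi>.add \<pi>.scale \<pi>l)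
      have "\<pi> r \<noteq> 0" using ind[of "a * d" i "b * d'" j] \<pi>r ab(1) u(2) ijk by auto
      moreover have "\<pi> r \<in> vec.span {\<pi> x, \<pi> y}"
      proof -
        have "\<pi> (h i) \<in> vec.span {\<pi> x, \<pi> y}" for i using \<pi>h mem_span_pair by blast
        then show ?thesis unfolding \<pi>r by (intro vec.span_add vec.span_scale) auto
      qed
      ultimately obtain m \<gamma> where m: "m < 3" "\<pi> r = \<gamma> *s \<pi> (h m)"
        using cover'[of r] ab(3) r_def by blast
      have "m \<noteq> i"
      proof
        assume "m = i"
        then have eq0: "(a * d - \<gamma>) *s \<pi> (h i) + (b * d') *s \<pi> (h j) = 0"
          using \<pi>r m(2) by (simp add: vec.scale_left_diff_distrib diff_add_eq)
        then show False using ind[OF eq0] ab(2) u'(2) ijk by auto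
      qed
      moreover have "m \<noteq> j"
      proof
        assume "m = j"
        then have eq0: "(a * d) *s \<pi> (h i) + (b * d' - \<gamma>) *s \<pi> (h j) = 0"
          using \<pi>r m(2) by (simp add: vec.scale_left_diff_distrib add_diff_eq)
        then show False using ind[OF eq0] ab(1) u(2) ijk by auto
      qed
      ultimately have "m = k" using m(1) ijk by auto
      have "h k = - (h i + h j)" by (simp only: h_sum[OF ijk] minus_minus)
      then have hk: "h k = - h i - h j" by simp
      have e: "(a * d) *s \<pi> (h i) + (b * d') *s \<pi> (h j) = \<gamma> *s (- \<pi> (h i) - \<pi> (h j))"
        using \<pi>r m(2) unfolding \<open>m = k\<close> hk by (simp add: \<pi>.diff \<pi>.neg)
      have "(a * d + \<gamma>) *s \<pi> (h i) + (b * d' + \<gamma>) *s \<pi> (h j)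
          = ((a * d) *s \<pi> (h i) + (b * d') *s \<pi> (h j)) + (\<gamma> *s \<pi> (h i) + \<gamma> *s \<pi> (h j))"
        by (simp add: vec.scale_left_distrib ac_simps)
      also have "\<dots> = 0" unfolding e by (simp add: vec_eq_iff algebra_simps)
      finally have eq0: "(a * d + \<gamma>) *s \<pi> (h i) + (b * d' + \<gamma>) *s \<pi> (h j) = 0" .
      have "a * d + \<gamma> = 0" "b * d' + \<gamma> = 0" using ind[OF eq0] ijk by simp_all
      then have \<gamma>: "a * d = - \<gamma>" "b * d' = - \<gamma>" by (simp_all add: eq_neg_iff_add_eq_0)
      then have "\<gamma> \<noteq> 0" using ab(1) u(2) by auto
      have "r = (a * d) *s (h i + l) + (b * d') *s (h j + l')"
        by (simp add: r_def u(3) u'(3))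
      also have "\<dots> = \<gamma> *s (h k + - (l + l'))"
        unfolding \<gamma> hk by (simp add: vec_eq_iff algebra_simps)
      finally have "r = \<gamma> *s (h k + - (l + l'))" .
      moreover have "- (l + l') \<in> ?L" using u(5) u'(5) L
        by (intro vec.subspace_neg vec.subspace_add)
      ultimately have "- (l + l') \<in> X k \<and> K k (- (l + l')) = \<kappa> r"
        using X_K[of r \<gamma> k "- (l + l')"] ab(3)[folded r_def] \<open>\<gamma> \<noteq> 0\<close> by blast
      then show ?thesis using ab(4,5) u(4) u'(4) by (simp add: r_def)
    qed
    \<comment> \<open>A third point on the line to \<open>o'\<close> in \<open>L\<close> remains in
      plane \<open>i\<close>; only its \<open>L\<close>-part moves, by a nonzero multiple of
      \<open>o'\<close>.\<close>
    have along: "\<exists>d. d \<noteq> 0 \<and> l + d *s o' \<in> X i \<and> K i (l + d *s o') \<noteq> K i l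
      \<and> K i (l + d *s o') \<noteq> \<kappa> o'"
      if o': "o' \<in> S" "o' \<in> ?L" and l: "l \<in> X i" "K i l \<noteq> \<kappa> o'" for o' l i
    proof -
      obtain u d where u: "u \<in> S" "d \<noteq> 0" "u = d *s (h i + l)" "\<kappa> u = K i l" "l \<in> ?L"
        using X_E[OF l(1)] by blast
      obtain a b where ab: "a \<noteq> 0" "b \<noteq> 0" "a *s u + b *s o' \<in> S"
        "\<kappa> (a *s u + b *s o') \<noteq> \<kappa> u" "\<kappa> (a *s u + b *s o') \<noteq> \<kappa> o'"
        using third_coeffs[OF u(1) o'(1)] l(2) u(4) by metis
      define e where "e = b / (a * d)"
      have "e \<noteq> 0" using ab u(2) by (simp add: e_def)
      have "a *s u + b *s o' = (a * d) *s (h i + (l + e *s o'))"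
        using ab(1) u(2) by (simp add: u(3) e_def vec_eq_iff field_simps)
      moreover have "l + e *s o' \<in> ?L" using u(5) o'(2) L
        by (intro vec.subspace_add vec.subspace_scale)
      ultimately have "l + e *s o' \<in> X i \<and> K i (l + e *s o') = \<kappa> (a *s u + b *s o')"
        using X_K[OF ab(3)] ab(1) u(2) by simp
      then show ?thesis using \<open>e \<noteq> 0\<close> ab(4,5) u(4) by auto
    qed
    have off_colour: "\<exists>l\<in>X i. K i l \<noteq> \<kappa> o'" if i: "o' \<in> S" "o' \<in> ?L" "i < 3" for o' i
    proof (cases "K i 0 = \<kappa> o'")
      case True
      obtain r where r: "r \<in> S" "r \<in> ?L" "\<kappa> r \<noteq> \<kappa> o'" using other by blast
      then obtain d where "0 + d *s r \<in> X i" "K i (0 + d *s r) \<noteq> K i 0"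
        using along[OF r(1,2) zero_X[OF i(3)]] True by metis
      then show ?thesis using True by auto
    qed (use zero_X i in auto)
    have "card (S \<inter> ?L) < 4"
    proof (rule few_two_class_directions[where X = "X 0"])
      show "pairwise_nonparallel (S \<inter> ?L)"
        using nonparallel by (auto simp: pairwise_nonparallel_def)
    next
      fix o' assume "o' \<in> S \<inter> ?L"
      then have o': "o' \<in> S" "o' \<in> ?L" by auto
      then have "o' \<noteq> 0" using nonparallel by (auto simp: pairwise_nonparallel_def)
      obtain l where l: "l \<in> X 0" "K 0 l \<noteq> \<kappa> o'" using off_colour[OF o', of 0] by auto
      obtain d where d: "d \<noteq> 0" "l + d *s o' \<in> X 0" using along[OF o' l] by blast
      moreover have "l + d *s o' - l \<in> vec.span {o'}" by (simp add: mem_span_singleton)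
      moreover have "l + d *s o' \<noteq> l" using d(1) \<open>o' \<noteq> 0\<close> by simp
      ultimately show "\<exists>l\<in>X 0. \<exists>l'\<in>X 0. l \<noteq> l' \<and> l - l' \<in> vec.span {o'}" using l(1) by blast
    next
      fix o' l\<^sub>1 l\<^sub>2 l\<^sub>3
      assume "o' \<in> S \<inter> ?L" and l: "l\<^sub>1 \<in> X 0" "l\<^sub>2 \<in> X 0" "l\<^sub>3 \<in> X 0"
      then have o': "o' \<in> S" "o' \<in> ?L" by auto
      show "l\<^sub>1 - l\<^sub>2 \<in> vec.span {o'} \<or> l\<^sub>1 - l\<^sub>3 \<in> vec.span {o'} \<or> l\<^sub>2 - l\<^sub>3 \<in> vec.span {o'}"
      proof -
        obtain o'' where o'': "o'' \<in> S" "o'' \<in> ?L" "\<kappa> o'' \<noteq> \<kappa> o'" using other by blast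
        have indep: "o'' \<notin> vec.span {o'}" "o' \<notin> vec.span {o''}" "o' \<noteq> 0" "o'' \<noteq> 0"
          using nonparallel o' o'' by (auto simp: pairwise_nonparallel_def)
        then have L_eq: "?L = vec.span {o', o''}"
          using span_pair_eq[OF o'(2) o''(2)] by simp
        have "vec.independent {o'', o'}"
          using indep by (simp add: vec.independent_insert)
        \<comment> \<open>A linear functional is read off from one coordinate of a linear map, with
          \<open>undefined\<close> as an arbitrary index. On \<open>L\<close> its kernel is the span
          of \<open>o'\<close>.\<close>
        then obtain g :: "complex ^ 'm \<Rightarrow> complex ^ 'm" where g: "Vector_Spaces.linear (*s) (*s) g"
          "\<And>v. v \<in> {o'', o'} \<Longrightarrow> g v = (if v = o'' then axis undefined 1 else 0)"
          using vec.linear_independent_extend[of "{o'', o'}" "\<lambda>v. if v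
            = o'' then axis undefined 1 else 0"] by blast
        interpret g: Vector_Spaces.linear "(*s)" "(*s)" g by (rule g(1))
        define f where "f v = g v $ undefined" for v
        have f_add: "f (v + w) = f v + f w" and f_diff: "f (v - w) = f v - f w"
          and f_scale: "f (c *s v) = c * f v" and f_neg: "f (- v) = - f v" for v w c
          by (simp_all add: f_def g.add g.diff g.scale g.neg)
        have "o'' \<noteq> o'" using o''(3) by auto
        then have f_o: "f o' = 0" "f o'' = 1"
          using g(2)[of o'] g(2)[of o''] by (auto simp: f_def axis_def)
        have f_ker: "v \<in> vec.span {o'}" if "v \<in> ?L" "f v = 0" for v
        proof -
          obtain a b where "v = a *s o' + b *s o''" using \<open>v \<in> ?L\<close> unfolding L_eq mem_span_pair
            by blast
          then show ?thesis using that(2) by (auto simp: f_add f_scale f_o mem_span_singleton)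
        qed
        \<comment> \<open>These are the nonzero values of \<open>f\<close> on differences within
          each \<open>X i\<close>. With all real parts kept nonzero, two elements of the same
          \<open>X i\<close> have equal \<open>\<phi>\<close> only if they agree modulo
          \<open>o'\<close>.\<close>
        let ?Z = "(\<Union>i\<in>{..<3}. (\<lambda>(l, l'). f (l - l')) ` (X i \<times> X i)) - {0}"
        have "finite ?Z" using fin_X by auto
        then obtain c where c: "\<And>v. v \<in> ?Z \<Longrightarrow> Re (c * v) \<noteq> 0"
          using ex_Re_mult_nonzero[of ?Z] by blast
        define \<phi> where "\<phi> v = Re (c * f v)" for v
        have \<phi>_add: "\<phi> (v + w) = \<phi> v + \<phi> w" and \<phi>_neg: "\<phi> (- v) = - \<phi> v"
          and \<phi>_o: "\<phi> (v + d *s o') = \<phi> v" for v w d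
          by (simp_all add: \<phi>_def f_add f_neg f_scale f_o algebra_simps)
        have \<phi>_inj: "l - l' \<in> vec.span {o'}" if "l \<in> X i" "l' \<in> X i" "i < 3" "\<phi> l = \<phi> l'" for l l' i
        proof (rule f_ker)
          show "l - l' \<in> ?L" using that(1,2) L by (auto simp: X_def intro: vec.subspace_diff)
          show "f (l - l') = 0"
          proof (rule ccontr)
            assume "f (l - l') \<noteq> 0"
            then have "f (l - l') \<in> ?Z" using that by force
            then have "Re (c * f (l - l')) \<noteq> 0" by (rule c)
            moreover have "Re (c * f (l - l')) = \<phi> l - \<phi> l'"
              by (simp add: \<phi>_def f_diff algebra_simps)
            ultimately show False using that(4) by simp
          qed
        qed
        \<comment> \<open>\<open>A i\<close> collects the classes modulo \<open>o'\<close> that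
          contain a colour other than \<open>\<kappa> o'\<close>; in the classes of
          \<open>B i\<close> every point has colour \<open>\<kappa> o'\<close>.\<close>
        define A where "A i = \<phi> ` {l \<in> X i. K i l \<noteq> \<kappa> o'}" for i
        define B where "B i = \<phi> ` X i - A i" for i
        obtain a b where ab: "A 0 \<union> B 0 \<subseteq> {a, b}"
        proof (rule sumset_triple[of A B])
          show "finite (A i)" if "i < 3" for i using fin_X[OF that] by (simp add: A_def)
          show "A i \<noteq> {}" if "i < 3" for i using off_colour[OF o' that] by (auto simp: A_def)
          show "- (a + b) \<in> A k \<union> B k" if ijk: "perm3 i j k" and ab: "a \<in> A i" "b \<in> A j"
            for i j k a b
          proof -
            obtain l where l: "l \<in> X i" "K i l \<noteq> \<kappa> o'" "a = \<phi> l" using ab(1) by (auto simp: A_def)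
            obtain l' where l': "l' \<in> X j" "b = \<phi> l'" using ab(2) by (auto simp: A_def)
            obtain d where d: "l + d *s o' \<in> X i" "K i (l + d *s o') \<noteq> K i l"
              using along[OF o' l(1,2)] by blast
            \<comment> \<open>The class of \<open>a\<close> contains points of two colours, so one
              of them differs in colour from \<open>l'\<close> and \<open>across\<close>
              applies.\<close>
            obtain l'' where "l'' \<in> X i" "K i l'' \<noteq> K j l'" "\<phi> l'' = a"
              using d l \<phi>_o by metis
            then have "- (l'' + l') \<in> X k" "\<phi> (- (l'' + l')) = - (a + b)"
              using across[OF ijk _ l'(1)] by (blast, simp only: \<phi>_add \<phi>_neg l'(2))
            then show ?thesis unfolding B_def by (metis Diff_iff UnCI image_eqI)
          qed
          show "- (a + b) \<in> A k" if ijk: "perm3 i j k" and ab: "a \<in> A i" "b \<in> B j" for i j k a b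
          proof -
            obtain l where l: "l \<in> X i" "K i l \<noteq> \<kappa> o'" "a = \<phi> l" using ab(1) by (auto simp: A_def)
            obtain l' where l': "l' \<in> X j" "b = \<phi> l'" using ab(2) by (auto simp: B_def)
            then have "K j l' = \<kappa> o'" using ab(2) by (auto simp: B_def A_def)
            then have "- (l + l') \<in> X k" "K k (- (l + l')) \<noteq> \<kappa> o'"
              using across[OF ijk l(1) l'(1)] l(2) by auto
            moreover have "\<phi> (- (l + l')) = - (a + b)" by (simp only: \<phi>_add \<phi>_neg l(3) l'(2))
            ultimately show ?thesis unfolding A_def
              by (metis (mono_tags, lifting) image_eqI mem_Collect_eq)
          qed
        qed
        have "\<phi> l \<in> {a, b}" if "l \<in> X 0" for l
          using ab that by (auto simp: B_def)
        then have "\<phi> l\<^sub>1 = \<phi> l\<^sub>2 \<or> \<phi> l\<^sub>1 = \<phi> l\<^sub>3 \<or> \<phi> l\<^sub>2 = \<phi> l\<^sub>3" using l by blast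
        then show ?thesis using \<phi>_inj l by (metis zero_less_numeral)
      qed
    qed
    then show False using card by simp
  qed
qed

end

section \<open>Projection from a line\<close>

lemma span_singleton_eq:
  fixes u v :: "'a::field ^ 'm"
  assumes "v \<in> vec.span {u}" "v \<noteq> 0"
  shows "vec.span {v} = vec.span {u}"
proof -
  obtain c where "v = c *s u" using assms(1) unfolding mem_span_singleton by blast
  then show ?thesis
    using vec.span_image_scale[of "{u}" "\<lambda>_. c"] assms(2) by auto
qed

text \<open>Planes through the line correspond to points of the projective plane over the quotient.
  The map sends the three vectors completing \<open>p\<close>, \<open>q\<close> to a basis onto the
  coordinate axes.\<close>

lemma quotient_by_line:
  fixes p q :: "complex ^ 5"
  assumes "p \<notin> vec.span {q}" "q \<noteq> 0"
  obtains \<pi> :: "complex ^ 5 \<Rightarrow> complex ^ 3" where "Vector_Spaces.linear (*s) (*s) \<pi>"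
    "\<And>v. \<pi> v = 0 \<longleftrightarrow> v \<in> vec.span {p, q}" "range \<pi> = UNIV"
proof -
  have "vec.independent {p, q}" using assms by (simp add: vec.independent_insert)
  then obtain Bs where Bs: "{p, q} \<subseteq> Bs" "vec.independent Bs" "UNIV \<subseteq> vec.span Bs"
    using vec.maximal_independent_subset_extend[of "{p, q}" UNIV] by auto
  have finB: "finite Bs" using Bs(2) by (rule vec.finiteI_independent)
  have "card Bs = CARD(5)"
    using vec.basis_card_eq_dim[OF subset_UNIV Bs(3,2)] by (simp only: vec_dim_card)
  then have cardB: "card Bs = 5" by simp
  define C where "C = Bs - {p, q}"
  have "p \<noteq> q" using assms(1) vec.span_base[of q "{q}"] by auto
  then have "card C = 3"
    using cardB Bs(1) finB by (simp add: C_def card_Diff_subset)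
  then have "card C = card (UNIV :: 3 set)" by simp
  then obtain \<beta> where \<beta>: "bij_betw \<beta> C (UNIV :: 3 set)"
    using finB by (metis C_def finite finite_Diff finite_same_card_bij)
  obtain \<pi> :: "complex ^ 5 \<Rightarrow> complex ^ 3" where \<pi>: "Vector_Spaces.linear (*s) (*s) \<pi>"
    "\<And>b. b \<in> Bs \<Longrightarrow> \<pi> b = (if b \<in> C then axis (\<beta> b) 1 else 0)"
    using vec.linear_independent_extend[OF Bs(2), of "\<lambda>b. if b \<in> C then axis (\<beta> b) 1 else 0"]
      by blast
  interpret \<pi>: Vector_Spaces.linear "(*s)" "(*s)" \<pi> by (rule \<pi>(1))
  have \<pi>C: "\<pi> b = axis (\<beta> b) 1" if "b \<in> C" for b using \<pi>(2)[of b] that by (simp add: C_def)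
  have "\<pi> ` C = (\<lambda>i. axis i 1) ` \<beta> ` C" using \<pi>C by (simp add: image_image)
  also have "\<dots> = cart_basis" using \<beta> by (auto simp: bij_betw_def cart_basis_def)
  finally have img: "\<pi> ` C = cart_basis" .
  have inj: "inj_on \<pi> C"
    using \<beta> by (auto simp: inj_on_def \<pi>C axis_eq_axis bij_betw_def)
  have pq0: "\<pi> p = 0" "\<pi> q = 0" using \<pi>(2) Bs(1) by (auto simp: C_def)
  have zero: "\<pi> u = 0" if u: "u \<in> vec.span {p, q}" for u
  proof -
    obtain a b where "u = a *s p + b *s q" using u mem_span_pair by blast
    then show ?thesis by (simp add: \<pi>.add \<pi>.scale pq0)
  qed
  show ?thesis
  proof (rule that[OF \<pi>(1)])
    fix v
    show "\<pi> v = 0 \<longleftrightarrow> v \<in> vec.span {p, q}"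
    proof
      assume v: "\<pi> v = 0"
      have "Bs = {p, q} \<union> C" using Bs(1) by (auto simp: C_def)
      then have "v \<in> vec.span ({p, q} \<union> C)" using Bs(3) by auto
      then obtain u w where uw: "v = u + w" "u \<in> vec.span {p, q}" "w \<in> vec.span C"
        unfolding vec.span_Un by blast
      then have "\<pi> w = 0" using v zero by (simp add: \<pi>.add)
      then have "w = 0"
        using vec.linear_indep_image_lemma[OF \<pi>(1) _ _ inj uw(3)] finB img independent_cart_basis
        by (simp add: C_def)
      then show "v \<in> vec.span {p, q}" using uw by simp
    qed (rule zero)
    have "vec.span (\<pi> ` C) = \<pi> ` vec.span C" by (rule \<pi>.span_image)
    then have "\<pi> ` vec.span C = UNIV" using img by simp
    then show "range \<pi> = UNIV" using image_mono[of "vec.span C" UNIV \<pi>]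
      by (simp add: top.extremum_uniqueI)
  qed
qed

text \<open>Projected from a line with four points, \<open>S\<close> gives a spanning set of
  \<open>complex ^ 3\<close>. Two of its points span a line carrying at least two more, by
  \<open>rich_pencil_plane\<close>, which the three-dimensional case forbids.\<close>

lemma bichromatic_line_card:
  fixes S :: "(complex ^ 5) set"
  assumes "coloured_configuration S \<kappa>" and span: "vec.span S = UNIV"
    and pq: "p \<in> S" "q \<in> S" "\<kappa> p \<noteq> \<kappa> q"
  shows "card (S \<inter> vec.span {p, q}) < 4"
proof (rule ccontr)
  assume "\<not> ?thesis"
  then have card: "4 \<le> card (S \<inter> vec.span {p, q})" by simp
  interpret coloured_configuration S \<kappa> by fact
  have "p \<notin> vec.span {q}" "q \<noteq> 0" using nonparallel pq by (auto simp: pairwise_nonparallel_def)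
  then obtain \<pi> :: "complex ^ 5 \<Rightarrow> complex ^ 3" where lin: "Vector_Spaces.linear (*s) (*s) \<pi>"
    and ker: "\<And>v. \<pi> v = 0 \<longleftrightarrow> v \<in> vec.span {p, q}" and range: "range \<pi> = UNIV"
    using quotient_by_line[of p q] by blast
  interpret \<pi>: Vector_Spaces.linear "(*s)" "(*s)" \<pi> by (rule lin)
  define Y where "Y = \<pi> ` S - {0}"
  have Y0: "0 \<notin> Y" by (simp add: Y_def)
  \<comment> \<open>The predicate depends on \<open>u\<close> only through its span, so parallel
    images receive the same representative.\<close>
  define rep where "rep u = (SOME v. v \<in> Y \<and> v \<in> vec.span {u})" for u
  have rep: "rep u \<in> Y" "rep u \<in> vec.span {u}" if "u \<in> Y" for u
    using someI[of "\<lambda>v. v \<in> Y \<and> v \<in> vec.span {u}" u] that vec.span_base[of u "{u}"]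
    by (auto simp: rep_def)
  have rep_span: "vec.span {rep u} = vec.span {u}" if "u \<in> Y" for u
  proof -
    have "rep u \<noteq> 0" using rep(1)[OF that] Y0 by metis
    with rep(2)[OF that] show ?thesis by (rule span_singleton_eq)
  qed
  have rep_eq: "rep u = rep v" if "vec.span {u} = vec.span {v}" for u v
    using that by (simp add: rep_def)
  have rep_cong: "rep u = rep v" if "u \<in> Y" "v \<in> Y" "rep u \<in> vec.span {rep v}" for u v
  proof (rule rep_eq)
    have "rep u \<noteq> 0" using rep(1)[OF that(1)] Y0 by metis
    with that(3) have "vec.span {rep u} = vec.span {rep v}" by (rule span_singleton_eq)
    then show "vec.span {u} = vec.span {v}" using rep_span that by simp
  qed
  define E where "E = rep ` Y"
  have EY: "E \<subseteq> Y" using rep by (auto simp: E_def)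
  show False
  proof (rule no_spanning_set_with_four_rich_lines[of E])
    show "finite E" using finite_S by (simp add: E_def Y_def)
    show "pairwise_nonparallel E"
      unfolding pairwise_nonparallel_def
    proof (intro conjI ballI impI)
      show "0 \<notin> E" using EY Y0 by blast
      fix e e' assume "e \<in> E" "e' \<in> E" "e \<in> vec.span {e'}"
      then show "e = e'" using rep_cong by (auto simp: E_def)
    qed
    show "vec.span E = UNIV"
    proof -
      have "\<pi> s \<in> vec.span E" if "s \<in> S" for s
      proof (cases "\<pi> s = 0")
        case True
        then show ?thesis by (simp add: vec.span_zero)
      next
        case False
        then have "\<pi> s \<in> Y" using that by (simp add: Y_def)
        then have "\<pi> s \<in> vec.span {rep (\<pi> s)}" "rep (\<pi> s) \<in> E"
          using rep_span vec.span_base[of "\<pi> s" "{\<pi> s}"] by (auto simp: E_def)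
        then show ?thesis using vec.span_mono[of "{rep (\<pi> s)}" E] by auto
      qed
      then have "vec.span (\<pi> ` S) \<subseteq> vec.span E"
        by (intro vec.span_minimal) auto
      moreover have "vec.span (\<pi> ` S) = UNIV"
        using \<pi>.span_image[of S] span range by simp
      ultimately show ?thesis by auto
    qed
    fix e e' assume ee: "e \<in> E" "e' \<in> E" "e \<noteq> e'"
    have eY: "e \<in> Y" "e' \<in> Y" using ee EY by auto
    obtain x where x: "x \<in> S" "e = \<pi> x" using eY by (auto simp: Y_def)
    obtain y where y: "y \<in> S" "e' = \<pi> y" using eY by (auto simp: Y_def)
    have rep_e: "rep v = v" if v: "v \<in> E" for v
    proof -
      obtain u where "u \<in> Y" "v = rep u" using v by (auto simp: E_def)
      then show ?thesis using rep_eq[OF rep_span] by simp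
    qed
    have nonpar: "e \<notin> vec.span {e'}" "e' \<notin> vec.span {e}"
      using rep_cong[OF eY] rep_cong[OF eY(2,1)] rep_e[OF ee(1)] rep_e[OF ee(2)] ee(3) by metis+
    have xy: "a = 0 \<and> b = 0" if "a *s \<pi> x + b *s \<pi> y = 0" for a b
    proof -
      have "a = 0"
      proof (rule ccontr)
        assume "a \<noteq> 0"
        have "a *s e = (- b) *s e'" using that x y by (simp add: eq_neg_iff_add_eq_0)
        have "e = (1 / a) *s (a *s e)" using \<open>a \<noteq> 0\<close> by simp
        also have "\<dots> = (1 / a * - b) *s e'"
          by (simp only: \<open>a *s e = (- b) *s e'\<close> vec.scale_scale)
        finally show False using nonpar(1) mem_span_singleton by blast
      qed
      moreover have "e' \<noteq> 0" using eY Y0 by auto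
      ultimately show ?thesis using that y by simp
    qed
    obtain z w where zw: "z \<in> S" "w \<in> S" "\<pi> z \<in> vec.span {\<pi> x, \<pi> y}" "\<pi> w \<in> vec.span {\<pi> x, \<pi> y}"
      "\<pi> z \<notin> vec.span {\<pi> x}" "\<pi> z \<notin> vec.span {\<pi> y}"
      "\<pi> w \<noteq> 0" "\<pi> w \<notin> vec.span {\<pi> x}" "\<pi> w \<notin> vec.span {\<pi> y}" "\<pi> w \<notin> vec.span {\<pi> z}"
      by (rule rich_pencil_plane[OF lin ker pq card x(1) y(1) xy])
    have "\<pi> z \<noteq> 0" using zw(5) vec.span_zero by metis
    then have zwY: "\<pi> z \<in> Y" "\<pi> w \<in> Y" using zw(1,2,7) by (simp_all add: Y_def)
    have sub: "rep u \<in> E \<inter> vec.span {e, e'}" if "u \<in> Y" "u \<in> vec.span {e, e'}" for u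
    proof -
      have "vec.span {u} \<subseteq> vec.span {e, e'}"
        using that(2) by (intro vec.span_minimal) auto
      then show ?thesis using rep(2)[OF that(1)] that(1) by (auto simp: E_def)
    qed
    have neq: "rep u \<noteq> rep v" if "u \<in> Y" "v \<in> Y" "u \<notin> vec.span {v}" for u v
      using that rep_span vec.span_base[of u "{u}"] by (metis singletonI)
    have "card {rep e, rep e', rep (\<pi> z), rep (\<pi> w)} = 4"
      using neq[of e e'] neq[of "\<pi> z" e] neq[of "\<pi> z" e'] neq[of "\<pi> w" e] neq[of "\<pi> w" e'] neq[of
        "\<pi> w" "\<pi> z"]
        eY zwY zw x y nonpar by (simp add: eq_commute[of "rep e"] eq_commute[of "rep e'"]
          eq_commute[of "rep (\<pi> z)"])
    moreover have "{rep e, rep e', rep (\<pi> z), rep (\<pi> w)} \<subseteq> E \<inter> vec.span {e, e'}"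
      using sub eY zwY zw(3,4) x y by (auto simp: vec.span_base)
    moreover have "finite (E \<inter> vec.span {e, e'})" using finite_S by (simp add: E_def Y_def)
    ultimately show "4 \<le> card (E \<inter> vec.span {e, e'})" by (metis card_mono)
  qed
qed

section \<open>The contradiction in dimension five\<close>

locale spanning_coloured_configuration = coloured_configuration S \<kappa>
  for S :: "(complex ^ 5) set" and \<kappa> :: "complex ^ 5 \<Rightarrow> 'c" +
  fixes p\<^sub>0 q\<^sub>0
  assumes span_S: "vec.span S = UNIV"
    and p\<^sub>0: "p\<^sub>0 \<in> S" and q\<^sub>0: "q\<^sub>0 \<in> S" and pq\<^sub>0: "\<kappa> p\<^sub>0 \<noteq> \<kappa> q\<^sub>0"
begin

lemma bichromatic_line:
  assumes "p \<in> S" "q \<in> S" "\<kappa> p \<noteq> \<kappa> q"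
  obtains r where "S \<inter> vec.span {p, q} = {p, q, r}" "\<kappa> r \<noteq> \<kappa> p" "\<kappa> r \<noteq> \<kappa> q"
proof -
  obtain r where r: "r \<in> S" "r \<in> vec.span {p, q}" "\<kappa> r \<noteq> \<kappa> p" "\<kappa> r \<noteq> \<kappa> q"
    using third[OF assms] by blast
  have "{p, q, r} \<subseteq> S \<inter> vec.span {p, q}"
    using assms(1,2) r(1,2) by (auto intro: vec.span_base)
  moreover have "card {p, q, r} = 3" using assms(3) r(3,4) by (auto simp: card_insert_if)
  moreover have "card (S \<inter> vec.span {p, q}) < 4"
    by (rule bichromatic_line_card[OF coloured_configuration_axioms span_S assms])
  ultimately have "{p, q, r} = S \<inter> vec.span {p, q}"
    using finite_S by (intro card_seteq) auto
  then show ?thesis using that r(3,4) by metis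
qed

text \<open>A point of colour \<open>\<gamma>\<close> lies on a line through a point of another
  colour and the resulting third point, and both of these avoid \<open>\<gamma>\<close>.\<close>

lemma span_avoiding_colour: "vec.span {s \<in> S. \<kappa> s \<noteq> \<gamma>} = UNIV"
proof -
  have "s \<in> vec.span {s \<in> S. \<kappa> s \<noteq> \<gamma>}" if s: "s \<in> S" for s
  proof (cases "\<kappa> s = \<gamma>")
    case False
    then show ?thesis using s by (intro vec.span_base) simp
  next
    case True
    obtain p where p: "p \<in> S" "\<kappa> p \<noteq> \<gamma>" using p\<^sub>0 q\<^sub>0 pq\<^sub>0 by metis
    obtain a b where ab: "a \<noteq> 0" "a *s s + b *s p \<in> S" "\<kappa> (a *s s + b *s p) \<noteq> \<gamma>"
      using third_coeffs[OF s p(1)] p(2) True by metis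
    have "s = (1 / a) *s ((a *s s + b *s p) - b *s p)" using ab(1) by simp
    moreover have "(1 / a) *s ((a *s s + b *s p) - b *s p) \<in> vec.span {s \<in> S. \<kappa> s \<noteq> \<gamma>}"
      using ab p by (intro vec.span_scale vec.span_diff vec.span_base) auto
    ultimately show ?thesis by metis
  qed
  then have "vec.span S \<subseteq> vec.span {s \<in> S. \<kappa> s \<noteq> \<gamma>}" by (intro vec.span_minimal) auto
  then show ?thesis using span_S by auto
qed

lemma outside_point:
  assumes "vec.subspace W" "W \<noteq> UNIV"
  obtains x where "x \<in> S" "x \<notin> W" "\<kappa> x \<noteq> \<gamma>"
proof -
  have "\<not> {s \<in> S. \<kappa> s \<noteq> \<gamma>} \<subseteq> W"
    using assms span_avoiding_colour[of \<gamma>] vec.span_minimal by blast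
  then show ?thesis using that by blast
qed

section \<open>Counting third points outside a subspace\<close>

definition off :: "(complex ^ 5) set \<Rightarrow> complex ^ 5 \<Rightarrow> nat" where
  "off W x = card {w \<in> S \<inter> W. \<kappa> w \<noteq> \<kappa> x}"

text \<open>Sending \<open>w\<close> to a third point on the line from \<open>x\<close> to
  \<open>w\<close> is injective, by disjointness of the cone lines. Its values avoid
  \<open>W\<close> and \<open>x\<close>; the latter makes the inequality strict.\<close>

lemma off_less:
  assumes W: "vec.subspace W" and x: "x \<in> S" "x \<notin> W"
  shows "off W x < card ((S - W) \<inter> vec.span (insert x W))"
proof -
  let ?N = "{w \<in> S \<inter> W. \<kappa> w \<noteq> \<kappa> x}"
  define f where "f w = (SOME r. r \<in> S \<and> r \<in> vec.span {x, w} \<and> \<kappa> r \<noteq> \<kappa> x \<and> \<kappa> r \<noteq> \<kappa> w)" for w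
  have f: "f w \<in> S \<and> f w \<in> vec.span {x, w} \<and> \<kappa> (f w) \<noteq> \<kappa> x \<and> \<kappa> (f w) \<noteq> \<kappa> w" if "w \<in> ?N" for w
    unfolding f_def by (rule someI_ex) (use third[of x w] x(1) that in auto)
  have np: "u \<notin> vec.span {v}" if "u \<in> S" "v \<in> S" "\<kappa> u \<noteq> \<kappa> v" for u v
    using nonparallel that by (auto simp: pairwise_nonparallel_def)
  have "inj_on f ?N"
  proof (rule inj_onI)
    fix w w' assume w: "w \<in> ?N" "w' \<in> ?N" "f w = f w'"
    have "w \<in> vec.span {w'}"
      using f[OF w(1)] f[OF w(2)] w np[of "f w" x] x(1)
      by (intro cone_disjoint[OF W x(2), of w w' "f w"]) auto
    then show "w = w'" using nonparallel w by (auto simp: pairwise_nonparallel_def)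
  qed
  moreover have "f w \<in> (S - W) \<inter> vec.span (insert x W) - {x}" if w: "w \<in> ?N" for w
  proof -
    have "f w \<notin> W"
      using f[OF w] w np[of "f w" w] by (intro cone_notin[OF W x(2), of w]) auto
    moreover have "vec.span {x, w} \<subseteq> vec.span (insert x W)"
      using w by (intro vec.span_mono) auto
    ultimately show ?thesis using f[OF w] by auto
  qed
  ultimately have "card ?N \<le> card ((S - W) \<inter> vec.span (insert x W) - {x})"
    using finite_S by (intro card_inj_on_le[of f]) auto
  also have "\<dots> < card ((S - W) \<inter> vec.span (insert x W))"
    using finite_S x by (intro psubset_card_mono) (auto intro: vec.span_base)
  finally show ?thesis by (simp add: off_def)
qed

text \<open>The spans of \<open>W\<close> with \<open>x\<close> and of \<open>W\<close> with
  \<open>y\<close> meet only in \<open>W\<close>, so the two counts are disjoint. The summand 2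
  records the two strict inequalities.\<close>

lemma off_add_off:
  assumes W: "vec.subspace W" and x: "x \<in> S" "x \<notin> W" and y: "y \<in> S" "y \<notin> vec.span (insert x W)"
  shows "off W x + off W y + 2 \<le> card (S - W)"
proof -
  have span_W: "vec.span W = W" using W by (simp add: vec.span_eq_iff)
  have yW: "y \<notin> W" using y(2) vec.span_superset[of "insert x W"] by auto
  have "(S - W) \<inter> vec.span (insert x W) \<inter> ((S - W) \<inter> vec.span (insert y W)) = {}"
  proof (rule ccontr)
    assume "\<not> ?thesis"
    then obtain z where z: "z \<notin> W" "z \<in> vec.span (insert x W)" "z \<in> vec.span (insert y W)" by blast
    obtain a where a: "z - a *s y \<in> W" using z(3) by (auto simp: vec.span_insert span_W)
    have "a \<noteq> 0" using a z(1) by auto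
    have "z - a *s y \<in> vec.span (insert x W)" using a by (intro vec.span_base) auto
    with z(2) have "z - (z - a *s y) \<in> vec.span (insert x W)" by (rule vec.span_diff)
    then have "a *s y \<in> vec.span (insert x W)" by simp
    then have "(1 / a) *s (a *s y) \<in> vec.span (insert x W)" by (rule vec.span_scale)
    then show False using y(2) \<open>a \<noteq> 0\<close> by simp
  qed
  then have "card ((S - W) \<inter> vec.span (insert x W)) + card ((S - W) \<inter> vec.span (insert y W))
    \<le> card (S - W)"
    using finite_S by (subst card_Un_disjoint[symmetric]) (auto intro!: card_mono)
  then show ?thesis using off_less[OF W x] off_less[OF W y(1) yW] by linarith
qed

lemma card_Int_le_off:
  assumes "\<kappa> x \<noteq> \<kappa> y"
  shows "card (S \<inter> W) \<le> off W x + off W y"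
proof -
  have "S \<inter> W \<subseteq> {w \<in> S \<inter> W. \<kappa> w \<noteq> \<kappa> x} \<union> {w \<in> S \<inter> W. \<kappa> w \<noteq> \<kappa> y}" using assms by auto
  then have "card (S \<inter> W) \<le> card ({w \<in> S \<inter> W. \<kappa> w \<noteq> \<kappa> x} \<union> {w \<in> S \<inter> W. \<kappa> w \<noteq> \<kappa> y})"
    using finite_S by (intro card_mono) auto
  also have "\<dots> \<le> off W x + off W y" unfolding off_def by (rule card_Un_le)
  finally show ?thesis .
qed

lemma dim_insert_le: "vec.dim (insert x W) \<le> Suc (vec.dim W)" for W :: "(complex ^ 5) set"
  by (simp add: vec.dim_insert)

lemma dim_UNIV5: "vec.dim (UNIV :: (complex ^ 5) set) = 5"
  using vec_dim_card[where 'n=5 and 'a=complex] by simp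

text \<open>The colour forbidden for \<open>y\<close> is a function \<open>\<delta>\<close> of
  \<open>x\<close>, so that \<open>y\<close> can be required to differ in colour from
  \<open>x\<close>. The bound 3 leaves room for \<open>x\<close> and still a proper subspace of
  dimension at most 4.\<close>

lemma two_outside_points:
  assumes W: "vec.subspace W" and dim: "vec.dim W \<le> 3"
  obtains x y where "x \<in> S" "x \<notin> W" "\<kappa> x \<noteq> \<gamma>" "y \<in> S" "y \<notin> vec.span (insert x W)" "\<kappa> y \<noteq> \<delta> x"
proof -
  have "W \<noteq> UNIV" using dim dim_UNIV5 by auto
  then obtain x where x: "x \<in> S" "x \<notin> W" "\<kappa> x \<noteq> \<gamma>" using outside_point[OF W] by blast
  have le4: "vec.dim (vec.span (insert x W)) \<le> 4" using dim_insert_le[of x W] dim by simp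
  have "vec.span (insert x W) \<noteq> UNIV"
  proof
    assume "vec.span (insert x W) = UNIV"
    then have "vec.dim (vec.span (insert x W)) = 5" by (simp only: dim_UNIV5)
    with le4 show False by linarith
  qed
  then obtain y where "y \<in> S" "y \<notin> vec.span (insert x W)" "\<kappa> y \<noteq> \<delta> x"
    using outside_point[OF vec.subspace_span] by blast
  then show ?thesis using that x by blast
qed

text \<open>A rearrangement of \<open>5 * card (S \<inter> W) < 2 * card S\<close>. If
  \<open>W\<close> meets two colours, it has three points of distinct colours, any colour is avoided
  by two of them, and 2 + 2 + 2 points lie outside. If it meets at most one, \<open>x\<close> and
  \<open>y\<close> of other colours see all of \<open>S \<inter> W\<close>.\<close>

lemma dim_two_bound:
  assumes W: "vec.subspace W" "vec.dim W = 2"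
  shows "3 * card (S \<inter> W) < 2 * card (S - W)"
proof -
  have le3: "vec.dim W \<le> 3" using W(2) by simp
  show ?thesis
  proof (cases "\<exists>a\<in>S \<inter> W. \<exists>b\<in>S \<inter> W. \<kappa> a \<noteq> \<kappa> b")
    case True
    then obtain a b where ab: "a \<in> S" "b \<in> S" "a \<in> W" "b \<in> W" "\<kappa> a \<noteq> \<kappa> b" by auto
    have "a \<notin> vec.span {b}" "b \<noteq> 0" using nonparallel ab by (auto simp: pairwise_nonparallel_def)
    then have "vec.independent {a, b}" by (simp add: vec.independent_insert)
    moreover have "card {a, b} = 2" using ab(5) by (auto simp: card_insert_if)
    ultimately have "W \<subseteq> vec.span {a, b}"
      using vec.card_eq_dim[of "{a, b}" W] ab W by auto
    moreover have "vec.span {a, b} \<subseteq> W" using ab W by (intro vec.span_minimal) auto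
    ultimately have W_eq: "W = vec.span {a, b}" by simp
    obtain r where r: "S \<inter> W = {a, b, r}" "\<kappa> r \<noteq> \<kappa> a" "\<kappa> r \<noteq> \<kappa> b"
      using bichromatic_line[OF ab(1,2,5)] unfolding W_eq by metis
    have off2: "2 \<le> off W x" for x
    proof -
      obtain u v where uv: "u \<in> S \<inter> W" "v \<in> S \<inter> W" "\<kappa> u \<noteq> \<kappa> x" "\<kappa> v \<noteq> \<kappa> x" "u \<noteq> v"
      proof (cases "\<kappa> a = \<kappa> x")
        case True
        then show ?thesis using that[of b r] r ab(5) by auto
      next
        case False
        then show ?thesis using that[of a b] that[of a r] r ab(5) by (cases "\<kappa> b = \<kappa> x") auto
      qed
      have "card {u, v} \<le> off W x"
        unfolding off_def using finite_S uv by (intro card_mono) auto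
      then show ?thesis using uv(5) by simp
    qed
    obtain x y where "x \<in> S" "x \<notin> W" "y \<in> S" "y \<notin> vec.span (insert x W)"
      using two_outside_points[OF W(1) le3, of "\<kappa> a" "\<lambda>_. \<kappa> a"] by blast
    then have "off W x + off W y + 2 \<le> card (S - W)" by (rule off_add_off[OF W(1)])
    then have "6 \<le> card (S - W)" using off2[of x] off2[of y] by linarith
    moreover have "card (S \<inter> W) \<le> 3" unfolding r(1) by (simp add: card_insert_if)
    ultimately show ?thesis by linarith
  next
    case False
    then obtain \<gamma> where \<gamma>: "\<And>w. w \<in> S \<inter> W \<Longrightarrow> \<kappa> w = \<gamma>" by metis
    obtain x y where xy: "x \<in> S" "x \<notin> W" "\<kappa> x \<noteq> \<gamma>" "y \<in> S" "y \<notin> vec.span (insert x W)" "\<kappa> y \<noteq> \<gamma>"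
      using two_outside_points[OF W(1) le3, of \<gamma> "\<lambda>_. \<gamma>"] by blast
    have "{w \<in> S \<inter> W. \<kappa> w \<noteq> \<kappa> x} = S \<inter> W" "{w \<in> S \<inter> W. \<kappa> w \<noteq> \<kappa> y} = S \<inter> W"
      using \<gamma> xy(3,6) by auto
    then have "off W x = card (S \<inter> W)" "off W y = card (S \<inter> W)" by (simp_all add: off_def)
    then show ?thesis using off_add_off[OF W(1) xy(1,2,4,5)] by linarith
  qed
qed

lemma card_S: "card S = card (S \<inter> W) + card (S - W)"
  using finite_S by (metis card_Int_Diff)

lemma uncrowded_S: "uncrowded S"
proof
  show "S \<noteq> {}" using p\<^sub>0 by auto
  show "0 \<notin> S" using nonparallel by (simp add: pairwise_nonparallel_def)
  fix W :: "(complex ^ 5) set"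
  assume W: "vec.subspace W" "W \<noteq> {0}" "W \<noteq> UNIV"
  have "vec.dim W \<noteq> 0" using W(1,2) vec.subspace_0 by fastforce
  moreover have "vec.dim W < 5"
    using vec.dim_psubset[of W UNIV] W dim_UNIV5
      by (simp add: vec.span_eq_iff[THEN iffD2] psubset_eq)
  ultimately consider "vec.dim W = 1" | "vec.dim W = 2" | "vec.dim W = 3" | "vec.dim W = 4"
    by linarith
  then have "5 * card (S \<inter> W) < card S * vec.dim W"
  proof cases
    case 1
    have "card (S \<inter> W) \<le> 1"
    proof (rule ccontr)
      assume "\<not> ?thesis"
      then have "\<not> (\<forall>a\<in>S \<inter> W. \<forall>b\<in>S \<inter> W. a = b)"
        using card_le_Suc0_iff_eq[of "S \<inter> W"] finite_S by simp
      then obtain a b where ab: "a \<in> S" "b \<in> S" "a \<in> W" "b \<in> W" "a \<noteq> b" by blast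
      then have "a \<notin> vec.span {b}" "b \<noteq> 0" using nonparallel
        by (auto simp: pairwise_nonparallel_def)
      then have "vec.independent {a, b}" by (simp add: vec.independent_insert)
      then have "card {a, b} \<le> vec.dim W" using ab by (intro vec.independent_card_le_dim) auto
      then show False using ab(5) 1 by simp
    qed
    \<comment> \<open>A line meeting two colours has three points, and the bound in dimension 2 then
      puts at least five outside it.\<close>
    moreover have "5 < card S"
    proof -
      let ?L = "vec.span {p\<^sub>0, q\<^sub>0}"
      have "p\<^sub>0 \<notin> vec.span {q\<^sub>0}" "q\<^sub>0 \<noteq> 0" using nonparallel p\<^sub>0 q\<^sub>0 pq\<^sub>0
        by (auto simp: pairwise_nonparallel_def)
      then have "vec.independent {p\<^sub>0, q\<^sub>0}" by (simp add: vec.independent_insert)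
      then have "vec.dim ?L = 2"
        using pq\<^sub>0 by (subst vec.dim_span_eq_card_independent) (auto simp: card_insert_if)
      then have "3 * card (S \<inter> ?L) < 2 * card (S - ?L)" by (intro dim_two_bound) auto
      moreover obtain r where "S \<inter> ?L = {p\<^sub>0, q\<^sub>0, r}" "\<kappa> r \<noteq> \<kappa> p\<^sub>0" "\<kappa> r \<noteq> \<kappa> q\<^sub>0"
        using bichromatic_line[OF p\<^sub>0 q\<^sub>0 pq\<^sub>0] by metis
      then have "card (S \<inter> ?L) = 3" using pq\<^sub>0 by (auto simp: card_insert_if)
      ultimately show ?thesis using card_S[of ?L] by linarith
    qed
    ultimately show ?thesis using 1 by simp
  next
    case 2
    then show ?thesis using dim_two_bound[OF W(1) 2] card_S[of W] by simp
  next
    case 3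
    obtain x y where xy: "x \<in> S" "x \<notin> W" "y \<in> S" "y \<notin> vec.span (insert x W)" "\<kappa> y \<noteq> \<kappa> x"
      using two_outside_points[OF W(1) eq_refl[OF 3], of "\<kappa> p\<^sub>0" \<kappa>] by blast
    have "card (S \<inter> W) \<le> off W x + off W y" using xy(5) by (intro card_Int_le_off) simp
    then show ?thesis using off_add_off[OF W(1) xy(1-4)] card_S[of W] 3 by simp
  next
    case 4
    \<comment> \<open>For a hyperplane two points outside may generate the same span with
      \<open>W\<close>, so their counts are not added as disjoint. Bounding each by
      \<open>card (S - W)\<close> suffices here.\<close>
    obtain x where x: "x \<in> S" "x \<notin> W" using outside_point[OF W(1,3)] by metis
    obtain y where y: "y \<in> S" "y \<notin> W" "\<kappa> y \<noteq> \<kappa> x" using outside_point[OF W(1,3)] by metis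
    have "card (S \<inter> W) \<le> off W x + off W y" using y(3) by (intro card_Int_le_off) simp
    moreover have "off W z < card (S - W)" if "z \<in> S" "z \<notin> W" for z
      using off_less[OF W(1) that] card_mono[of "S - W" "(S - W) \<inter> vec.span (insert z W)"] finite_S
      by (simp add: less_le_trans)
    then have "off W x < card (S - W)" "off W y < card (S - W)" using x y by auto
    ultimately show ?thesis using card_S[of W] 4 by simp
  qed
  then show "CARD(5) * card (S \<inter> W) < card S * vec.dim W" by simp
qed (rule finite_S)

lemma contradiction: False
proof -
  obtain h :: "complex ^ 5 \<Rightarrow> complex ^ 5 \<Rightarrow> real" where h:
    "\<And>i. i \<in> S \<Longrightarrow> h i i = (CARD(5) / card S)\<^sup>2"
    "(\<Sum>i\<in>S. \<Sum>j\<in>S. h i j) = CARD(5)"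
    "\<And>K W. vec.subspace W \<Longrightarrow> K \<subseteq> S \<inter> W \<Longrightarrow>
      (card K * (CARD(5) / card S))\<^sup>2 \<le> vec.dim W * (\<Sum>i\<in>K. \<Sum>j\<in>K. h i j)"
    using isotropic_correlations[OF uncrowded_S] by blast
  define n where "n = real (card S)"
  have n: "0 < n" using finite_S p\<^sub>0 by (auto simp: n_def card_gt_0_iff)
  define P where "P = {(i, j). i \<in> S \<and> j \<in> S \<and> \<kappa> i \<noteq> \<kappa> j}"
  \<comment> \<open>The diagonal belongs to \<open>Q\<close>. Each colour class is estimated within
    the whole space of dimension 5, so equal-coloured pairs average at least 1/5.\<close>
  define Q where "Q = {(i, j). i \<in> S \<and> j \<in> S \<and> \<kappa> i = \<kappa> j}"
  have PQ: "S \<times> S = P \<union> Q" "P \<inter> Q = {}" by (auto simp: P_def Q_def)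
  have fin: "finite P" "finite Q" using finite_S PQ(1) by (metis finite_SigmaI finite_Un)+
  have line: "\<exists>r. S \<inter> vec.span {i, j} = {i, j, r} \<and> \<kappa> r \<noteq> \<kappa> i \<and> \<kappa> r \<noteq> \<kappa> j" if "(i, j) \<in> P" for i j
  proof -
    have "i \<in> S" "j \<in> S" "\<kappa> i \<noteq> \<kappa> j" using that by (auto simp: P_def)
    then show ?thesis by (metis bichromatic_line)
  qed
  have P_bound: "(real 3 - 2) / (2 * (real 3 - 1)) * (CARD(5) / card S)\<^sup>2 * card P
    \<le> (\<Sum>(i, j)\<in>P. h i j)"
  proof (rule pair_sum_bound[where r\<^sub>0=3, OF finite_S nonparallel _ _ _ _ h(1,3)])
    show "P \<subseteq> {(i, j). i \<in> S \<and> j \<in> S \<and> i \<noteq> j}" by (auto simp: P_def)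
    fix i j assume ij: "(i, j) \<in> P"
    obtain r where r: "S \<inter> vec.span {i, j} = {i, j, r}" "\<kappa> r \<noteq> \<kappa> i" "\<kappa> r \<noteq> \<kappa> j"
      using line[OF ij] by blast
    have ij': "\<kappa> i \<noteq> \<kappa> j" using ij by (simp add: P_def)
    have "card {i, j, r} = 3" using r(2,3) ij' by (auto simp: card_insert_if)
    then show "3 \<le> card (S \<inter> vec.span {i, j})" by (simp add: r(1))
    fix a b assume "a \<in> S \<inter> vec.span {i, j}" "b \<in> S \<inter> vec.span {i, j}" "a \<noteq> b"
    then show "(a, b) \<in> P" using r ij' unfolding P_def by auto
  qed auto
  define C where "C \<gamma> = {s \<in> S. \<kappa> s = \<gamma>}" for \<gamma>
  have finC: "finite (C \<gamma>)" for \<gamma> using finite_S by (simp add: C_def)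
  have fibre: "{q \<in> Q. \<kappa> (fst q) = \<gamma>} = C \<gamma> \<times> C \<gamma>" for \<gamma> by (auto simp: Q_def C_def)
  have sub: "(\<lambda>q. \<kappa> (fst q)) ` Q \<subseteq> \<kappa> ` S" by (auto simp: Q_def)
  have group: "(\<Sum>q\<in>Q. f q) = (\<Sum>\<gamma>\<in>\<kappa> ` S. \<Sum>q\<in>C \<gamma> \<times> C \<gamma>. f q)" for f :: "_ \<Rightarrow> real"
    using sum.group[OF fin(2) finite_imageI[OF finite_S] sub, of f] by (simp add: fibre)
  have "(CARD(5) / card S)\<^sup>2 / 5 * card Q = (\<Sum>\<gamma>\<in>\<kappa> ` S. (card (C \<gamma>) * (CARD(5) / card S))\<^sup>2 / 5)"
    using group[of "\<lambda>_. 1"]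
    by (simp add: card_cartesian_product sum_distrib_left power2_eq_square mult_ac)
  also have "\<dots> \<le> (\<Sum>\<gamma>\<in>\<kappa> ` S. \<Sum>(i, j)\<in>C \<gamma> \<times> C \<gamma>. h i j)"
  proof (rule sum_mono)
    fix \<gamma>
    have "(card (C \<gamma>) * (CARD(5) / card S))\<^sup>2
      \<le> vec.dim (UNIV :: (complex ^ 5) set) * (\<Sum>i\<in>C \<gamma>. \<Sum>j\<in>C \<gamma>. h i j)"
      by (rule h(3)) (auto simp: C_def)
    then show "(card (C \<gamma>) * (CARD(5) / card S))\<^sup>2 / 5 \<le> (\<Sum>(i, j)\<in>C \<gamma> \<times> C \<gamma>. h i j)"
      unfolding dim_UNIV5 sum.cartesian_product[symmetric] by simp
  qed
  also have "\<dots> = (\<Sum>(i, j)\<in>Q. h i j)" by (rule group[symmetric])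
  finally have Q_bound: "(CARD(5) / card S)\<^sup>2 / 5 * card Q \<le> (\<Sum>(i, j)\<in>Q. h i j)" .
  have "5 = (\<Sum>(i, j)\<in>S \<times> S. h i j)" using h(2) by (simp add: sum.cartesian_product)
  also have "\<dots> = (\<Sum>(i, j)\<in>P. h i j) + (\<Sum>(i, j)\<in>Q. h i j)"
    unfolding PQ(1) using fin PQ(2) by (rule sum.union_disjoint)
  finally have ineq: "(5 / n)\<^sup>2 / 4 * card P + (5 / n)\<^sup>2 / 5 * card Q \<le> 5"
    using P_bound Q_bound by (simp add: n_def)
  have "card (S \<times> S) = card P + card Q"
    unfolding PQ(1) using fin PQ(2) by (rule card_Un_disjoint)
  then have "real (card P) + real (card Q) = n * n"
    by (simp add: n_def card_cartesian_product flip: of_nat_add of_nat_mult)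
  then have Q_eq: "real (card Q) = n * n - card P" by simp
  \<comment> \<open>The excess factor 1/20 is 1/4 - 1/5; it multiplies the number of bichromatic
    pairs, which is positive because of \<open>p\<^sub>0\<close> and
    \<open>q\<^sub>0\<close>.\<close>
  have "(5 / n)\<^sup>2 / 4 * card P + (5 / n)\<^sup>2 / 5 * card Q = 5 + (5 / n)\<^sup>2 / 20 * card P"
    unfolding Q_eq using n by (simp add: power2_eq_square field_simps)
  with ineq have "(5 / n)\<^sup>2 / 20 * card P \<le> 0" by simp
  moreover have "(p\<^sub>0, q\<^sub>0) \<in> P" using p\<^sub>0 q\<^sub>0 pq\<^sub>0 by (simp add: P_def)
  then have "0 < real (card P)" using fin(1) by (auto simp: card_gt_0_iff)
  then have "0 < (5 / n)\<^sup>2 / 20 * card P" using n by simp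
  ultimately show False by simp
qed

end

section \<open>Passage to vectors\<close>

lemma complex_affine_dim_hull_le:
  fixes U :: "(complex ^ 'n) set"
  assumes "p \<in> U"
  shows "complex_affine_dim (complex_affine hull U) \<le> vec.dim ((\<lambda>x. x - p) ` U)"
proof -
  let ?V = "vec.span ((\<lambda>x. x - p) ` U)"
  define A where "A = {x. x - p \<in> ?V}"
  have "complex_affine A"
    unfolding complex_affine_def
  proof (intro ballI allI impI)
    fix x y and u v :: complex
    assume xy: "x \<in> A" "y \<in> A" and uv: "u + v = 1"
    have "u *s x + v *s y - p = u *s x + v *s y - (u + v) *s p" using uv by simp
    also have "\<dots> = u *s (x - p) + v *s (y - p)"
      by (simp add: vec_eq_iff algebra_simps)
    finally have eq: "u *s x + v *s y - p = u *s (x - p) + v *s (y - p)" .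
    show "u *s x + v *s y \<in> A"
      using xy unfolding A_def mem_Collect_eq eq by (intro vec.span_add vec.span_scale)
  qed
  moreover have "U \<subseteq> A" by (auto simp: A_def intro: vec.span_base)
  ultimately have hull: "complex_affine hull U \<subseteq> A" by (simp add: hull_minimal)
  have "{x - y | x y. x \<in> complex_affine hull U \<and> y \<in> complex_affine hull U} \<subseteq> ?V"
  proof clarify
    fix x y assume "x \<in> complex_affine hull U" "y \<in> complex_affine hull U"
    then have "x - p \<in> ?V" "y - p \<in> ?V" using hull by (auto simp: A_def)
    then have "(x - p) - (y - p) \<in> ?V" by (rule vec.span_diff)
    then show "x - y \<in> ?V" by simp
  qed
  then have "vec.dim {x - y | x y. x \<in> complex_affine hull U \<and> y \<in> complex_affine hull U}
    \<le> vec.dim ((\<lambda>x. x - p) ` U)"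
    by (rule vec.dim_mono)
  moreover have "complex_affine hull U \<noteq> {}" using hull_subset[of U complex_affine] assms by blast
  ultimately show ?thesis by (simp add: complex_affine_dim_def)
qed

lemma complex_collinear_affine_combination:
  assumes "complex_collinear {r, p, q}" "p \<noteq> q"
  obtains c where "r - p = c *s (q - p)"
proof -
  obtain u where u: "\<And>x y. x \<in> {r, p, q} \<Longrightarrow> y \<in> {r, p, q} \<Longrightarrow> \<exists>c. x - y = c *s u"
    using assms(1) unfolding complex_collinear_def by blast
  obtain a where a: "q - p = a *s u" using u[of q p] by auto
  obtain b where b: "r - p = b *s u" using u[of r p] by auto
  have "a \<noteq> 0" using a assms(2) by auto
  then have "r - p = (b / a) *s (q - p)" by (simp add: a b)
  then show ?thesis by (rule that)
qed

text \<open>Only the points in one 4-dimensional flat through \<open>p\<close> and \<open>q\<close>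
  are kept. The third-point property survives, because a line through two points of a flat stays in
  it.\<close>

lemma coloured_dim_bound:
  fixes U :: "(complex ^ 'n) set" and \<kappa> :: "complex ^ 'n \<Rightarrow> 'c"
  assumes fin: "finite U" and p: "p \<in> U" and q: "q \<in> U" and pq: "\<kappa> p \<noteq> \<kappa> q"
    and third: "\<And>s t. s \<in> U \<Longrightarrow> t \<in> U \<Longrightarrow> \<kappa> s \<noteq> \<kappa> t \<Longrightarrow>
      \<exists>r\<in>U. complex_collinear {r, s, t} \<and> \<kappa> r \<noteq> \<kappa> s \<and> \<kappa> r \<noteq> \<kappa> t"
  shows "vec.dim ((\<lambda>x. x - p) ` U) \<le> 3"
proof (rule ccontr)
  let ?D = "(\<lambda>x. x - p) ` U"
  assume "\<not> vec.dim ?D \<le> 3"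
  have "q - p \<noteq> 0" using pq by auto
  then have "vec.independent {q - p}" by simp
  \<comment> \<open>Starting the basis with \<open>q - p\<close> keeps \<open>q\<close> in the flat,
    so two colours remain.\<close>
  then obtain Bs where Bs: "{q - p} \<subseteq> Bs" "Bs \<subseteq> ?D" "vec.independent Bs" "?D \<subseteq> vec.span Bs"
    using vec.maximal_independent_subset_extend[of "{q - p}" ?D] q by auto
  have "card Bs = vec.dim ?D" by (rule vec.basis_card_eq_dim[OF Bs(2,4,3)])
  then have "4 \<le> card Bs" using \<open>\<not> vec.dim ?D \<le> 3\<close> by simp
  moreover have finB: "finite Bs" using Bs(3) by (rule vec.finiteI_independent)
  ultimately have "3 \<le> card (Bs - {q - p})" using Bs(1) by simp
  then obtain C' where C': "C' \<subseteq> Bs - {q - p}" "card C' = 3" "finite C'"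
    by (rule obtain_subset_with_card_n)
  define C where "C = insert (q - p) C'"
  have C: "C \<subseteq> Bs" "q - p \<in> C" "finite C" "card C = 4"
    using C' Bs(1) by (auto simp: C_def card_insert_if)
  have indep: "vec.independent C" using Bs(3) C(1) vec.independent_mono by blast
  \<comment> \<open>Index 0 is left free for the homogenising coordinate.\<close>
  have "card C = card (UNIV - {0 :: 5})" using C(4) by (simp add: card_Diff_subset)
  then obtain \<beta> where \<beta>: "bij_betw \<beta> C (UNIV - {0 :: 5})"
    using C(3) by (metis finite finite_same_card_bij)
  obtain f :: "complex ^ 'n \<Rightarrow> complex ^ 5" where f: "Vector_Spaces.linear (*s) (*s) f"
    "\<And>c. c \<in> C \<Longrightarrow> f c = axis (\<beta> c) 1"
    using vec.linear_independent_extend[OF indep, of "\<lambda>c. axis (\<beta> c) 1"] by blast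
  interpret f: Vector_Spaces.linear "(*s)" "(*s)" f by (rule f(1))
  have inj: "inj_on f C" using \<beta> by (auto simp: inj_on_def f(2) axis_eq_axis bij_betw_def)
  have "f ` C \<subseteq> cart_basis" using f(2) by (auto simp: cart_basis_def)
  then have "vec.independent (f ` C)" using independent_cart_basis vec.independent_mono by blast
  then have f_ker: "v = 0" if "v \<in> vec.span C" "f v = 0" for v
    using vec.linear_indep_image_lemma[OF f(1) C(3) _ inj that] by blast
  have f_0: "f v $ 0 = 0" if "v \<in> vec.span C" for v
  proof -
    have "vec.subspace {v. f v $ 0 = 0}"
      by (auto simp: vec.subspace_def f.add f.scale f.zero)
    moreover have "C \<subseteq> {v. f v $ 0 = 0}"
      using f(2) bij_betwE[OF \<beta>] by (auto simp: axis_def)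
    ultimately have "vec.span C \<subseteq> {v. f v $ 0 = 0}" by (intro vec.span_minimal) auto
    then show ?thesis using that by auto
  qed
  define T where "T = {s \<in> U. s - p \<in> vec.span C}"
  \<comment> \<open>Homogeneous coordinates: coordinate 0 equals 1 on all lifts, so parallel lifts
    coincide.\<close>
  define lift where "lift s = f (s - p) + axis 0 1" for s
  have lift_0: "lift s $ 0 = 1" if "s \<in> T" for s
    using f_0 that by (simp add: T_def lift_def axis_def)
  have inj_lift: "inj_on lift T"
  proof (rule inj_onI)
    fix s t assume st: "s \<in> T" "t \<in> T" "lift s = lift t"
    have "(s - p) - (t - p) \<in> vec.span C"
      using st(1,2) unfolding T_def by (blast intro: vec.span_diff)
    moreover have "f ((s - p) - (t - p)) = 0" using st(3) by (simp add: lift_def f.diff)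
    ultimately have "(s - p) - (t - p) = 0" by (rule f_ker)
    then show "s = t" by simp
  qed
  define \<kappa>' where "\<kappa>' v = \<kappa> (the_inv_into T lift v)" for v
  have \<kappa>': "\<kappa>' (lift s) = \<kappa> s" if "s \<in> T" for s
    using the_inv_into_f_f[OF inj_lift that] by (simp add: \<kappa>'_def)
  have pT: "p \<in> T" and qT: "q \<in> T" using p q C(2) by (auto simp: T_def vec.span_zero vec.span_base)
  have "spanning_coloured_configuration (lift ` T) \<kappa>' (lift p) (lift q)"
  proof
    show "finite (lift ` T)" using fin by (simp add: T_def)
    show "pairwise_nonparallel (lift ` T)"
      unfolding pairwise_nonparallel_def
    proof (intro conjI ballI impI)
      show "0 \<notin> lift ` T" using lift_0 by force
      fix u v assume uv: "u \<in> lift ` T" "v \<in> lift ` T" "u \<in> vec.span {v}"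
      then obtain c where c: "u = c *s v" unfolding mem_span_singleton by blast
      have "u $ 0 = 1" "v $ 0 = 1" using uv(1,2) lift_0 by auto
      then have "c = 1" using c by simp
      then show "u = v" using c by simp
    qed
    show "vec.span (lift ` T) = UNIV"
    proof -
      have "lift p = axis 0 1" by (simp add: lift_def f.zero)
      then have axis_0: "axis 0 1 \<in> vec.span (lift ` T)"
        using pT by (metis imageI vec.span_base)
      have "axis i 1 \<in> vec.span (lift ` T)" for i
      proof (cases "i = 0")
        case False
        then have "i \<in> \<beta> ` C" using bij_betw_imp_surj_on[OF \<beta>] by simp
        then obtain c where c: "c \<in> C" "\<beta> c = i" by blast
        then obtain s where s: "s \<in> U" "c = s - p" using C(1) Bs(2) by auto
        then have "s \<in> T" using c(1) by (auto simp: T_def intro: vec.span_base)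
        then have "lift s - axis 0 1 \<in> vec.span (lift ` T)"
          using axis_0 by (blast intro: vec.span_diff vec.span_base)
        then show ?thesis using f(2)[OF c(1)] c(2) s(2) by (simp add: lift_def)
      qed (use axis_0 in simp)
      then have "vec.span cart_basis \<subseteq> vec.span (lift ` T)"
        by (intro vec.span_minimal) (auto simp: cart_basis_def)
      then show ?thesis by auto
    qed
    show "\<exists>r\<in>lift ` T. r \<in> vec.span {u, v} \<and> \<kappa>' r \<noteq> \<kappa>' u \<and> \<kappa>' r \<noteq> \<kappa>' v"
      if uv: "u \<in> lift ` T" "v \<in> lift ` T" "\<kappa>' u \<noteq> \<kappa>' v" for u v
    proof -
      obtain s t where st: "s \<in> T" "t \<in> T" "u = lift s" "v = lift t" using uv by blast
      then have \<kappa>st: "\<kappa> s \<noteq> \<kappa> t" using uv(3) \<kappa>' by simp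
      then obtain r where r: "r \<in> U" "complex_collinear {r, s, t}" "\<kappa> r \<noteq> \<kappa> s" "\<kappa> r \<noteq> \<kappa> t"
        using third[of s t] st by (auto simp: T_def)
      obtain c where "r - s = c *s (t - s)"
        using complex_collinear_affine_combination[OF r(2)] \<kappa>st by metis
      then have "r - p = (s - p) + c *s ((t - p) - (s - p))" by (simp add: algebra_simps)
      then have rp: "r - p = (1 - c) *s (s - p) + c *s (t - p)"
        by (simp add: vec_eq_iff algebra_simps)
      moreover have "s - p \<in> vec.span C" "t - p \<in> vec.span C" using st(1,2) by (simp_all add: T_def)
      ultimately have "r - p \<in> vec.span C" by (metis vec.span_add vec.span_scale)
      then have rT: "r \<in> T" using r(1) by (simp add: T_def)
      have "lift r = (1 - c) *s lift s + c *s lift t"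
      proof -
        have "f (r - p) = (1 - c) *s f (s - p) + c *s f (t - p)"
          unfolding rp by (simp only: f.add f.scale)
        then show ?thesis unfolding lift_def by (simp add: vec_eq_iff algebra_simps)
      qed
      then have "lift r \<in> vec.span {u, v}" using st mem_span_pair by blast
      then show ?thesis using rT r(3,4) \<kappa>' st by auto
    qed
    show "lift p \<in> lift ` T" "lift q \<in> lift ` T" "\<kappa>' (lift p) \<noteq> \<kappa>' (lift q)"
      using pT qT pq \<kappa>' by auto
  qed
  then show False by (rule spanning_coloured_configuration.contradiction)
qed

text \<open>If only one of the sets were nonempty, the collinearity assumption would be vacuous and
  that set arbitrary; requiring two nonempty members excludes this.\<close>

theorem theorem3p7:
  fixes k :: nat and S :: "nat \<Rightarrow> (complex ^ 'n) set"
  assumes "k \<ge> 3"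
    and "\<And>i. i \<in> {1..k} \<Longrightarrow> finite (S i)"
    and "\<exists>i\<in>{1..k}. \<exists>j\<in>{1..k}. i \<noteq> j \<and> S i \<noteq> {} \<and> S j \<noteq> {}"
    and "\<And>i j p q. \<lbrakk>i \<in> {1..k}; j \<in> {1..k}; i \<noteq> j; p \<in> S i; q \<in> S j; p \<noteq> q\<rbrakk>
           \<Longrightarrow> \<exists>t \<in> {1..k} - {i, j}. \<exists>r \<in> S t - {p, q}. complex_collinear {r, p, q}"
  shows "complex_affine_dim (complex_affine hull (\<Union>i\<in>{1..k}. S i)) \<le> 3"
proof -
  define U where "U = (\<Union>i\<in>{1..k}. S i)"
  define col where "col s = {i \<in> {1..k}. s \<in> S i}" for s
  \<comment> \<open>A point lying in several of the sets gets a colour of its own.\<close>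
  define \<kappa> where "\<kappa> s = (col s, if is_singleton (col s) then None else Some s)" for s
  have fin: "finite U" using assms(2) by (simp add: U_def)
  have U_iff: "s \<in> U \<longleftrightarrow> col s \<noteq> {}" for s by (auto simp: U_def col_def)
  have third: "\<exists>r\<in>U. complex_collinear {r, s, t} \<and> \<kappa> r \<noteq> \<kappa> s \<and> \<kappa> r \<noteq> \<kappa> t"
    if st: "s \<in> U" "t \<in> U" "\<kappa> s \<noteq> \<kappa> t" for s t
  proof -
    \<comment> \<open>Otherwise \<open>col s\<close> and \<open>col t\<close> are the same
      singleton, and the colours agree.\<close>
    have "\<exists>i\<in>col s. \<exists>j\<in>col t. i \<noteq> j"
    proof (rule ccontr)
      assume "\<not> ?thesis"
      then have eq: "i = j" if "i \<in> col s" "j \<in> col t" for i j using that by blast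
      obtain i j where ij: "i \<in> col s" "j \<in> col t" using st(1,2) U_iff by blast
      have "col s = {i}" using eq[OF _ ij(2)] ij(1) by auto
      moreover have "col t = {i}" using eq[OF ij(1)] ij(2) by auto
      ultimately show False using st(3) by (simp add: \<kappa>_def)
    qed
    then obtain i j where ij: "i \<in> col s" "j \<in> col t" "i \<noteq> j" by blast
    have "s \<noteq> t" using st(3) by auto
    moreover have "i \<in> {1..k}" "j \<in> {1..k}" "s \<in> S i" "t \<in> S j"
      using ij by (simp_all add: col_def)
    ultimately obtain m r where m: "m \<in> {1..k} - {i, j}" "r \<in> S m - {s, t}" "complex_collinear {r,
      s, t}"
      using assms(4)[of i j s t] ij(3) by blast
    then have "m \<in> col r" by (auto simp: col_def)
    \<comment> \<open>Distinct points of equal colour have the same singleton \<open>col\<close>,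
      which cannot contain both \<open>m\<close> and \<open>l\<close>.\<close>
    have "\<kappa> r \<noteq> \<kappa> v" if v: "r \<noteq> v" "l \<in> col v" "l \<noteq> m" for v l
    proof
      assume eq: "\<kappa> r = \<kappa> v"
      then have "is_singleton (col r)" using v(1) by (auto simp: \<kappa>_def split: if_splits)
      moreover have "l \<in> col r" using eq v(2) by (simp add: \<kappa>_def)
      ultimately show False using \<open>m \<in> col r\<close> v(3) by (auto simp: is_singleton_def)
    qed
    then have "\<kappa> r \<noteq> \<kappa> s" "\<kappa> r \<noteq> \<kappa> t" using m ij by blast+
    then show ?thesis using m(3) \<open>m \<in> col r\<close> U_iff by blast
  qed
  obtain i j p q where ij: "i \<in> {1..k}" "j \<in> {1..k}" "i \<noteq> j" "p \<in> S i" "q \<in> S j"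
    using assms(3) by blast
  have pq: "p \<in> U" "q \<in> U" using ij by (auto simp: U_def)
  have "vec.dim ((\<lambda>x. x - p) ` U) \<le> 3"
  proof (cases "\<exists>s\<in>U. \<kappa> s \<noteq> \<kappa> p")
    case True
    then show ?thesis using coloured_dim_bound[OF fin pq(1) _ _ third] by metis
  next
    \<comment> \<open>If all points have one colour, its set of indices contains both
      \<open>i\<close> and \<open>j\<close>, so the colour determines the point and \<open>U\<close>
      reduces to \<open>p\<close>.\<close>
    case False
    have "i \<in> col p" "j \<in> col q" using ij by (auto simp: col_def)
    moreover have "col q = col p" using False pq(2) by (auto simp: \<kappa>_def)
    ultimately have "\<not> is_singleton (col p)" using ij(3) by (auto simp: is_singleton_def)
    then have "s = p" if "\<kappa> s = \<kappa> p" for s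
      using that by (simp add: \<kappa>_def split: if_splits)
    then have "s = p" if "s \<in> U" for s using False that by blast
    then have "(\<lambda>x. x - p) ` U \<subseteq> {0}" by auto
    then have "vec.dim ((\<lambda>x. x - p) ` U) = 0" by simp
    then show ?thesis by linarith
  qed
  then show ?thesis
    using complex_affine_dim_hull_le[OF pq(1)] by (simp add: U_def)
qed

end
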